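(* Let $\mathcal{M}=(K_{i(e)},w_e,p_e)_{e\in E}$ be a countable Markov system on a complete metric space $(K,d)$ which is contractive and uniformly continuous, with $b<\infty$. Then the following holds true. (i) Suppose $\mathcal{M}$ is non-degenerate and has a dominating Markov chain. Then $P(\mathcal{M})$ is not empty if and only if there exists $x_0\in K$ such that $(\alpha^{x_0}_n)_{n\in\mathbb{N}}$ is uniformly tight. (ii) Suppose $\mathcal{M}$ is consistent, has a dominating Markov chain, and there exists $x_0\in K$ such that $(\alpha^{x_0}_n)_{n\in\mathbb{N}}$ is uniformly tight. Then $P(\mathcal{M})$ is not empty. (iii) Every $\mu\in P(\mathcal{M})$ is tight. (iv) Suppose the sets $\{e\in E: i(e)=j\}$ and $\{e\in E: t(e)=j\}$ are finite for all $j\in N$. Then for every finite $c\subset N$ and every $\epsilon>0$ there exists a compact $C\subset K$ such that $$\mu(C)>\mu\Big(\bigcup_{i\in c}K_i\Big)-\epsilon\quad\text{for all }\mu\in P(\mathcal{M}).$$ (v) If $E$ is finite, then $P(\mathcal{M})$ is uniformly tight.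
   Context: Setting. $(K,d)$ is a complete metric space; $P(X)$ denotes the Borel probability measures on $X$. A countable Markov system $\mathcal{M}=(K_{i(e)},w_e,p_e)_{e\in E}$ on $K$ consists of: a set $N\subset\mathbb{N}$ with $1\in N$; a partition $(K_j)_{j\in N}$ of $K$ into non-empty Borel sets; an at most countable set $E$; a surjective map $i:E\to N$ and a map $t:E\to N$; for each $e\in E$, Borel measurable $w_e:K_{i(e)}\to K_{t(e)}$ and $p_e:K_{i(e)}\to[0,1]$ with $p_e\not\equiv 0$, such that $\sum_{e\in E,\,i(e)=j}p_e(x)=1$ for all $x\in K_j$, $j\in N$. Each $p_e$ is extended to $K$ by zero and each $w_e$ is extended to a Borel map $K\to K$ arbitrarily. For Borel $f:K\to[0,\infty)$, $Uf:=\sum_{e\in E}p_e\,f\circ w_e$; $U^*\nu(f):=\int Uf\,d\nu$ for bounded such $f$, $\nu\in P(K)$. $P(\mathcal{M}):=\{\mu\in P(K): U^*\mu=\mu\}$. $\mathcal{M}$ is contractive with contraction rate $0<a<1$ iff $\sum_{e\in E,\,i(e)=j}p_e(x)d(w_ex,w_ey)\le a\,d(x,y)$ for all $x,y\in K_j$, $j\in N$. $\mathcal{M}$ is uniformly continuous iff $w_e|_{K_{i(e)}}$ and $p_e|_{K_{i(e)}}$ are uniformly continuous for each $e\in E$. Code space. $\bar E:=E\cup\{\infty\}$ is the one-point compactification of discrete $E$; $w_\infty:=\mathrm{id}$, $p_\infty:=0$, $i(\infty)=t(\infty):=1$. $\bar\Sigma:=\bar E^{\mathbb{Z}}$ with the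 product topology; $(S\sigma)_{i-1}=\sigma_i$; $P_S(\bar\Sigma)$ is the set of $S$-invariant Borel probability measures. ${}_m[e_m,\dots,e_n]:=\{\sigma\in\bar\Sigma:\sigma_i=e_i,\ m\le i\le n\}$. $\mathcal{F}$ is the $\sigma$-algebra generated by all cylinders ${}_m[e_m,\dots,e_0]$, $m\le 0$. $\Sigma_G:=\{\sigma\in\bar\Sigma: \sigma_n\in E,\ i(\sigma_{n+1})=t(\sigma_n)\ \forall n\in\mathbb{Z}\}$. Fix $x_i\in K_i$ for each $i\in N$. $D:=\{\sigma\in\Sigma_G:\lim_{m\to-\infty}w_{\sigma_0}\circ\dots\circ w_{\sigma_m}(x_{i(\sigma_m)})\text{ exists}\}$; $F:\bar\Sigma\to K$ is this limit on $D$, and $F(\sigma):=x_{t(\sigma_0)}$ for $\sigma\notin D$. $F(\Lambda):=\Lambda\circ F^{-1}$ for measures $\Lambda$ on $\bar\Sigma$. $b:=\sup_{i\in N}\sup_{x\in K_i}\sum_{e\in E,\,i(e)=i}p_e(x)\,d(w_e(x_{i(e)}),x_{t(e)})$. $T_j:=\{\sigma\in\Sigma_G:t(\sigma_0)=j\}$. $\bar p_e$ is the continuous extension of $p_e|_{K_{i(e)}}$ to $\bar K_{i(e)}$, extended by zero to $K$. $\tilde E(\mathcal{M})$ is the set of $\Lambda\in P_S(\bar\Sigma)$ with $\Lambda(D)=1$ and $E_\Lambda(1_{{}_1[e]}|\mathcal{F})=(\bar p_e\circ F)\,1_{T_{i(e)}}$ $\Lambda$-a.e. for all $e\in E$. $\mathcal{M}$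 is non-degenerate iff for every $\Lambda\in\tilde E(\mathcal{M})$ there exists $i\in N$ with $\Lambda(T_i\cap F^{-1}(K_i))>0$. $\mathcal{M}$ is consistent iff $F(M)\in P(\mathcal{M})$ for all $M\in\tilde E(\mathcal{M})$. $\mathcal{M}$ has a dominating Markov chain iff $\sum_{e\in E,\,i(e)=i}\sup_{x\in K_i}p_e(x)<\infty$ for every $i\in N$. For $x\in K$, $\alpha^x_n(\{j\}):=\frac1n\sum_{k=1}^n {U^*}^k\delta_x(K_j)$, $j\in N$, a probability measure on $N$; $(\alpha^{x}_n)_n$ is uniformly tight iff for every $\epsilon>0$ there is a finite $V\subset N$ with $\alpha^{x}_n(N\setminus V)<\epsilon$ for all $n\in\mathbb{N}$. A set of Borel measures $\{\Lambda_i\}$ on a topological space $X$ is (uniformly) tight iff for every $\epsilon>0$ there is a compact $C\subset X$ with $\Lambda_i(X\setminus C)<\epsilon$ for all $i$. *)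

theory Defs
  imports "HOL-Probability.Probability"
begin

text \<open>
  The complete metric space \<open>K\<close> is the type \<open>'k :: complete_space\<close>.  Sums of nonnegative terms over
  index sets are taken in \<^typ>\<open>ennreal\<close> as integrals with respect to the counting measure.
\<close>

section \<open>Countable Markov systems\<close>

record ('k, 'e) markov_sys =
  idx :: "nat set"
  cell :: "nat \<Rightarrow> 'k set"
  edges :: "'e set"
  src :: "'e \<Rightarrow> nat"
  tgt :: "'e \<Rightarrow> nat"
  mp :: "'e \<Rightarrow> 'k \<Rightarrow> 'k"
  pr :: "'e \<Rightarrow> 'k \<Rightarrow> real"

definition out_edges :: "('k, 'e) markov_sys \<Rightarrow> nat \<Rightarrow> 'e set" where
  "out_edges M j = {e \<in> edges M. src M e = j}"

definition in_edges :: "('k, 'e) markov_sys \<Rightarrow> nat \<Rightarrow> 'e set" where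
  "in_edges M j = {e \<in> edges M. tgt M e = j}"

text \<open>
  \<^term>\<open>mp M e\<close> and \<^term>\<open>pr M e\<close> are the maps already extended to all of \<open>K\<close>: the former to an
  arbitrary Borel map, the latter by zero.
\<close>

definition markov_system :: "('k :: complete_space, 'e) markov_sys \<Rightarrow> bool" where
  "markov_system M \<longleftrightarrow>
     idx M \<subseteq> {1..} \<and> 1 \<in> idx M \<and>
     (\<forall>j \<in> idx M. cell M j \<noteq> {} \<and> cell M j \<in> sets borel) \<and>
     disjoint_family_on (cell M) (idx M) \<and> (\<Union>j \<in> idx M. cell M j) = UNIV \<and>
     countable (edges M) \<and> src M ` edges M = idx M \<and> tgt M ` edges M \<subseteq> idx M \<and>
     (\<forall>e \<in> edges M.
        mp M e \<in> borel \<rightarrow>\<^sub>M borel \<and> mp M e ` cell M (src M e) \<subseteq> cell M (tgt M e) \<and>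
        pr M e \<in> borel \<rightarrow>\<^sub>M borel \<and>
        (\<forall>y \<in> cell M (src M e). 0 \<le> pr M e y \<and> pr M e y \<le> 1) \<and>
        (\<exists>y \<in> cell M (src M e). pr M e y \<noteq> 0) \<and>
        (\<forall>y. y \<notin> cell M (src M e) \<longrightarrow> pr M e y = 0)) \<and>
     (\<forall>j \<in> idx M. \<forall>y \<in> cell M j. (\<integral>\<^sup>+ e. ennreal (pr M e y) \<partial>count_space (out_edges M j)) = 1)"

definition contractive :: "('k :: complete_space, 'e) markov_sys \<Rightarrow> bool" where
  "contractive M \<longleftrightarrow> (\<exists>a::real. 0 < a \<and> a < 1 \<and>
     (\<forall>j \<in> idx M. \<forall>y \<in> cell M j. \<forall>z \<in> cell M j.
        (\<integral>\<^sup>+ e. ennreal (pr M e y * dist (mp M e y) (mp M e z)) \<partial>count_space (out_edges M j))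
          \<le> ennreal (a * dist y z)))"

definition uniformly_continuous_system :: "('k :: complete_space, 'e) markov_sys \<Rightarrow> bool" where
  "uniformly_continuous_system M \<longleftrightarrow> (\<forall>e \<in> edges M.
     uniformly_continuous_on (cell M (src M e)) (mp M e) \<and>
     uniformly_continuous_on (cell M (src M e)) (pr M e))"

definition dominating_chain :: "('k :: complete_space, 'e) markov_sys \<Rightarrow> bool" where
  "dominating_chain M \<longleftrightarrow> (\<forall>j \<in> idx M.
     (\<integral>\<^sup>+ e. (SUP y \<in> cell M j. ennreal (pr M e y)) \<partial>count_space (out_edges M j)) < \<infinity>)"

definition bsup :: "('k :: complete_space, 'e) markov_sys \<Rightarrow> (nat \<Rightarrow> 'k) \<Rightarrow> ennreal" where
  "bsup M x = (SUP j \<in> idx M. SUP y \<in> cell M j.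
     \<integral>\<^sup>+ e. ennreal (pr M e y * dist (mp M e (x (src M e))) (x (tgt M e))) \<partial>count_space (out_edges M j))"


section \<open>The Markov operator and invariant measures\<close>

definition borel_probs :: "'k :: topological_space measure set" where
  "borel_probs = {\<nu>. sets \<nu> = sets borel \<and> prob_space \<nu>}"

definition Uop :: "('k, 'e) markov_sys \<Rightarrow> ('k \<Rightarrow> ennreal) \<Rightarrow> 'k \<Rightarrow> ennreal" where
  "Uop M f y = (\<integral>\<^sup>+ e. ennreal (pr M e y) * f (mp M e y) \<partial>count_space (edges M))"

text \<open>
  \<open>Ustar M \<nu>\<close> is the measure whose integral functional is \<open>f \<mapsto> \<integral> Uop M f d\<nu>\<close>; see
  \<open>nn_integral_Ustar\<close> below.
\<close>

definition Ustar :: "('k :: topological_space, 'e) markov_sys \<Rightarrow> 'k measure \<Rightarrow> 'k measure" where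
  "Ustar M \<nu> = measure_of UNIV (sets borel) (\<lambda>A. \<integral>\<^sup>+ y. Uop M (indicator A) y \<partial>\<nu>)"

definition invariant_probs :: "('k :: topological_space, 'e) markov_sys \<Rightarrow> 'k measure set" where
  "invariant_probs M = {\<mu> \<in> borel_probs. Ustar M \<mu> = \<mu>}"

definition alpha :: "('k :: topological_space, 'e) markov_sys \<Rightarrow> 'k \<Rightarrow> nat \<Rightarrow> nat measure" where
  "alpha M y n = point_measure (idx M)
     (\<lambda>j. ennreal (1 / real n * (\<Sum>k = 1..n. measure ((Ustar M ^^ k) (return borel y)) (cell M j))))"

definition alpha_tight :: "('k :: topological_space, 'e) markov_sys \<Rightarrow> 'k \<Rightarrow> bool" where
  "alpha_tight M y \<longleftrightarrow> (\<forall>\<epsilon>::real. \<epsilon> > 0 \<longrightarrow>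
     (\<exists>V \<subseteq> idx M. finite V \<and> (\<forall>n \<ge> 1. emeasure (alpha M y n) (idx M - V) < ennreal \<epsilon>)))"

definition uniformly_tight :: "'k :: topological_space measure set \<Rightarrow> bool" where
  "uniformly_tight \<L> \<longleftrightarrow> (\<forall>\<epsilon>::real. \<epsilon> > 0 \<longrightarrow>
     (\<exists>C. compact C \<and> (\<forall>\<Lambda> \<in> \<L>. emeasure \<Lambda> (UNIV - C) < ennreal \<epsilon>)))"


section \<open>The code space\<close>

text \<open>The point \<open>\<infinity>\<close> of the one-point compactification of \<open>E\<close> is \<^const>\<open>None\<close>.\<close>

fun srcb :: "('k, 'e) markov_sys \<Rightarrow> 'e option \<Rightarrow> nat" where
  "srcb M (Some e) = src M e"
| "srcb M None = 1"

fun tgtb :: "('k, 'e) markov_sys \<Rightarrow> 'e option \<Rightarrow> nat" where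
  "tgtb M (Some e) = tgt M e"
| "tgtb M None = 1"

fun mpb :: "('k, 'e) markov_sys \<Rightarrow> 'e option \<Rightarrow> 'k \<Rightarrow> 'k" where
  "mpb M (Some e) = mp M e"
| "mpb M None = id"

definition code_top :: "('k, 'e) markov_sys \<Rightarrow> (int \<Rightarrow> 'e option) topology" where
  "code_top M =
     product_topology (\<lambda>_. Alexandroff_compactification (discrete_topology (edges M))) UNIV"

definition code_space :: "('k, 'e) markov_sys \<Rightarrow> (int \<Rightarrow> 'e option) set" where
  "code_space M = topspace (code_top M)"

definition code_borel :: "('k, 'e) markov_sys \<Rightarrow> (int \<Rightarrow> 'e option) measure" where
  "code_borel M = sigma (code_space M) {G. openin (code_top M) G}"

definition shift :: "(int \<Rightarrow> 'e option) \<Rightarrow> int \<Rightarrow> 'e option" where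
  "shift \<sigma> = (\<lambda>i. \<sigma> (i + 1))"

definition shift_invariant_probs :: "('k, 'e) markov_sys \<Rightarrow> (int \<Rightarrow> 'e option) measure set" where
  "shift_invariant_probs M =
     {\<Lambda>. sets \<Lambda> = sets (code_borel M) \<and> prob_space \<Lambda> \<and> distr \<Lambda> \<Lambda> shift = \<Lambda>}"

text \<open>Only the values of \<open>\<eta>\<close> on \<open>{m..n}\<close> matter for the cylinder determined by \<open>\<eta>\<close>.\<close>

definition cylinder :: "('k, 'e) markov_sys \<Rightarrow> int \<Rightarrow> int \<Rightarrow> (int \<Rightarrow> 'e option) \<Rightarrow> (int \<Rightarrow> 'e option) set"
  where "cylinder M m n \<eta> = {\<sigma> \<in> code_space M. \<forall>i \<in> {m..n}. \<sigma> i = \<eta> i}"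

definition past_algebra :: "('k, 'e) markov_sys \<Rightarrow> (int \<Rightarrow> 'e option) measure" where
  "past_algebra M = sigma (code_space M) {cylinder M m 0 \<eta> | m \<eta>. m \<le> 0 \<and> \<eta> \<in> code_space M}"

definition Sigma_G :: "('k, 'e) markov_sys \<Rightarrow> (int \<Rightarrow> 'e option) set" where
  "Sigma_G M = {\<sigma> \<in> code_space M.
     \<forall>n. \<sigma> n \<in> Some ` edges M \<and> srcb M (\<sigma> (n + 1)) = tgtb M (\<sigma> n)}"

text \<open>\<open>past_comp M \<sigma> n\<close> is the composition \<open>w\<^bsub>\<sigma>\<^sub>0\<^esub> \<circ> \<dots> \<circ> w\<^bsub>\<sigma>\<^sub>m\<^esub>\<close> with \<open>m = -n\<close>.\<close>

fun past_comp :: "('k, 'e) markov_sys \<Rightarrow> (int \<Rightarrow> 'e option) \<Rightarrow> nat \<Rightarrow> 'k \<Rightarrow> 'k" where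
  "past_comp M \<sigma> 0 = mpb M (\<sigma> 0)"
| "past_comp M \<sigma> (Suc n) = past_comp M \<sigma> n \<circ> mpb M (\<sigma> (- int (Suc n)))"

definition past_point ::
    "('k, 'e) markov_sys \<Rightarrow> (nat \<Rightarrow> 'k) \<Rightarrow> (int \<Rightarrow> 'e option) \<Rightarrow> nat \<Rightarrow> 'k" where
  "past_point M x \<sigma> n = past_comp M \<sigma> n (x (srcb M (\<sigma> (- int n))))"

definition Dset :: "('k :: complete_space, 'e) markov_sys \<Rightarrow> (nat \<Rightarrow> 'k) \<Rightarrow> (int \<Rightarrow> 'e option) set" where
  "Dset M x = {\<sigma> \<in> Sigma_G M. convergent (past_point M x \<sigma>)}"

definition Fmap :: "('k :: complete_space, 'e) markov_sys \<Rightarrow> (nat \<Rightarrow> 'k) \<Rightarrow> (int \<Rightarrow> 'e option) \<Rightarrow> 'k" where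
  "Fmap M x \<sigma> = (if \<sigma> \<in> Dset M x then lim (past_point M x \<sigma>) else x (tgtb M (\<sigma> 0)))"

definition Tset :: "('k, 'e) markov_sys \<Rightarrow> nat \<Rightarrow> (int \<Rightarrow> 'e option) set" where
  "Tset M j = {\<sigma> \<in> Sigma_G M. tgtb M (\<sigma> 0) = j}"

definition pbar :: "('k :: complete_space, 'e) markov_sys \<Rightarrow> 'e \<Rightarrow> 'k \<Rightarrow> real" where
  "pbar M e = (THE g. continuous_on (closure (cell M (src M e))) g \<and>
     (\<forall>y \<in> cell M (src M e). g y = pr M e y) \<and>
     (\<forall>y. y \<notin> closure (cell M (src M e)) \<longrightarrow> g y = 0))"

definition Etilde ::
    "('k :: complete_space, 'e) markov_sys \<Rightarrow> (nat \<Rightarrow> 'k) \<Rightarrow> (int \<Rightarrow> 'e option) measure set" where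
  "Etilde M x = {\<Lambda> \<in> shift_invariant_probs M. emeasure \<Lambda> (Dset M x) = 1 \<and>
     (\<forall>e \<in> edges M. AE \<sigma> in \<Lambda>.
        real_cond_exp \<Lambda> (past_algebra M) (indicator (cylinder M 1 1 (\<lambda>_. Some e))) \<sigma> =
          pbar M e (Fmap M x \<sigma>) * indicator (Tset M (src M e)) \<sigma>)}"

definition nondegenerate :: "('k :: complete_space, 'e) markov_sys \<Rightarrow> (nat \<Rightarrow> 'k) \<Rightarrow> bool" where
  "nondegenerate M x \<longleftrightarrow> (\<forall>\<Lambda> \<in> Etilde M x. \<exists>j \<in> idx M.
     emeasure \<Lambda> (Tset M j \<inter> Fmap M x -` cell M j) > 0)"

definition consistent :: "('k :: complete_space, 'e) markov_sys \<Rightarrow> (nat \<Rightarrow> 'k) \<Rightarrow> bool" where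
  "consistent M x \<longleftrightarrow> (\<forall>\<Lambda> \<in> Etilde M x. distr \<Lambda> borel (Fmap M x) \<in> invariant_probs M)"


section \<open>Basic facts\<close>

lemma sets_Ustar [simp, measurable_cong]: "sets (Ustar M \<nu>) = sets borel"
  unfolding Ustar_def by (metis sets.sets_measure_of_eq space_borel)

lemma space_Ustar [simp]: "space (Ustar M \<nu>) = UNIV"
  unfolding Ustar_def by (simp add: space_measure_of_conv)

context
  fixes M :: "('k :: complete_space, 'e) markov_sys" and \<nu> :: "'k measure"
  assumes M: "markov_system M" and \<nu>: "sets \<nu> = sets borel"
begin

private definition \<kappa> :: "'e \<Rightarrow> 'k measure" where
  "\<kappa> e = distr (density \<nu> (\<lambda>y. ennreal (pr M e y))) borel (mp M e)"

private lemma sets_kappa [measurable_cong]: "sets (\<kappa> e) = sets borel"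
  by (simp add: \<kappa>_def)

private lemma nn_integral_Uop:
  assumes f [measurable]: "f \<in> borel_measurable borel"
  shows "(\<integral>\<^sup>+ y. Uop M f y \<partial>\<nu>) = (\<integral>\<^sup>+ e. (\<integral>\<^sup>+ y. f y \<partial>\<kappa> e) \<partial>count_space (edges M))"
proof -
  have meas: "mp M e \<in> \<nu> \<rightarrow>\<^sub>M borel" "pr M e \<in> \<nu> \<rightarrow>\<^sub>M borel" if "e \<in> edges M" for e
    using M that unfolding markov_system_def measurable_cong_sets[OF \<nu> refl] by blast+
  have term_meas: "(\<lambda>y. ennreal (pr M e y) * f (mp M e y)) \<in> borel_measurable \<nu>"
    if "e \<in> edges M" for e
  proof -
    note meas[OF that, measurable]
    show ?thesis by measurable
  qed
  have "countable (edges M)"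
    using M by (simp add: markov_system_def)
  then have "(\<integral>\<^sup>+ y. Uop M f y \<partial>\<nu>) =
      (\<integral>\<^sup>+ e. (\<integral>\<^sup>+ y. ennreal (pr M e y) * f (mp M e y) \<partial>\<nu>) \<partial>count_space (edges M))"
    unfolding Uop_def by (intro nn_integral_count_space_nn_integral term_meas)
  also have "\<dots> = (\<integral>\<^sup>+ e. (\<integral>\<^sup>+ y. f y \<partial>\<kappa> e) \<partial>count_space (edges M))"
  proof (intro nn_integral_cong)
    fix e assume "e \<in> space (count_space (edges M))"
    then have e: "e \<in> edges M" by simp
    note meas[OF e, measurable]
    show "(\<integral>\<^sup>+ y. ennreal (pr M e y) * f (mp M e y) \<partial>\<nu>) = (\<integral>\<^sup>+ y. f y \<partial>\<kappa> e)"
      unfolding \<kappa>_def by (simp add: nn_integral_distr nn_integral_density)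
  qed
  finally show ?thesis .
qed

private lemma nn_integral_Uop_indicator:
  assumes "A \<in> sets borel"
  shows "(\<integral>\<^sup>+ y. Uop M (indicator A) y \<partial>\<nu>) = (\<integral>\<^sup>+ e. emeasure (\<kappa> e) A \<partial>count_space (edges M))"
  using assms by (subst nn_integral_Uop) (auto simp: sets_kappa intro!: nn_integral_cong)

lemma emeasure_Ustar:
  assumes A: "A \<in> sets borel"
  shows "emeasure (Ustar M \<nu>) A = (\<integral>\<^sup>+ y. Uop M (indicator A) y \<partial>\<nu>)"
proof (rule emeasure_measure_of[OF Ustar_def])
  show "positive (sets (Ustar M \<nu>)) (\<lambda>A. \<integral>\<^sup>+ y. Uop M (indicator A) y \<partial>\<nu>)"
    by (simp add: positive_def Uop_def)
  show "countably_additive (sets (Ustar M \<nu>)) (\<lambda>A. \<integral>\<^sup>+ y. Uop M (indicator A) y \<partial>\<nu>)"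
  proof (rule countably_additiveI)
    fix B :: "nat \<Rightarrow> 'k set"
    assume B: "range B \<subseteq> sets (Ustar M \<nu>)" "disjoint_family B"
    then have [simp]: "B n \<in> sets borel" for n by auto
    have [simp]: "(\<Union>n. B n) \<in> sets borel" by (intro sets.countable_UN) auto
    have "(\<Sum>n. \<integral>\<^sup>+ y. Uop M (indicator (B n)) y \<partial>\<nu>) =
        (\<integral>\<^sup>+ e. (\<Sum>n. emeasure (\<kappa> e) (B n)) \<partial>count_space (edges M))"
      by (simp add: nn_integral_Uop_indicator nn_integral_suminf)
    also have "\<dots> = (\<integral>\<^sup>+ e. emeasure (\<kappa> e) (\<Union>n. B n) \<partial>count_space (edges M))"
      using B by (intro nn_integral_cong suminf_emeasure) (auto simp: sets_kappa)
    finally show "(\<Sum>n. \<integral>\<^sup>+ y. Uop M (indicator (B n)) y \<partial>\<nu>) =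
        (\<integral>\<^sup>+ y. Uop M (indicator (\<Union>n. B n)) y \<partial>\<nu>)"
      by (simp add: nn_integral_Uop_indicator)
  qed
qed (use A in auto)

lemma nn_integral_Ustar:
  assumes "f \<in> borel_measurable borel"
  shows "(\<integral>\<^sup>+ y. f y \<partial>Ustar M \<nu>) = (\<integral>\<^sup>+ y. Uop M f y \<partial>\<nu>)"
proof -
  have "(\<integral>\<^sup>+ y. f y \<partial>Ustar M \<nu>) = (\<integral>\<^sup>+ e. (\<integral>\<^sup>+ y. f y \<partial>\<kappa> e) \<partial>count_space (edges M))"
    using assms
  proof (induction rule: borel_measurable_induct)
    case (cong f g)
    then show ?case by (metis (no_types, lifting) UNIV_I ext space_borel)
  next
    case (set A)
    then show ?case
      by (simp add: emeasure_Ustar nn_integral_Uop_indicator sets_kappa)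
  next
    case (mult u c)
    note [measurable] = mult.hyps
    from mult.IH show ?case by (simp add: nn_integral_cmult)
  next
    case (add u v)
    note [measurable] = add.hyps
    from add.IH show ?case by (simp add: nn_integral_add)
  next
    case (seq W)
    note [measurable] = seq.hyps(1)
    have "incseq (\<lambda>n e. \<integral>\<^sup>+ y. W n y \<partial>\<kappa> e)"
      using seq.hyps by (auto simp: incseq_def le_fun_def intro!: nn_integral_mono)
    then show ?case
      using seq.IH seq.hyps
      by (simp add: nn_integral_monotone_convergence_SUP image_comp)
  qed
  then show ?thesis using assms by (simp add: nn_integral_Uop)
qed

end

end

theory Submission
  imports Defs
begin

text \<open>
  Write \<open>j(y)\<close> for the index of the cell of \<open>y\<close> and \<open>h(y) = d(y, x\<^bsub>j(y)\<^esub>)\<close>.  Two inequalities for the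
  operator \<open>U\<close> carry the proof: the contraction of distances within a cell, and the drift inequality
  \<open>U h \<le> a h + b\<close> (\<open>base_dist_drift\<close>), which bounds the mean of \<open>h\<close> under every invariant measure and
  along every orbit of the Markov chain of the system.

  Tightness.  Let \<open>A\<^sub>n(j)\<close> consist of the end points in cell \<open>j\<close> of all admissible paths with at most \<open>n\<close>
  edges that start at base points.  The distance \<open>g\<^sub>n(y)\<close> of \<open>y\<close> to \<open>A\<^sub>n(j(y))\<close> satisfies
  \<open>U g\<^bsub>n+1\<^esub> \<le> a g\<^sub>n\<close>, so its integral against an invariant measure is at most \<open>a\<^sup>n b / (1 - a)\<close>.  Hence an
  invariant measure lives on the closure of a countable set, where the classical theorem of Ulam gives
  tightness.  If only finitely many edges enter each cell, the sets \<open>A\<^sub>n(j)\<close> are finite and the bound is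
  the same for all invariant measures, which yields one compact set for all of them.

  From an invariant measure to tight frequencies.  The maximal ergodic inequality, applied to the
  indicators of tails of the cell partition, shows that the frequencies with which the chain visits
  the cells are tight for some starting point (\<open>invariant_imp_alpha_tight\<close>).

  From tight frequencies to a code measure.  Start the chain at a point with tight frequencies and
  average the laws of its words of length \<open>L\<close> over time.  The dominating chain turns tightness of
  frequencies into tightness of these averages (\<open>words_tight\<close>), so a diagonal subsequence converges for
  all \<open>L\<close>.  The limits are consistent under dropping the last letter, and also under dropping the first
  one because averaging makes the error vanish; Kolmogorov's extension theorem
  (\<open>stationary_process_of_consistent_words\<close>) yields a shift invariant \<open>\<Lambda>\<close>.  Under the averaged laws the
  mean distance between the position of the chain and the point coded by its last \<open>n\<close> letters is
  \<open>O(a\<^sup>n)\<close>, uniformly in time.  Therefore the coded points converge \<open>\<Lambda>\<close>-almost surely, and uniform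
  continuity of \<open>p\<^sub>e\<close> allows the true position to be replaced by the coded point in the law of the next letter
  (\<open>next_letter_law\<close>).  This is the conditional expectation formula that defines \<open>Etilde\<close>.

  From a code measure to an invariant measure.  For consistent systems this is the definition.  For
  non-degenerate ones, the set of codes whose coded point lies in its own cell has positive measure and
  is mapped into itself by the shift up to a null set, because \<open>w\<^sub>e\<close> is continuous on its cell.  Conditioning on this set
  and projecting to \<open>K\<close> gives an invariant measure (\<open>nondegenerate_imp_invariant\<close>).
\<close>

section \<open>Countable Markov systems as Markov chains\<close>

locale markov =
  fixes M :: "('k :: complete_space, 'e) markov_sys"
  assumes sys: "markov_system M"
begin

definition cell_of :: "'k \<Rightarrow> nat" where
  "cell_of y = (THE j. j \<in> idx M \<and> y \<in> cell M j)"

lemma countable_edges: "countable (edges M)"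
  using sys by (simp add: markov_system_def)

lemma cell_borel [measurable]: "j \<in> idx M \<Longrightarrow> cell M j \<in> sets borel"
  using sys by (simp add: markov_system_def)

lemma src_in [simp]: "e \<in> edges M \<Longrightarrow> src M e \<in> idx M"
  using sys by (auto simp: markov_system_def)

lemma tgt_in [simp]: "e \<in> edges M \<Longrightarrow> tgt M e \<in> idx M"
  using sys by (auto simp: markov_system_def)

lemma src_surj: "src M ` edges M = idx M"
  using sys by (simp add: markov_system_def)

lemma cell_disjoint: "disjoint_family_on (cell M) (idx M)"
  using sys by (simp add: markov_system_def)

lemma cell_cover: "(\<Union>j \<in> idx M. cell M j) = UNIV"
  using sys by (simp add: markov_system_def)

lemma cell_of_eq: "j \<in> idx M \<Longrightarrow> y \<in> cell M j \<Longrightarrow> cell_of y = j"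
  using cell_disjoint unfolding cell_of_def disjoint_family_on_def
  by (intro the_equality) blast+

lemma cell_of_in [simp]: "cell_of y \<in> idx M" and in_cell_of [simp]: "y \<in> cell M (cell_of y)"
proof -
  obtain j where "j \<in> idx M" "y \<in> cell M j"
    using cell_cover by blast
  then show "cell_of y \<in> idx M" "y \<in> cell M (cell_of y)"
    using cell_of_eq by auto
qed

lemma in_cell_iff: "j \<in> idx M \<Longrightarrow> y \<in> cell M j \<longleftrightarrow> cell_of y = j"
  using cell_of_eq by fastforce

lemma edge_facts:
  assumes "e \<in> edges M"
  shows mp_meas: "mp M e \<in> borel \<rightarrow>\<^sub>M borel"
    and pr_meas: "pr M e \<in> borel \<rightarrow>\<^sub>M borel"
    and mp_cell: "mp M e ` cell M (src M e) \<subseteq> cell M (tgt M e)"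
    and pr_bounds: "\<forall>y \<in> cell M (src M e). 0 \<le> pr M e y \<and> pr M e y \<le> 1"
    and pr_zero: "\<forall>y. y \<notin> cell M (src M e) \<longrightarrow> pr M e y = 0"
  using sys assms unfolding markov_system_def by blast+

lemma pr_outside: "e \<in> edges M \<Longrightarrow> cell_of y \<noteq> src M e \<Longrightarrow> pr M e y = 0"
  using pr_zero in_cell_iff src_in by blast

lemma pr_nonneg: "e \<in> edges M \<Longrightarrow> 0 \<le> pr M e y"
  using pr_bounds[of e] pr_zero[of e] by (metis order_refl)

lemma pr_le_1: "e \<in> edges M \<Longrightarrow> pr M e y \<le> 1"
  using pr_bounds[of e] pr_zero[of e] by (metis zero_le_one)

lemma cell_of_mp: "e \<in> edges M \<Longrightarrow> src M e = cell_of y \<Longrightarrow> cell_of (mp M e y) = tgt M e"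
  using mp_cell[of e] in_cell_of[of y] by (intro cell_of_eq) auto

lemma nn_integral_edges_eq_out:
  assumes "\<And>e. e \<in> edges M \<Longrightarrow> src M e \<noteq> j \<Longrightarrow> f e = 0"
  shows "(\<integral>\<^sup>+ e. f e \<partial>count_space (edges M)) = (\<integral>\<^sup>+ e. f e \<partial>count_space (out_edges M j))"
proof -
  have "(\<integral>\<^sup>+ e. f e \<partial>count_space (edges M)) = (\<integral>\<^sup>+ e. f e * indicator (edges M) e \<partial>count_space UNIV)"
    by (simp add: nn_integral_count_space_indicator)
  also have "\<dots> = (\<integral>\<^sup>+ e. f e * indicator (out_edges M j) e \<partial>count_space UNIV)"
    using assms by (intro nn_integral_cong) (auto simp: indicator_def out_edges_def)
  also have "\<dots> = (\<integral>\<^sup>+ e. f e \<partial>count_space (out_edges M j))"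
    by (simp add: nn_integral_count_space_indicator)
  finally show ?thesis .
qed

lemma sum_pr: "(\<integral>\<^sup>+ e. ennreal (pr M e y) \<partial>count_space (edges M)) = 1"
proof -
  have "(\<integral>\<^sup>+ e. ennreal (pr M e y) \<partial>count_space (edges M)) =
     (\<integral>\<^sup>+ e. ennreal (pr M e y) \<partial>count_space (out_edges M (cell_of y)))"
    by (intro nn_integral_edges_eq_out) (auto simp: pr_outside)
  also have "\<dots> = 1"
    using sys cell_of_in[of y] in_cell_of[of y] unfolding markov_system_def by blast
  finally show ?thesis .
qed

text \<open>
  The law of the edge taken at \<open>y\<close>.  As a probability mass function it lets the laws of paths be
  composed without measurability conditions on \<open>K\<close>, and it turns \<open>U f (y)\<close> into the mean of \<open>f\<close>
  after one step (\<open>Uop_step\<close>).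
\<close>

definition step :: "'k \<Rightarrow> 'e pmf" where
  "step y = embed_pmf (\<lambda>e. if e \<in> edges M then pr M e y else 0)"

lemma pmf_step: "pmf (step y) e = (if e \<in> edges M then pr M e y else 0)"
  unfolding step_def
proof (rule pmf_embed_pmf)
  have "(\<integral>\<^sup>+ e. ennreal (if e \<in> edges M then pr M e y else 0) \<partial>count_space UNIV)
     = (\<integral>\<^sup>+ e. ennreal (pr M e y) \<partial>count_space (edges M))"
    by (auto simp: nn_integral_count_space_indicator indicator_def intro!: nn_integral_cong)
  then show "(\<integral>\<^sup>+ e. ennreal (if e \<in> edges M then pr M e y else 0) \<partial>count_space UNIV) = 1"
    by (simp add: sum_pr)
qed (simp add: pr_nonneg)

lemma set_step: "e \<in> set_pmf (step y) \<Longrightarrow> e \<in> edges M \<and> src M e = cell_of y"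
  using pr_outside[of e y] unfolding set_pmf_iff pmf_step by metis

lemma nn_integral_step: "(\<integral>\<^sup>+ e. f e \<partial>step y) = (\<integral>\<^sup>+ e. ennreal (pr M e y) * f e \<partial>count_space (edges M))"
  unfolding nn_integral_measure_pmf pmf_step
  by (auto simp: nn_integral_count_space_indicator indicator_def intro!: nn_integral_cong)

lemma nn_integral_step_out:
  "(\<integral>\<^sup>+ e. f e \<partial>step y) = (\<integral>\<^sup>+ e. ennreal (pr M e y) * f e \<partial>count_space (out_edges M (cell_of y)))"
  unfolding nn_integral_step by (rule nn_integral_edges_eq_out) (simp add: pr_outside)

lemma Uop_step: "Uop M f y = (\<integral>\<^sup>+ e. f (mp M e y) \<partial>step y)"
  by (simp add: Uop_def nn_integral_step)

lemma Uop_mono: "(\<And>z. f z \<le> g z) \<Longrightarrow> Uop M f y \<le> Uop M g y"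
  unfolding Uop_step by (rule nn_integral_mono)

lemma Uop_const: "Uop M (\<lambda>_. c) y = c"
  by (simp add: Uop_step)

lemma Uop_add: "Uop M (\<lambda>z. f z + g z) y = Uop M f y + Uop M g y"
  by (simp add: Uop_step nn_integral_add)

lemma Uop_measurable [measurable]:
  assumes f [measurable]: "f \<in> borel_measurable borel"
  shows "Uop M f \<in> borel_measurable borel"
proof -
  interpret sigma_finite_measure "count_space (edges M)"
    by (rule sigma_finite_measure_count_space_countable[OF countable_edges])
  have *: "(\<lambda>y. ennreal (pr M e y) * f (mp M e y)) \<in> borel_measurable borel" if "e \<in> edges M" for e
  proof -
    note [measurable] = mp_meas[OF that] pr_meas[OF that]
    show ?thesis by measurable
  qed
  have "(\<lambda>p. ennreal (pr M (fst p) (snd p)) * f (mp M (fst p) (snd p)))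
      \<in> borel_measurable (count_space (edges M) \<Otimes>\<^sub>M borel)"
    by (intro measurable_pair_measure_countable1 countable_edges) (use * in simp)
  from measurable_compose[OF measurable_pair_swap' this]
  have "(\<lambda>(y, e). ennreal (pr M e y) * f (mp M e y)) \<in> borel_measurable (borel \<Otimes>\<^sub>M count_space (edges M))"
    by (simp add: case_prod_beta)
  from borel_measurable_nn_integral[OF this] show ?thesis
    by (simp add: Uop_def[abs_def] )
qed

lemma cell_of_measurable [measurable]: "cell_of \<in> borel \<rightarrow>\<^sub>M count_space UNIV"
proof (rule measurable_count_space_eq_countable[THEN iffD2, rule_format], rule countableI_type, safe)
  fix j :: nat
  have "cell_of -` {j} \<inter> space borel = (if j \<in> idx M then cell M j else {})"
    using in_cell_iff by (auto split: if_splits)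
  then show "cell_of -` {j} \<inter> space borel \<in> sets (borel :: 'k measure)"
    by auto
qed auto

lemma nn_integral_invariant:
  assumes "\<mu> \<in> invariant_probs M" "f \<in> borel_measurable borel"
  shows "(\<integral>\<^sup>+ y. Uop M f y \<partial>\<mu>) = (\<integral>\<^sup>+ y. f y \<partial>\<mu>)"
  using nn_integral_Ustar[OF sys _ assms(2), of \<mu>] assms(1)
  by (auto simp: invariant_probs_def borel_probs_def)

end

text \<open>
  A contraction rate \<open>a\<close> and a finite bound \<open>b\<close> of \<open>bsup\<close> are parameters, so that the estimates below
  have explicit constants.
\<close>

locale contractive_markov = markov M for M :: "('k :: complete_space, 'e) markov_sys" +
  fixes x :: "nat \<Rightarrow> 'k" and a b :: real
  assumes x_in: "j \<in> idx M \<Longrightarrow> x j \<in> cell M j"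
    and a_pos: "0 < a" and a_less_1: "a < 1"
    and contraction: "j \<in> idx M \<Longrightarrow> y \<in> cell M j \<Longrightarrow> z \<in> cell M j \<Longrightarrow>
        (\<integral>\<^sup>+ e. ennreal (pr M e y * dist (mp M e y) (mp M e z)) \<partial>count_space (out_edges M j))
          \<le> ennreal (a * dist y z)"
    and b_nonneg: "0 \<le> b"
    and bsup_le: "bsup M x \<le> ennreal b"
    and unif_cont: "uniformly_continuous_system M"
begin

definition base_dist :: "'k \<Rightarrow> real" where
  "base_dist y = dist y (x (cell_of y))"

lemma base_dist_nonneg [simp]: "0 \<le> base_dist y"
  by (simp add: base_dist_def)

lemma cell_of_x [simp]: "j \<in> idx M \<Longrightarrow> cell_of (x j) = j"
  by (rule cell_of_eq[OF _ x_in])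

lemma piecewise_measurable:
  assumes "\<And>j. f j \<in> borel \<rightarrow>\<^sub>M N"
  shows "(\<lambda>y::'k. f (cell_of y) y) \<in> borel \<rightarrow>\<^sub>M N"
  using assms by (rule measurable_compose_countable) measurable

lemma base_dist_measurable [measurable]: "base_dist \<in> borel_measurable borel"
  unfolding base_dist_def by (rule piecewise_measurable) (intro borel_measurable_continuous_onI continuous_intros)

lemma contraction_step:
  assumes "cell_of y = cell_of z"
  shows "(\<integral>\<^sup>+ e. ennreal (dist (mp M e y) (mp M e z)) \<partial>step y) \<le> ennreal (a * dist y z)"
proof -
  let ?O = "count_space (out_edges M (cell_of y))"
  have "(\<integral>\<^sup>+ e. ennreal (dist (mp M e y) (mp M e z)) \<partial>step y)
      = (\<integral>\<^sup>+ e. ennreal (pr M e y * dist (mp M e y) (mp M e z)) \<partial>?O)"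
    unfolding nn_integral_step_out
    by (intro nn_integral_cong) (auto simp: out_edges_def ennreal_mult pr_nonneg)
  also have "\<dots> \<le> ennreal (a * dist y z)"
    using in_cell_of[of z] in_cell_of[of y] by (intro contraction) (auto simp: assms simp del: in_cell_of)
  finally show ?thesis .
qed

lemma base_points_step:
  "(\<integral>\<^sup>+ e. ennreal (dist (mp M e (x (src M e))) (x (tgt M e))) \<partial>step y) \<le> ennreal b"
proof -
  let ?O = "count_space (out_edges M (cell_of y))"
  have "(\<integral>\<^sup>+ e. ennreal (dist (mp M e (x (src M e))) (x (tgt M e))) \<partial>step y)
      = (\<integral>\<^sup>+ e. ennreal (pr M e y * dist (mp M e (x (src M e))) (x (tgt M e))) \<partial>?O)"
    unfolding nn_integral_step_out
    by (intro nn_integral_cong) (auto simp: out_edges_def ennreal_mult pr_nonneg)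
  also have "\<dots> \<le> bsup M x"
    unfolding bsup_def by (intro SUP_upper2[OF cell_of_in[of y]] SUP_upper2[OF in_cell_of]) simp
  finally show ?thesis using bsup_le by (rule order.trans)
qed

text \<open>
  Compare \<open>w\<^sub>e y\<close> with \<open>w\<^sub>e x\<^sub>j\<close> for the base point \<open>x\<^sub>j\<close> of the cell of \<open>y\<close>: contraction bounds the mean
  distance of the two, and \<open>b\<close> bounds the mean distance of \<open>w\<^sub>e x\<^sub>j\<close> from the base point of its cell.
\<close>

lemma base_dist_drift: "Uop M (\<lambda>y. ennreal (base_dist y)) y \<le> ennreal (a * base_dist y + b)"
proof -
  let ?z = "x (cell_of y)"
  have "Uop M (\<lambda>y. ennreal (base_dist y)) y
      \<le> (\<integral>\<^sup>+ e. ennreal (dist (mp M e y) (mp M e ?z))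
          + ennreal (dist (mp M e (x (src M e))) (x (tgt M e))) \<partial>step y)"
    unfolding Uop_step
  proof (intro nn_integral_mono_AE AE_pmfI)
    fix e assume "e \<in> set_pmf (step y)"
    then have e: "e \<in> edges M" "src M e = cell_of y" using set_step by auto
    have "base_dist (mp M e y) \<le> dist (mp M e y) (mp M e ?z) + dist (mp M e (x (src M e))) (x (tgt M e))"
      unfolding base_dist_def using cell_of_mp[OF e] dist_triangle e(2) by metis
    then show "ennreal (base_dist (mp M e y)) \<le> ennreal (dist (mp M e y) (mp M e ?z))
        + ennreal (dist (mp M e (x (src M e))) (x (tgt M e)))"
      by (simp add: ennreal_leI flip: ennreal_plus)
  qed
  also have "\<dots> = (\<integral>\<^sup>+ e. ennreal (dist (mp M e y) (mp M e ?z)) \<partial>step y)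
      + (\<integral>\<^sup>+ e. ennreal (dist (mp M e (x (src M e))) (x (tgt M e))) \<partial>step y)"
    by (simp add: nn_integral_add)
  also have "\<dots> \<le> ennreal (a * base_dist y) + ennreal b"
    unfolding base_dist_def by (intro add_mono base_points_step contraction_step) simp
  also have "\<dots> = ennreal (a * base_dist y + b)" using a_pos b_nonneg by simp
  finally show ?thesis .
qed

end

section \<open>Tightness of invariant measures\<close>

text \<open>
  The intersection of the unions of balls is closed and totally bounded, hence compact.  It depends on
  the nets only, so it serves all measures at once.
\<close>

lemma tight_by_finite_nets:
  fixes T :: "nat \<Rightarrow> 'k :: complete_space set"
  assumes T: "\<And>k. finite (T k)" and \<epsilon>: "0 < (\<epsilon>::real)"
  obtains C where "compact C"
    and "\<And>\<mu> B. sets \<mu> = sets borel \<Longrightarrow> B \<in> sets borel \<Longrightarrow>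
      (\<And>k. emeasure \<mu> (B - (\<Union>t\<in>T k. cball t (1 / Suc k))) \<le> ennreal (\<epsilon> / 2 * (1/2) ^ Suc k))
      \<Longrightarrow> emeasure \<mu> (B - C) < ennreal \<epsilon>"
proof
  let ?G = "\<lambda>k. \<Union>t\<in>T k. cball t (1 / Suc k)"
  define C where "C = (\<Inter>k. ?G k)"
  have closed_G: "closed (?G k)" for k
    using T by auto
  then have "closed C" by (auto simp: C_def)
  moreover have "\<exists>A. finite A \<and> C \<subseteq> (\<Union>z\<in>A. ball z e)" if "e > 0" for e
  proof -
    obtain k where k: "1 / Suc k < e" using nat_approx_posE[OF \<open>e > 0\<close>] by auto
    have "C \<subseteq> ?G k" by (auto simp: C_def)
    also have "\<dots> \<subseteq> (\<Union>z\<in>T k. ball z e)" using k by fastforce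
    finally show ?thesis using T by blast
  qed
  ultimately show "compact C"
    by (simp add: compact_eq_totally_bounded complete_eq_closed)
  fix \<mu> :: "'k measure" and B
  assume [measurable_cong]: "sets \<mu> = sets borel" and [measurable]: "B \<in> sets borel"
    and le: "\<And>k. emeasure \<mu> (B - ?G k) \<le> ennreal (\<epsilon> / 2 * (1/2) ^ Suc k)"
  have [measurable]: "?G k \<in> sets borel" for k using closed_G by auto
  have sums: "(\<lambda>k. \<epsilon> / 2 * (1/2) ^ Suc k) sums (\<epsilon> / 2 * 1)"
    by (intro sums_mult power_half_series)
  have "range (\<lambda>k. B - ?G k) \<subseteq> sets \<mu>" by (intro image_subsetI) measurable
  note sub = emeasure_subadditive_countably[OF this]
  have "B - C = (\<Union>k. B - ?G k)" by (auto simp: C_def)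
  then have "emeasure \<mu> (B - C) = emeasure \<mu> (\<Union>k. B - ?G k)" by simp
  also have "\<dots> \<le> (\<Sum>k. emeasure \<mu> (B - ?G k))"
    by (rule sub)
  also have "\<dots> \<le> (\<Sum>k. ennreal (\<epsilon> / 2 * (1/2) ^ Suc k))"
    by (intro suminf_le le) auto
  also have "\<dots> = ennreal (\<epsilon> / 2 * 1)"
    using sums \<epsilon> by (intro suminf_ennreal_eq) auto
  also have "\<dots> < ennreal \<epsilon>" using \<epsilon> by (simp add: ennreal_less_iff)
  finally show "emeasure \<mu> (B - C) < ennreal \<epsilon>" .
qed

context contractive_markov
begin

lemma invariantD:
  assumes "\<mu> \<in> invariant_probs M"
  shows "sets \<mu> = sets borel" "prob_space \<mu>" "space \<mu> = UNIV"
  using assms sets_eq_imp_space_eq[of \<mu> borel] by (auto simp: invariant_probs_def borel_probs_def)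

text \<open>
  The drift inequality cannot be integrated directly while the mean of \<open>h\<close> may be infinite.  For
  \<open>c \<ge> b / (1 - a)\<close> it survives truncation at \<open>c\<close>, where invariance cancels the finite truncated
  integrals and leaves a bound for the integral of \<open>(1 - a) h\<close> over \<open>{h \<le> c}\<close>; then \<open>c\<close> tends to infinity.
\<close>

lemma nn_integral_base_dist_le:
  assumes \<mu>: "\<mu> \<in> invariant_probs M"
  shows "(\<integral>\<^sup>+ y. ennreal (base_dist y) \<partial>\<mu>) \<le> ennreal (b / (1 - a))"
proof -
  interpret prob_space \<mu> by (rule invariantD[OF \<mu>])
  note [measurable_cong] = invariantD(1)[OF \<mu>]
  have trunc: "(\<integral>\<^sup>+ y. ennreal ((1 - a) * base_dist y) * indicator {z. base_dist z \<le> c} y \<partial>\<mu>) \<le> ennreal b"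
    if c: "b \<le> (1 - a) * c" "0 \<le> c" for c
  proof -
    let ?A = "\<lambda>y. ennreal ((1 - a) * base_dist y) * indicator {z. base_dist z \<le> c} y"
    let ?B = "\<lambda>y. ennreal (min (a * base_dist y + b) c)"
    let ?\<phi> = "\<lambda>y. ennreal (min (base_dist y) c)"
    have "(\<integral>\<^sup>+ y. ?\<phi> y \<partial>\<mu>) = (\<integral>\<^sup>+ y. Uop M ?\<phi> y \<partial>\<mu>)"
      by (rule nn_integral_invariant[OF \<mu>, symmetric]) measurable
    also have "\<dots> \<le> (\<integral>\<^sup>+ y. ?B y \<partial>\<mu>)"
    proof (intro nn_integral_mono)
      fix y
      have "Uop M ?\<phi> y \<le> Uop M (\<lambda>y. ennreal (base_dist y)) y" by (intro Uop_mono) simp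
      also note base_dist_drift
      finally have 1: "Uop M ?\<phi> y \<le> ennreal (a * base_dist y + b)" .
      have "Uop M ?\<phi> y \<le> Uop M (\<lambda>y. ennreal c) y" by (intro Uop_mono) (simp add: ennreal_leI)
      then have 2: "Uop M ?\<phi> y \<le> ennreal c" by (simp add: Uop_const)
      from 1 2 show "Uop M ?\<phi> y \<le> ?B y" by (auto simp: min_def)
    qed
    finally have *: "(\<integral>\<^sup>+ y. ?\<phi> y \<partial>\<mu>) \<le> (\<integral>\<^sup>+ y. ?B y \<partial>\<mu>)" .
    have pw: "?B y + ?A y \<le> ?\<phi> y + ennreal b" for y
    proof (cases "base_dist y \<le> c")
      case True
      have "a * base_dist y + b \<le> a * c + (1 - a) * c" using True a_pos c by (intro add_mono mult_left_mono) auto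
      then have "a * base_dist y + b \<le> c" by (simp add: algebra_simps)
      then have "?B y + ?A y = ennreal ((a * base_dist y + b) + (1 - a) * base_dist y)"
        using True a_pos a_less_1 b_nonneg by (simp add: ennreal_plus[symmetric] del: ennreal_plus)
      also have "\<dots> = ?\<phi> y + ennreal b" using True b_nonneg by (simp add: algebra_simps min_absorb1)
      finally show ?thesis by simp
    next
      case False
      then show ?thesis using b_nonneg c by (auto simp: min_def ennreal_leI intro!: add_increasing2)
    qed
    have "(\<integral>\<^sup>+ y. ?B y \<partial>\<mu>) + (\<integral>\<^sup>+ y. ?A y \<partial>\<mu>) = (\<integral>\<^sup>+ y. ?B y + ?A y \<partial>\<mu>)"
      by (intro nn_integral_add[symmetric]) measurable
    also have "\<dots> \<le> (\<integral>\<^sup>+ y. ?\<phi> y + ennreal b \<partial>\<mu>)" by (intro nn_integral_mono pw)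
    also have "\<dots> = (\<integral>\<^sup>+ y. ?\<phi> y \<partial>\<mu>) + ennreal b" by (simp add: nn_integral_add emeasure_space_1)
    also have "\<dots> \<le> (\<integral>\<^sup>+ y. ?B y \<partial>\<mu>) + ennreal b" by (intro add_mono *) simp
    finally have "(\<integral>\<^sup>+ y. ?B y \<partial>\<mu>) + (\<integral>\<^sup>+ y. ?A y \<partial>\<mu>) \<le> (\<integral>\<^sup>+ y. ?B y \<partial>\<mu>) + ennreal b" .
    moreover have "(\<integral>\<^sup>+ y. ?B y \<partial>\<mu>) \<le> (\<integral>\<^sup>+ y. ennreal c \<partial>\<mu>)"
      by (intro nn_integral_mono) (simp add: ennreal_leI)
    then have "(\<integral>\<^sup>+ y. ?B y \<partial>\<mu>) < \<top>"
      using order.strict_trans1 by (fastforce simp: emeasure_space_1)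
    ultimately show ?thesis by (auto simp: ennreal_add_left_cancel_le)
  qed
  define c0 where "c0 = b / (1 - a)"
  have c0: "0 \<le> c0" using a_less_1 b_nonneg by (simp add: c0_def)
  have "(\<integral>\<^sup>+ y. ennreal ((1 - a) * base_dist y) \<partial>\<mu>)
     = (\<integral>\<^sup>+ y. (SUP n. ennreal ((1 - a) * base_dist y) * indicator {z. base_dist z \<le> c0 + real n} y) \<partial>\<mu>)"
  proof (intro nn_integral_cong antisym)
    fix y
    obtain n where "base_dist y \<le> real n" using real_arch_simple by blast
    then have "base_dist y \<le> c0 + real n" using c0 by simp
    then show "ennreal ((1 - a) * base_dist y) \<le> (SUP n. ennreal ((1 - a) * base_dist y) * indicator {z. base_dist z \<le> c0 + real n} y)"
      by (intro SUP_upper2[of n]) auto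
  qed (auto intro!: SUP_least split: split_indicator)
  also have "\<dots> = (SUP n. \<integral>\<^sup>+ y. ennreal ((1 - a) * base_dist y) * indicator {z. base_dist z \<le> c0 + real n} y \<partial>\<mu>)"
    by (intro nn_integral_monotone_convergence_SUP) (auto simp: incseq_def le_fun_def split: split_indicator)
  also have "\<dots> \<le> ennreal b"
  proof (intro SUP_least trunc)
    fix n
    have "b = (1 - a) * c0" using a_less_1 by (simp add: c0_def)
    also have "\<dots> \<le> (1 - a) * (c0 + real n)" using a_less_1 by (intro mult_left_mono) auto
    finally show "b \<le> (1 - a) * (c0 + real n)" .
  qed (use c0 in auto)
  finally have 1: "ennreal (1 - a) * (\<integral>\<^sup>+ y. ennreal (base_dist y) \<partial>\<mu>) \<le> ennreal b"
    using a_less_1 by (simp add: ennreal_mult nn_integral_cmult)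
  have "(\<integral>\<^sup>+ y. ennreal (base_dist y) \<partial>\<mu>) = ennreal (1 / (1 - a)) * (ennreal (1 - a) * (\<integral>\<^sup>+ y. ennreal (base_dist y) \<partial>\<mu>))"
    using a_less_1 by (simp add: mult.assoc[symmetric] ennreal_mult[symmetric])
  also have "\<dots> \<le> ennreal (1 / (1 - a)) * ennreal b" by (intro mult_left_mono 1) simp
  also have "\<dots> = ennreal (b / (1 - a))" using a_less_1 b_nonneg by (simp add: ennreal_mult[symmetric])
  finally show ?thesis .
qed

text \<open>
  End points in cell \<open>j\<close> of paths with at most \<open>n\<close> edges that start at base points.  Including the base
  point at every stage keeps the sets nonempty in cells that no edge enters.
\<close>

fun skel :: "nat \<Rightarrow> nat \<Rightarrow> 'k set" where
  "skel 0 j = {x j}"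
| "skel (Suc n) j = insert (x j) (\<Union>e\<in>in_edges M j. mp M e ` skel n (src M e))"

lemma in_edgesD: "e \<in> in_edges M j \<Longrightarrow> e \<in> edges M" "e \<in> in_edges M j \<Longrightarrow> tgt M e = j"
  by (auto simp: in_edges_def)

lemma skel_nonempty [simp]: "skel n j \<noteq> {}"
  by (cases n) auto

lemma skel_countable: "countable (skel n j)"
proof (induction n arbitrary: j)
  case (Suc n)
  have "countable (in_edges M j)"
    using countable_edges by (rule countable_subset[rotated]) (auto simp: in_edges_def)
  then show ?case using Suc by auto
qed auto

lemma skel_finite:
  assumes "\<And>j. j \<in> idx M \<Longrightarrow> finite (in_edges M j)" "j \<in> idx M"
  shows "finite (skel n j)"
  using assms(2)
proof (induction n arbitrary: j)
  case (Suc n)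
  then show ?case using assms(1) by (auto dest: in_edgesD)
qed auto

lemma skel_cell: "j \<in> idx M \<Longrightarrow> z \<in> skel n j \<Longrightarrow> cell_of z = j"
proof (induction n arbitrary: j z)
  case (Suc n)
  from Suc.prems(2) consider "z = x j" | e z' where "e \<in> in_edges M j" "z' \<in> skel n (src M e)" "z = mp M e z'"
    by auto
  then show ?case
  proof cases
    case 2
    then have "cell_of z' = src M e" using Suc.IH[of "src M e" z'] by (auto dest: in_edgesD)
    then show ?thesis using 2 cell_of_mp[of e z'] by (auto dest: in_edgesD)
  qed (use Suc.prems in auto)
qed auto

definition skel_dist :: "nat \<Rightarrow> 'k \<Rightarrow> real" where
  "skel_dist n y = infdist y (skel n (cell_of y))"

lemma skel_dist_nonneg [simp]: "0 \<le> skel_dist n y"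
  by (simp add: skel_dist_def infdist_nonneg)

lemma skel_dist_measurable [measurable]: "skel_dist n \<in> borel_measurable borel"
  unfolding skel_dist_def
  by (rule piecewise_measurable) (intro borel_measurable_continuous_onI continuous_intros)

text \<open>
  Along an edge \<open>e\<close>, a point \<open>z\<close> of the skeleton near \<open>y\<close> moves to the point \<open>w\<^sub>e z\<close> of the next skeleton, and
  on average \<open>w\<^sub>e z\<close> is closer to \<open>w\<^sub>e y\<close> by the factor \<open>a\<close>.
\<close>

lemma Uop_skel_dist: "Uop M (\<lambda>y. ennreal (skel_dist (Suc n) y)) y \<le> ennreal (a * skel_dist n y)"
proof (rule ennreal_le_epsilon)
  fix \<epsilon> :: real assume "0 < \<epsilon>"
  define \<delta> where "\<delta> = \<epsilon> / a"
  have "\<delta> > 0" using \<open>0 < \<epsilon>\<close> a_pos by (simp add: \<delta>_def)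
  then have "infdist y (skel n (cell_of y)) < skel_dist n y + \<delta>" by (simp add: skel_dist_def)
  then obtain z where z: "z \<in> skel n (cell_of y)" "dist y z < skel_dist n y + \<delta>"
    using cInf_lessD[of "dist y ` skel n (cell_of y)"] by (auto simp: infdist_notempty)
  then have cz: "cell_of y = cell_of z" using skel_cell[of "cell_of y" z n] by simp
  have "Uop M (\<lambda>y. ennreal (skel_dist (Suc n) y)) y \<le> (\<integral>\<^sup>+ e. ennreal (dist (mp M e y) (mp M e z)) \<partial>step y)"
    unfolding Uop_step
  proof (intro nn_integral_mono_AE AE_pmfI ennreal_leI)
    fix e assume "e \<in> set_pmf (step y)"
    then have e: "e \<in> edges M" "src M e = cell_of y" using set_step by auto
    have "mp M e z \<in> skel (Suc n) (tgt M e)" using e z by (auto simp: in_edges_def)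
    then show "skel_dist (Suc n) (mp M e y) \<le> dist (mp M e y) (mp M e z)"
      using cell_of_mp[OF e] unfolding skel_dist_def by (metis infdist_le)
  qed
  also have "\<dots> \<le> ennreal (a * dist y z)" by (rule contraction_step[OF cz])
  also have "\<dots> \<le> ennreal (a * (skel_dist n y + \<delta>))"
    using z(2) a_pos by (intro ennreal_leI mult_left_mono) auto
  also have "\<dots> = ennreal (a * skel_dist n y) + ennreal \<epsilon>"
    using a_pos \<open>0 < \<epsilon>\<close> by (simp add: \<delta>_def distrib_left)
  finally show "Uop M (\<lambda>y. ennreal (skel_dist (Suc n) y)) y \<le> ennreal (a * skel_dist n y) + ennreal \<epsilon>" .
qed

lemma nn_integral_skel_dist_le:
  assumes \<mu>: "\<mu> \<in> invariant_probs M"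
  shows "(\<integral>\<^sup>+ y. ennreal (skel_dist n y) \<partial>\<mu>) \<le> ennreal (a ^ n * (b / (1 - a)))"
proof (induction n)
  case 0
  show ?case using nn_integral_base_dist_le[OF \<mu>] by (simp add: skel_dist_def base_dist_def)
next
  case (Suc n)
  note [measurable_cong] = invariantD(1)[OF \<mu>]
  have "(\<integral>\<^sup>+ y. ennreal (skel_dist (Suc n) y) \<partial>\<mu>) = (\<integral>\<^sup>+ y. Uop M (\<lambda>y. ennreal (skel_dist (Suc n) y)) y \<partial>\<mu>)"
    by (rule nn_integral_invariant[OF \<mu>, symmetric]) measurable
  also have "\<dots> \<le> (\<integral>\<^sup>+ y. ennreal (a * skel_dist n y) \<partial>\<mu>)"
    by (intro nn_integral_mono Uop_skel_dist)
  also have "\<dots> = ennreal a * (\<integral>\<^sup>+ y. ennreal (skel_dist n y) \<partial>\<mu>)"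
    using a_pos by (simp add: ennreal_mult nn_integral_cmult)
  also have "\<dots> \<le> ennreal a * ennreal (a ^ n * (b / (1 - a)))" by (intro mult_left_mono Suc) simp
  also have "\<dots> = ennreal (a ^ Suc n * (b / (1 - a)))"
    using a_pos by (simp add: ennreal_mult'[symmetric] mult.assoc)
  finally show ?case .
qed

lemma skel_decay: "0 < (\<epsilon>::real) \<Longrightarrow> \<exists>n. a ^ n * (b / (1 - a)) \<le> \<epsilon>"
proof -
  assume "0 < \<epsilon>"
  have "(\<lambda>n. a ^ n * (b / (1 - a))) \<longlonglongrightarrow> 0 * (b / (1 - a))"
    using a_pos a_less_1 by (intro tendsto_intros LIMSEQ_realpow_zero) auto
  then have "\<forall>\<^sub>F n in sequentially. a ^ n * (b / (1 - a)) < \<epsilon>"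
    using \<open>0 < \<epsilon>\<close> by (intro order_tendstoD) auto
  then show ?thesis by (auto simp: eventually_sequentially intro: less_imp_le)
qed

text \<open>
  With finitely many edges into each cell the skeletons are finite nets.  Their depth \<open>n k\<close> is chosen so
  that Markov's inequality leaves mass at most \<open>\<epsilon> 2\<^bsup>-k-2\<^esup>\<close> outside the balls of radius \<open>1 / (k + 1)\<close>; the
  choice does not involve the measure.
\<close>

lemma invariant_tight_on_cells:
  assumes fin: "\<And>j. j \<in> idx M \<Longrightarrow> finite (in_edges M j)"
    and c: "c \<subseteq> idx M" "finite c" and \<epsilon>: "0 < (\<epsilon>::real)"
  obtains C where "compact C"
    "\<And>\<mu>. \<mu> \<in> invariant_probs M \<Longrightarrow> emeasure \<mu> ((\<Union>j\<in>c. cell M j) - C) < ennreal \<epsilon>"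
proof -
  have "\<exists>n. a ^ n * (b / (1 - a)) \<le> \<epsilon> / 2 * (1/2) ^ Suc k / Suc k" for k
    using \<epsilon> by (intro skel_decay) auto
  then obtain n where n: "\<And>k. a ^ n k * (b / (1 - a)) \<le> \<epsilon> / 2 * (1/2) ^ Suc k / Suc k" by metis
  define T where "T k = (\<Union>j\<in>c. skel (n k) j)" for k
  have T: "finite (T k)" for k
    using c fin skel_finite unfolding T_def by (intro finite_UN_I) auto
  from tight_by_finite_nets[of T, OF T \<epsilon>] obtain C where C: "compact C"
    and tight: "\<And>\<mu> B. sets \<mu> = sets borel \<Longrightarrow> B \<in> sets borel \<Longrightarrow>
      (\<And>k. emeasure \<mu> (B - (\<Union>t\<in>T k. cball t (1 / Suc k))) \<le> ennreal (\<epsilon> / 2 * (1/2) ^ Suc k))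
      \<Longrightarrow> emeasure \<mu> (B - C) < ennreal \<epsilon>" by blast
  show ?thesis
  proof (rule that[OF C])
    fix \<mu> assume \<mu>: "\<mu> \<in> invariant_probs M"
    note [measurable_cong] = invariantD(1)[OF \<mu>]
    have sp: "space \<mu> = UNIV" by (rule invariantD[OF \<mu>])
    let ?B = "\<Union>j\<in>c. cell M j"
    show "emeasure \<mu> (?B - C) < ennreal \<epsilon>"
    proof (rule tight[OF invariantD(1)[OF \<mu>]])
      show "?B \<in> sets borel" using c by (intro sets.finite_UN cell_borel) auto
      fix k
      have "emeasure \<mu> (?B - (\<Union>t\<in>T k. cball t (1 / Suc k))) \<le> emeasure \<mu> {y\<in>space \<mu>. 1 \<le> ennreal (Suc k) * ennreal (skel_dist (n k) y)}"
      proof (intro emeasure_mono subsetI)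
        fix y assume y: "y \<in> ?B - (\<Union>t\<in>T k. cball t (1 / Suc k))"
        then obtain j where j: "j \<in> c" "y \<in> cell M j" by auto
        then have cy: "cell_of y = j" using c by (intro cell_of_eq) auto
        have "1 / Suc k \<le> dist y z" if "z \<in> skel (n k) j" for z
        proof -
          have "z \<in> T k" using that j by (auto simp: T_def)
          then have "y \<notin> cball z (1 / Suc k)" using y by auto
          then show ?thesis by (simp add: dist_commute)
        qed
        then have "1 / Suc k \<le> skel_dist (n k) y"
          unfolding skel_dist_def cy by (auto simp: infdist_notempty intro!: cINF_greatest)
        then have "1 \<le> real (Suc k) * skel_dist (n k) y" by (simp add: field_simps)
        then have "ennreal 1 \<le> ennreal (real (Suc k) * skel_dist (n k) y)" by (intro ennreal_leI)
        then show "y \<in> {y\<in>space \<mu>. 1 \<le> ennreal (Suc k) * ennreal (skel_dist (n k) y)}"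
          by (simp add: sp ennreal_mult' del: of_nat_Suc)
      qed measurable
      also have "\<dots> \<le> ennreal (Suc k) * (\<integral>\<^sup>+ y. ennreal (skel_dist (n k) y) * indicator (space \<mu>) y \<partial>\<mu>)"
        by (intro nn_integral_Markov_inequality) auto
      also have "\<dots> = ennreal (Suc k) * (\<integral>\<^sup>+ y. ennreal (skel_dist (n k) y) \<partial>\<mu>)"
        by (simp add: sp)
      also have "\<dots> \<le> ennreal (Suc k) * ennreal (\<epsilon> / 2 * (1/2) ^ Suc k / Suc k)"
        by (intro mult_left_mono order.trans[OF nn_integral_skel_dist_le[OF \<mu>]] ennreal_leI n) simp
      also have "\<dots> = ennreal (\<epsilon> / 2 * (1/2) ^ Suc k)"
        by (simp add: ennreal_mult'[symmetric] del: of_nat_Suc power_Suc)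
      finally show "emeasure \<mu> (?B - (\<Union>t\<in>T k. cball t (1 / Suc k))) \<le> ennreal (\<epsilon> / 2 * (1/2) ^ Suc k)" .
    qed
  qed
qed

text \<open>
  The union of all skeletons is countable, and its mean distance is at most \<open>a\<^sup>n b / (1 - a)\<close> for every
  \<open>n\<close>, hence zero.  So almost every point lies in the closure of this countable set, and for each radius
  finitely many balls about its members carry nearly all the mass.
\<close>

lemma invariant_tight:
  assumes \<mu>: "\<mu> \<in> invariant_probs M"
  shows "uniformly_tight {\<mu>}"
  unfolding uniformly_tight_def
proof (intro allI impI)
  fix \<epsilon> :: real assume \<epsilon>: "0 < \<epsilon>"
  interpret prob_space \<mu> by (rule invariantD[OF \<mu>])
  note [measurable_cong] = invariantD(1)[OF \<mu>]
  have sp: "space \<mu> = UNIV" by (rule invariantD[OF \<mu>])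
  define S where "S = (\<Union>n. \<Union>j\<in>idx M. skel n j)"
  have S: "countable S" "S \<noteq> {}"
    using sys skel_countable by (auto simp: S_def markov_system_def)
  have inf_meas [measurable]: "(\<lambda>y. infdist y S) \<in> borel_measurable borel"
    by (intro borel_measurable_continuous_onI continuous_intros)
  have "(\<integral>\<^sup>+ y. ennreal (infdist y S) \<partial>\<mu>) \<le> 0 + ennreal \<delta>" if \<delta>: "0 < \<delta>" for \<delta>
  proof -
    obtain n where n: "a ^ n * (b / (1 - a)) \<le> \<delta>" using skel_decay[OF \<delta>] by auto
    have "(\<integral>\<^sup>+ y. ennreal (infdist y S) \<partial>\<mu>) \<le> (\<integral>\<^sup>+ y. ennreal (skel_dist n y) \<partial>\<mu>)"
    proof (intro nn_integral_mono ennreal_leI)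
      fix y
      have "skel n (cell_of y) \<subseteq> S" unfolding S_def using cell_of_in by blast
      then show "infdist y S \<le> skel_dist n y" unfolding skel_dist_def by (intro infdist_mono) auto
    qed
    also have "\<dots> \<le> ennreal \<delta>"
      using n by (intro order.trans[OF nn_integral_skel_dist_le[OF \<mu>]] ennreal_leI)
    finally show ?thesis by simp
  qed
  then have "(\<integral>\<^sup>+ y. ennreal (infdist y S) \<partial>\<mu>) \<le> 0" by (rule ennreal_le_epsilon)
  then have "AE y in \<mu>. ennreal (infdist y S) = 0" by (subst nn_integral_0_iff_AE[symmetric]) auto
  then have near: "AE y in \<mu>. infdist y S = 0" 
    by eventually_elim (simp add: infdist_nonneg ennreal_eq_0_iff order.antisym)
  define s where "s = from_nat_into S"
  have s: "range s = S" using S by (simp add: s_def range_from_nat_into)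
  have "\<exists>m. emeasure \<mu> (UNIV - (\<Union>t\<in>s ` {..m}. cball t (1 / Suc k))) \<le> ennreal (\<epsilon> / 2 * (1/2) ^ Suc k)" for k
  proof -
    let ?A = "\<lambda>m. UNIV - (\<Union>t\<in>s ` {..m}. cball t (1 / Suc k))"
    have A: "?A m \<in> sets \<mu>" for m
    proof -
      have "closed (\<Union>t\<in>s ` {..m}. cball t (1 / Suc k))" by (intro closed_UN) auto
      then show ?thesis by measurable
    qed
    have "(\<lambda>m. emeasure \<mu> (?A m)) \<longlonglongrightarrow> emeasure \<mu> (\<Inter>m. ?A m)"
      by (intro Lim_emeasure_decseq) (use A in \<open>auto simp: decseq_def\<close>)
    moreover have "emeasure \<mu> (\<Inter>m. ?A m) = 0"
    proof -
      have I: "(\<Inter>m. ?A m) \<in> sets \<mu>" using A by blast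
      have "AE y in \<mu>. y \<notin> (\<Inter>m. ?A m)"
        using near
      proof eventually_elim
        case (elim y)
        then have "infdist y S < 1 / Suc k" by simp
        then obtain z where "z \<in> S" "dist y z < 1 / Suc k"
          using cInf_lessD[of "dist y ` S"] S by (auto simp: infdist_notempty)
        then obtain i where "dist y (s i) < 1 / Suc k" using s by auto
        then have "y \<in> cball (s i) (1 / Suc k)" by (simp add: dist_commute)
        then show ?case by blast
      qed
      then show ?thesis using AE_iff_null_sets[OF I] by auto
    qed
    ultimately have "(\<lambda>m. emeasure \<mu> (?A m)) \<longlonglongrightarrow> 0" by simp
    then have "\<forall>\<^sub>F m in sequentially. emeasure \<mu> (?A m) < ennreal (\<epsilon> / 2 * (1/2) ^ Suc k)"
      using \<epsilon> by (intro order_tendstoD) (auto simp: ennreal_zero_less_mult_iff)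
    then show ?thesis by (auto simp: eventually_sequentially intro: less_imp_le)
  qed
  then obtain m where m: "\<And>k. emeasure \<mu> (UNIV - (\<Union>t\<in>s ` {..m k}. cball t (1 / Suc k))) \<le> ennreal (\<epsilon> / 2 * (1/2) ^ Suc k)"
    by metis
  obtain C where "compact C" and tight: "\<And>\<mu> B. sets \<mu> = sets borel \<Longrightarrow> B \<in> sets borel \<Longrightarrow>
      (\<And>k. emeasure \<mu> (B - (\<Union>t\<in>s ` {..m k}. cball t (1 / Suc k))) \<le> ennreal (\<epsilon> / 2 * (1/2) ^ Suc k))
      \<Longrightarrow> emeasure \<mu> (B - C) < ennreal \<epsilon>"
    using tight_by_finite_nets[of "\<lambda>k. s ` {..m k}" \<epsilon>] \<epsilon> by auto
  then show "\<exists>C. compact C \<and> (\<forall>\<Lambda>\<in>{\<mu>}. emeasure \<Lambda> (UNIV - C) < ennreal \<epsilon>)"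
    using tight[OF invariantD(1)[OF \<mu>], of UNIV] m by auto
qed

end

section \<open>A maximal inequality and tight orbits\<close>

context markov
begin

abbreviation orbit :: "'k \<Rightarrow> nat \<Rightarrow> 'k measure" where
  "orbit y k \<equiv> (Ustar M ^^ k) (return borel y)"

lemma sets_Ustar_pow: "sets \<nu> = sets borel \<Longrightarrow> sets ((Ustar M ^^ k) \<nu>) = sets borel"
  by (cases k) simp_all

lemma Uop_pow_measurable [measurable]:
  "f \<in> borel_measurable borel \<Longrightarrow> (Uop M ^^ k) f \<in> borel_measurable borel"
  by (induction k) (auto intro: Uop_measurable)

lemma nn_integral_Ustar_pow:
  assumes "sets \<nu> = sets borel" "f \<in> borel_measurable borel"
  shows "(\<integral>\<^sup>+ y. f y \<partial>(Ustar M ^^ k) \<nu>) = (\<integral>\<^sup>+ y. (Uop M ^^ k) f y \<partial>\<nu>)"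
  using assms(2)
proof (induction k arbitrary: f)
  case (Suc k)
  have "(\<integral>\<^sup>+ y. f y \<partial>(Ustar M ^^ Suc k) \<nu>) = (\<integral>\<^sup>+ y. Uop M f y \<partial>(Ustar M ^^ k) \<nu>)"
    using Suc.prems by (simp add: nn_integral_Ustar[OF sys sets_Ustar_pow[OF assms(1)]])
  also have "\<dots> = (\<integral>\<^sup>+ y. (Uop M ^^ k) (Uop M f) y \<partial>\<nu>)"
    using Suc.prems by (intro Suc.IH Uop_measurable)
  finally show ?case by (simp add: funpow_swap1)
qed simp

lemma emeasure_orbit:
  assumes "B \<in> sets borel"
  shows "emeasure (orbit y k) B = (Uop M ^^ k) (indicator B) y"
proof -
  have "emeasure (orbit y k) B = (\<integral>\<^sup>+ z. indicator B z \<partial>orbit y k)"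
    using assms sets_Ustar_pow[of "return borel y"] by (intro nn_integral_indicator[symmetric]) simp
  also have "\<dots> = (\<integral>\<^sup>+ z. (Uop M ^^ k) (indicator B) z \<partial>return borel y)"
    using assms by (intro nn_integral_Ustar_pow) auto
  also have "\<dots> = (Uop M ^^ k) (indicator B) y"
    using assms by (intro nn_integral_return) (auto intro: Uop_pow_measurable)
  finally show ?thesis .
qed

lemma Uop_pow_const: "(Uop M ^^ k) (\<lambda>_. c) = (\<lambda>_. c)"
  by (induction k) (simp_all add: Uop_const[abs_def])

lemma prob_space_orbit: "prob_space (orbit y k)"
proof
  have "space (orbit y k) = UNIV"
    using sets_eq_imp_space_eq[OF sets_Ustar_pow, of "return borel y"] by simp
  then show "emeasure (orbit y k) (space (orbit y k)) = 1"
    using emeasure_orbit[of UNIV] Uop_pow_const[of k 1] by (simp add: indicator_def)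
qed

lemma emeasure_alpha:
  assumes "X \<subseteq> idx M"
  shows "emeasure (alpha M y n) X = ennreal (1 / real n * (\<Sum>k = 1..n. measure (orbit y k) {z. cell_of z \<in> X}))"
proof -
  have UN: "(\<Union>j\<in>X. cell M j) = {z. cell_of z \<in> X}"
  proof (intro set_eqI iffI)
    fix z assume "z \<in> (\<Union>j\<in>X. cell M j)"
    then obtain j where "j \<in> X" "z \<in> cell M j" by blast
    then show "z \<in> {z. cell_of z \<in> X}" using cell_of_eq[of j z] assms by blast
  next
    fix z assume "z \<in> {z. cell_of z \<in> X}"
    then show "z \<in> (\<Union>j\<in>X. cell M j)" using in_cell_of[of z] by blast
  qed
  have one: "(\<integral>\<^sup>+ j. ennreal (measure (orbit y k) (cell M j)) \<partial>count_space X) = ennreal (measure (orbit y k) {z. cell_of z \<in> X})" for k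
  proof -
    interpret prob_space "orbit y k" by (rule prob_space_orbit)
    have "(\<integral>\<^sup>+ j. emeasure (orbit y k) (cell M j) \<partial>count_space X) = emeasure (orbit y k) (\<Union>j\<in>X. cell M j)"
    proof (rule emeasure_UN_countable[symmetric])
      show "cell M j \<in> sets (orbit y k)" if "j \<in> X" for j
        using that assms cell_borel[of j] by (simp add: sets_Ustar_pow subset_iff)
      show "disjoint_family_on (cell M) X" by (rule disjoint_family_on_mono[OF assms cell_disjoint])
    qed simp
    then show ?thesis by (simp add: UN emeasure_eq_measure)
  qed
  have X: "X \<inter> idx M = X" using assms by auto
  have "emeasure (alpha M y n) X = (\<integral>\<^sup>+ j. ennreal (1 / real n * (\<Sum>k = 1..n. measure (orbit y k) (cell M j))) \<partial>count_space X)"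
    using assms unfolding alpha_def point_measure_def
    by (subst emeasure_density) (auto simp: nn_integral_count_space_indicator indicator_def X intro!: nn_integral_cong)
  also have "\<dots> = (\<integral>\<^sup>+ j. ennreal (1 / real n) * (\<Sum>k = 1..n. ennreal (measure (orbit y k) (cell M j))) \<partial>count_space X)"
    by (intro nn_integral_cong) (simp only: ennreal_mult' divide_nonneg_nonneg of_nat_0_le_iff zero_le_one sum_ennreal measure_nonneg)
  also have "\<dots> = ennreal (1 / real n) * (\<Sum>k = 1..n. \<integral>\<^sup>+ j. ennreal (measure (orbit y k) (cell M j)) \<partial>count_space X)"
    by (simp add: nn_integral_cmult nn_integral_sum del: sum_ennreal)
  also have "\<dots> = ennreal (1 / real n * (\<Sum>k = 1..n. measure (orbit y k) {z. cell_of z \<in> X}))"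
    by (simp only: one ennreal_mult' divide_nonneg_nonneg of_nat_0_le_iff zero_le_one sum_ennreal measure_nonneg)
  finally show ?thesis .
qed

text \<open>
  Partial sums \<open>f + U f + \<dots> + U\<^bsup>n-1\<^esup> f\<close>, in the recursive form on which Garsia's argument for the maximal
  inequality acts.
\<close>

fun birkhoff :: "('k \<Rightarrow> ennreal) \<Rightarrow> nat \<Rightarrow> 'k \<Rightarrow> ennreal" where
  "birkhoff f 0 = (\<lambda>_. 0)"
| "birkhoff f (Suc n) = (\<lambda>y. f y + Uop M (birkhoff f n) y)"

lemma Uop_sum: "Uop M (\<lambda>z. \<Sum>i<n. g i z) y = (\<Sum>i<(n::nat). Uop M (g i) y)"
  by (induction n) (simp_all add: Uop_add Uop_const)

lemma birkhoff_eq: "birkhoff f n y = (\<Sum>k<n. (Uop M ^^ k) f y)"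
proof (induction n arbitrary: y)
  case (Suc n)
  have "birkhoff f n = (\<lambda>z. \<Sum>k<n. (Uop M ^^ k) f z)" using Suc by auto
  then have "birkhoff f (Suc n) y = f y + Uop M (\<lambda>z. \<Sum>k<n. (Uop M ^^ k) f z) y" by simp
  also have "\<dots> = (\<Sum>k<Suc n. (Uop M ^^ k) f y)"
    by (subst sum.lessThan_Suc_shift) (simp add: Uop_sum)
  finally show ?case .
qed simp

lemma birkhoff_measurable [measurable]:
  "f \<in> borel_measurable borel \<Longrightarrow> birkhoff f n \<in> borel_measurable borel"
  by (induction n) (auto intro!: borel_measurable_add Uop_measurable)

lemma birkhoff_le: "(\<And>z. f z \<le> 1) \<Longrightarrow> birkhoff f n y \<le> of_nat n"
proof (induction n arbitrary: y)
  case (Suc n)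
  have "Uop M (birkhoff f n) y \<le> Uop M (\<lambda>_. of_nat n) y" by (intro Uop_mono Suc)
  then show ?case using Suc.prems[of y] by (simp add: Uop_const add_mono)
qed simp

text \<open>
  Garsia's argument.  Let \<open>S\<^sub>k\<close> be the partial sums and \<open>m\<^sub>N\<close> the maximum of \<open>S\<^sub>k - k \<epsilon>\<close> for \<open>k \<le> N\<close>, where
  truncated subtraction supplies positive parts.  Then \<open>m\<^sub>N + \<epsilon> 1\<^bsub>{m\<^sub>N > 0}\<^esub> \<le> U m\<^sub>N + f\<close>, and integration
  against an invariant measure cancels the two bounded functions \<open>m\<^sub>N\<close> and \<open>U m\<^sub>N\<close>.
\<close>

lemma maximal_ergodic:
  assumes \<mu>: "\<mu> \<in> invariant_probs M" and f [measurable]: "f \<in> borel_measurable borel"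
    and f1: "\<And>z. f z \<le> 1" and \<epsilon>: "0 < (\<epsilon>::real)"
  shows "ennreal \<epsilon> * emeasure \<mu> {y. \<exists>n. ennreal (real n * \<epsilon>) < birkhoff f n y} \<le> (\<integral>\<^sup>+ y. f y \<partial>\<mu>)"
proof -
  have [measurable_cong]: "sets \<mu> = sets borel" and "prob_space \<mu>"
    using \<mu> by (auto simp: invariant_probs_def borel_probs_def)
  then have sp: "space \<mu> = UNIV" using sets_eq_imp_space_eq[of \<mu> borel] by simp
  interpret prob_space \<mu> by fact
  define mx where "mx N y = Max ((\<lambda>k. birkhoff f k y - ennreal (real k * \<epsilon>)) ` {..N})" for N :: nat and y
  have [measurable]: "mx N \<in> borel_measurable borel" for N
    unfolding mx_def by (intro borel_measurable_Max) auto
  define E where "E N = {y. 0 < mx N y}" for N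
  have E_iff: "y \<in> E N \<longleftrightarrow> (\<exists>n\<le>N. ennreal (real n * \<epsilon>) < birkhoff f n y)" for y N
    unfolding E_def mx_def by (auto simp: Max_gr_iff diff_gt_0_iff_gt_ennreal)
  have [measurable]: "E N \<in> sets borel" for N
    unfolding E_def by measurable
  \<comment> \<open>On \<open>E N\<close> the maximum is attained at some \<open>k > 0\<close>, and one step back \<open>S\<^bsub>k-1\<^esub> \<le> m\<^sub>N + (k - 1) \<epsilon>\<close>.\<close>
  have key: "mx N y + ennreal \<epsilon> * indicator (E N) y \<le> Uop M (mx N) y + f y" for N y
  proof (cases "y \<in> E N")
    case True
    have "mx N y \<in> (\<lambda>k. birkhoff f k y - ennreal (real k * \<epsilon>)) ` {..N}"
      unfolding mx_def by (intro Max_in) auto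
    then obtain k where k: "k \<le> N" "mx N y = birkhoff f k y - ennreal (real k * \<epsilon>)" by auto
    have pos: "ennreal (real k * \<epsilon>) < birkhoff f k y"
      using True k by (simp add: E_def diff_gt_0_iff_gt_ennreal)
    then obtain k' where k': "k = Suc k'" by (cases k) auto
    have "birkhoff f k' z \<le> mx N z + ennreal (real k' * \<epsilon>)" for z
    proof -
      have "birkhoff f k' z - ennreal (real k' * \<epsilon>) \<le> mx N z"
        unfolding mx_def using k(1) k' by (intro Max_ge) auto
      then show ?thesis by (simp add: ennreal_minus_le_iff add.commute)
    qed
    then have "Uop M (birkhoff f k') y \<le> Uop M (mx N) y + ennreal (real k' * \<epsilon>)"
      using Uop_mono[of "birkhoff f k'" "\<lambda>z. mx N z + ennreal (real k' * \<epsilon>)" y] by (simp add: Uop_add Uop_const)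
    then have le: "birkhoff f k y \<le> (Uop M (mx N) y + f y) + ennreal (real k' * \<epsilon>)"
      unfolding k' by (simp add: add_ac add_left_mono)
    have "birkhoff f k y \<le> of_nat k" by (rule birkhoff_le[OF f1])
    then obtain r where r: "birkhoff f k y = ennreal r" "0 \<le> r"
      by (cases "birkhoff f k y") (auto simp: top_unique)
    show ?thesis
    proof (cases "Uop M (mx N) y + f y")
      case (real s)
      have "r \<le> s + real k' * \<epsilon>" using le real \<epsilon> r by (simp add: ennreal_plus[symmetric] del: ennreal_plus)
      moreover have "real k * \<epsilon> < r" using pos r \<epsilon> by (simp add: ennreal_less_iff)
      ultimately show ?thesis using True real r \<epsilon>
        unfolding k(2) by (simp add: ennreal_minus ennreal_plus[symmetric] k' algebra_simps del: ennreal_plus)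
    next
      case top
      then show ?thesis by (simp only: top_greatest)
    qed
  next
    case False
    then have "mx N y = 0" by (simp add: E_def)
    then show ?thesis using False by simp
  qed
  have bound: "ennreal \<epsilon> * emeasure \<mu> (E N) \<le> (\<integral>\<^sup>+ y. f y \<partial>\<mu>)" for N
  proof -
    have "(\<integral>\<^sup>+ y. mx N y \<partial>\<mu>) + ennreal \<epsilon> * emeasure \<mu> (E N) = (\<integral>\<^sup>+ y. mx N y + ennreal \<epsilon> * indicator (E N) y \<partial>\<mu>)"
      by (simp add: nn_integral_add nn_integral_cmult)
    also have "\<dots> \<le> (\<integral>\<^sup>+ y. Uop M (mx N) y + f y \<partial>\<mu>)" by (intro nn_integral_mono key)
    also have "\<dots> = (\<integral>\<^sup>+ y. Uop M (mx N) y \<partial>\<mu>) + (\<integral>\<^sup>+ y. f y \<partial>\<mu>)"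
      by (intro nn_integral_add) measurable
    also have "(\<integral>\<^sup>+ y. Uop M (mx N) y \<partial>\<mu>) = (\<integral>\<^sup>+ y. mx N y \<partial>\<mu>)"
      by (rule nn_integral_invariant[OF \<mu>]) measurable
    finally have le: "(\<integral>\<^sup>+ y. mx N y \<partial>\<mu>) + ennreal \<epsilon> * emeasure \<mu> (E N) \<le> (\<integral>\<^sup>+ y. mx N y \<partial>\<mu>) + (\<integral>\<^sup>+ y. f y \<partial>\<mu>)" .
    have "mx N y \<le> of_nat N" for y
      unfolding mx_def
    proof (intro Max.boundedI, safe)
      fix k assume "k \<le> N"
      have "birkhoff f k y - ennreal (real k * \<epsilon>) \<le> birkhoff f k y" by (rule diff_le_self_ennreal)
      also have "\<dots> \<le> of_nat k" by (rule birkhoff_le[OF f1])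
      also have "\<dots> \<le> of_nat N" using \<open>k \<le> N\<close> by simp
      finally show "birkhoff f k y - ennreal (real k * \<epsilon>) \<le> of_nat N" .
    qed auto
    then have "(\<integral>\<^sup>+ y. mx N y \<partial>\<mu>) \<le> (\<integral>\<^sup>+ y. of_nat N \<partial>\<mu>)" by (intro nn_integral_mono)
    then have "(\<integral>\<^sup>+ y. mx N y \<partial>\<mu>) < \<top>"
      using order.strict_trans1 by (fastforce simp: emeasure_space_1 of_nat_less_top)
    then show ?thesis using le by (auto simp: ennreal_add_left_cancel_le)
  qed
  have "{y. \<exists>n. ennreal (real n * \<epsilon>) < birkhoff f n y} = (\<Union>N. E N)"
    using E_iff by blast
  also have "emeasure \<mu> \<dots> = (SUP N. emeasure \<mu> (E N))"
    by (intro SUP_emeasure_incseq[symmetric]) (auto simp: incseq_def E_iff, meson order.trans)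
  finally have "ennreal \<epsilon> * emeasure \<mu> {y. \<exists>n. ennreal (real n * \<epsilon>) < birkhoff f n y} = (SUP N. ennreal \<epsilon> * emeasure \<mu> (E N))"
    by (simp add: SUP_mult_left_ennreal)
  also have "\<dots> \<le> (\<integral>\<^sup>+ y. f y \<partial>\<mu>)" by (intro SUP_least bound)
  finally show ?thesis .
qed

text \<open>
  The cells beyond \<open>v m\<close> have so little mass that the points from which the chain ever visits them with
  frequency above \<open>1 / (m + 1)\<close> form a set of measure at most \<open>2\<^bsup>-m-2\<^esup>\<close>.  These sets do not cover \<open>K\<close>, and any
  point outside all of them has tight frequencies.
\<close>

lemma invariant_imp_alpha_tight:
  assumes \<mu>: "\<mu> \<in> invariant_probs M"
  shows "\<exists>y. alpha_tight M y"
proof -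
  have [measurable_cong]: "sets \<mu> = sets borel" and "prob_space \<mu>"
    using \<mu> by (auto simp: invariant_probs_def borel_probs_def)
  then have sp: "space \<mu> = UNIV" using sets_eq_imp_space_eq[of \<mu> borel] by simp
  interpret prob_space \<mu> by fact
  define B where "B v = {y. v < cell_of y}" for v
  have B [measurable]: "B v \<in> sets borel" for v
    unfolding B_def by measurable
  have "\<exists>v. emeasure \<mu> (B v) \<le> ennreal ((1/2) ^ (m + 2) / real (Suc m))" for m
  proof -
    have "(\<lambda>v. emeasure \<mu> (B v)) \<longlonglongrightarrow> emeasure \<mu> (\<Inter>v. B v)"
      by (intro Lim_emeasure_decseq) (auto simp: decseq_def B_def)
    moreover have "(\<Inter>v. B v) = {}" by (auto simp: B_def)
    ultimately have "(\<lambda>v. emeasure \<mu> (B v)) \<longlonglongrightarrow> 0" by simp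
    then have "\<forall>\<^sub>F v in sequentially. emeasure \<mu> (B v) < ennreal ((1/2) ^ (m + 2) / real (Suc m))"
      by (intro order_tendstoD) auto
    then show ?thesis by (auto simp: eventually_sequentially intro: less_imp_le)
  qed
  then obtain v where v: "\<And>m. emeasure \<mu> (B (v m)) \<le> ennreal ((1/2) ^ (m + 2) / real (Suc m))" by metis
  define bad where "bad m = {y. \<exists>n. ennreal (real n * (1 / real (Suc m))) < birkhoff (indicator (B (v m))) n y}" for m
  have bad_meas [measurable]: "bad m \<in> sets \<mu>" for m
    unfolding bad_def by measurable
  have bad: "emeasure \<mu> (bad m) \<le> ennreal (1/2 * (1/2) ^ Suc m)" for m
  proof -
    have "emeasure \<mu> (bad m) = ennreal (real (Suc m)) * (ennreal (1 / real (Suc m)) * emeasure \<mu> (bad m))"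
      by (simp add: mult.assoc[symmetric] ennreal_mult'[symmetric] del: of_nat_Suc)
    also have "\<dots> \<le> ennreal (real (Suc m)) * (\<integral>\<^sup>+ y. indicator (B (v m)) y \<partial>\<mu>)"
      unfolding bad_def by (intro mult_left_mono maximal_ergodic[OF \<mu>]) (auto simp: indicator_def)
    also have "\<dots> \<le> ennreal (real (Suc m)) * ennreal ((1/2) ^ (m + 2) / real (Suc m))"
      using v by (intro mult_left_mono) auto
    also have "\<dots> = ennreal (1/2 * (1/2) ^ Suc m)"
      by (simp add: ennreal_mult'[symmetric] del: of_nat_Suc)
    finally show ?thesis .
  qed
  have sums: "(\<lambda>k. 1 / 2 * (1/2) ^ Suc k :: real) sums (1 / 2 * 1)"
    by (intro sums_mult power_half_series)
  have "emeasure \<mu> (\<Union>m. bad m) \<le> (\<Sum>m. emeasure \<mu> (bad m))"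
    by (intro emeasure_subadditive_countably) auto
  also have "\<dots> \<le> (\<Sum>m. ennreal (1/2 * (1/2) ^ Suc m))" by (intro suminf_le bad) auto
  also have "\<dots> = ennreal (1/2 * 1)" using sums by (intro suminf_ennreal_eq) auto
  also have "\<dots> < ennreal 1" by (rule ennreal_lessI) auto
  finally have "emeasure \<mu> (\<Union>m. bad m) \<noteq> emeasure \<mu> UNIV" using emeasure_space_1 sp by auto
  then have "(\<Union>m. bad m) \<noteq> UNIV" by metis
  then obtain y where y: "\<And>m. y \<notin> bad m" by blast
  have "alpha_tight M y"
    unfolding alpha_tight_def
  proof (intro allI impI)
    fix \<epsilon> :: real assume "0 < \<epsilon>"
    then obtain m where m: "1 / Suc m < \<epsilon> / 2" using nat_approx_posE[of "\<epsilon> / 2"] by auto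
    have "emeasure (alpha M y n) (idx M - {j \<in> idx M. j \<le> v m}) < ennreal \<epsilon>" if n: "n \<ge> 1" for n
    proof -
      have e: "{z. cell_of z \<in> idx M - {j \<in> idx M. j \<le> v m}} = B (v m)"
        by (auto simp: B_def)
      have "ennreal (\<Sum>k = 1..n. measure (orbit y k) (B (v m))) = (\<Sum>k = 1..n. emeasure (orbit y k) (B (v m)))"
        using prob_space_orbit by (simp add: finite_measure.emeasure_eq_measure prob_space.finite_measure)
      also have "\<dots> = (\<Sum>k = 1..n. (Uop M ^^ k) (indicator (B (v m))) y)"
        by (simp add: emeasure_orbit)
      \<comment> \<open>\<open>alpha\<close> averages over the times \<open>1, \<dots>, n\<close> and the partial sum over \<open>0, \<dots>, n\<close>,
        which costs the factor \<open>(n + 1) / n \<le> 2\<close>.\<close>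
      also have "\<dots> \<le> (\<Sum>k<Suc n. (Uop M ^^ k) (indicator (B (v m))) y)"
        by (intro sum_mono2) auto
      also have "\<dots> = birkhoff (indicator (B (v m))) (Suc n) y" by (rule birkhoff_eq[symmetric])
      also have "\<dots> \<le> ennreal (real (Suc n) * (1 / real (Suc m)))"
        using y[of m] unfolding bad_def mem_Collect_eq not_ex not_less by blast
      finally have "(\<Sum>k = 1..n. measure (orbit y k) (B (v m))) \<le> real (Suc n) * (1 / real (Suc m))"
        by (subst (asm) ennreal_le_iff) auto
      then have "1 / real n * (\<Sum>k = 1..n. measure (orbit y k) (B (v m))) \<le> 1 / real n * (real (Suc n) * (1 / real (Suc m)))"
        by (intro mult_left_mono) auto
      also have "\<dots> = (1 / real n * real (Suc n)) * (1 / real (Suc m))" by simp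
      also have "\<dots> \<le> 2 * (1 / real (Suc m))" using n by (intro mult_right_mono) (auto simp: field_simps)
      also have "\<dots> < \<epsilon>" using m by simp
      finally show ?thesis
        using \<open>0 < \<epsilon>\<close> unfolding emeasure_alpha[OF Diff_subset] e by (intro ennreal_lessI)
    qed
    then show "\<exists>V\<subseteq>idx M. finite V \<and> (\<forall>n\<ge>1. emeasure (alpha M y n) (idx M - V) < ennreal \<epsilon>)"
      by (intro exI[of _ "{j \<in> idx M. j \<le> v m}"]) auto
  qed
  then show ?thesis by blast
qed

end

section \<open>The code space and the coding map\<close>

context markov
begin

definition letters :: "'e option set" where
  "letters = insert None (Some ` edges M)"

lemma countable_letters [simp]: "countable letters"
  using countable_edges by (simp add: letters_def)

lemma None_letters [simp]: "None \<in> letters"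
  and Some_letters [simp]: "Some e \<in> letters \<longleftrightarrow> e \<in> edges M"
  by (auto simp: letters_def)

lemma code_space_eq: "code_space M = {\<sigma>. \<forall>i. \<sigma> i \<in> letters}"
  unfolding code_space_def code_top_def by (auto simp: letters_def PiE_def)

lemma code_spaceD: "\<sigma> \<in> code_space M \<Longrightarrow> \<sigma> i \<in> letters"
  by (simp add: code_space_eq)

lemma space_code_borel [simp]: "space (code_borel M) = code_space M"
  unfolding code_borel_def by (intro space_measure_of) (auto simp: code_space_def dest: openin_subset)

text \<open>
  Boxes that constrain finitely many coordinates to a singleton or to the complement of a finite set of
  edges form a countable base of the topology, so the Borel sets are generated by the coordinates.
\<close>

lemma sets_code_borel: "sets (code_borel M) = sets (\<Pi>\<^sub>M i\<in>UNIV. count_space letters)"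
proof
  let ?P = "\<Pi>\<^sub>M i\<in>(UNIV :: int set). count_space letters"
  have sp: "space ?P = code_space M"
    by (auto simp: space_PiM code_space_eq PiE_def)
  have sub: "{G. openin (code_top M) G} \<subseteq> Pow (code_space M)"
    by (auto simp: code_space_def dest: openin_subset)
  have "G \<in> sets ?P" if G: "openin (code_top M) G" for G
  proof -
    define BB where "BB = (\<lambda>e. {Some e}) ` edges M \<union> (\<lambda>C. insert None (Some ` (edges M - C))) ` {C. finite C \<and> C \<subseteq> edges M}"
    define box where "box ps = {\<sigma> \<in> code_space M. \<forall>p\<in>set ps. \<sigma> (fst p) \<in> snd p}" for ps :: "(int \<times> 'e option set) list"
    have BB: "\<exists>B\<in>BB. v \<in> B \<and> B \<subseteq> U"
      if "openin (Alexandroff_compactification (discrete_topology (edges M))) U" "v \<in> U" for U v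
      using that by (cases v) (auto simp: openin_Alexandroff_compactification BB_def compactin_discrete_topology)
    have "countable BB"
      unfolding BB_def using countable_edges countable_Collect_finite_subset by (intro countable_Un countable_image) auto
    then have "countable (lists (UNIV \<times> BB) :: (int \<times> 'e option set) list set)" by (intro countable_lists) auto
    then have cnt: "countable {ps \<in> lists (UNIV \<times> BB). box ps \<subseteq> G}" by (rule countable_subset[rotated]) auto
    have "box ps \<in> sets ?P" for ps
    proof -
      have [measurable]: "(\<lambda>\<sigma>. \<sigma> (fst p) \<in> snd p) \<in> ?P \<rightarrow>\<^sub>M count_space UNIV" for p :: "int \<times> 'e option set"
        by (rule measurable_compose[OF measurable_component_singleton[OF UNIV_I]]) simp
      show ?thesis unfolding box_def sp[symmetric] by measurable
    qed
    then have "(\<Union>ps\<in>{ps \<in> lists (UNIV \<times> BB). box ps \<subseteq> G}. box ps) \<in> sets ?P"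
      by (intro sets.countable_UN'[OF cnt]) auto
    moreover have "G = (\<Union>ps\<in>{ps \<in> lists (UNIV \<times> BB). box ps \<subseteq> G}. box ps)"
    proof (intro antisym subsetI)
      fix \<sigma> assume \<sigma>: "\<sigma> \<in> G"
      then have \<sigma>': "\<sigma> \<in> code_space M" using G by (auto simp: code_space_def dest: openin_subset)
      obtain U where fin: "finite {i. U i \<noteq> topspace (Alexandroff_compactification (discrete_topology (edges M)))}"
        and op: "\<And>i. openin (Alexandroff_compactification (discrete_topology (edges M))) (U i)"
        and \<sigma>U: "\<sigma> \<in> PiE UNIV U" and UG: "PiE UNIV U \<subseteq> G"
        using G \<sigma> unfolding code_top_def openin_product_topology_alt by auto
      let ?J = "{i. U i \<noteq> topspace (Alexandroff_compactification (discrete_topology (edges M)))}"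
      have "\<forall>i. \<exists>B\<in>BB. \<sigma> i \<in> B \<and> B \<subseteq> U i"
        using BB[OF op] \<sigma>U by (auto simp: PiE_def Pi_def)
      then obtain V where V: "\<And>i. V i \<in> BB" "\<And>i. \<sigma> i \<in> V i" "\<And>i. V i \<subseteq> U i" by metis
      obtain js where js: "set js = ?J" using finite_list[OF fin] by auto
      define ps where "ps = map (\<lambda>i. (i, V i)) js"
      have "ps \<in> lists (UNIV \<times> BB)" using V by (auto simp: ps_def)
      moreover have "\<sigma> \<in> box ps" using \<sigma>' V by (auto simp: box_def ps_def)
      moreover have "box ps \<subseteq> G"
      proof (intro subsetI subsetD[OF UG])
        fix \<tau> assume \<tau>: "\<tau> \<in> box ps"
        have "\<tau> i \<in> U i" for i
        proof (cases "i \<in> ?J")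
          case True
          then have "(i, V i) \<in> set ps" using js by (auto simp: ps_def)
          then have "\<tau> i \<in> V i" using \<tau> by (auto simp: box_def)
          then show ?thesis using V(3) by blast
        next
          case False
          then have "U i = letters" by (simp add: letters_def)
          then show ?thesis using \<tau> by (auto simp: box_def intro: code_spaceD)
        qed
        then show "\<tau> \<in> PiE UNIV U" by auto
      qed
      ultimately show "\<sigma> \<in> (\<Union>ps\<in>{ps \<in> lists (UNIV \<times> BB). box ps \<subseteq> G}. box ps)" by blast
    qed auto
    ultimately show ?thesis by simp
  qed
  then show "sets (code_borel M) \<subseteq> sets ?P"
    unfolding code_borel_def sets_measure_of[OF sub] unfolding sp[symmetric] by (intro sets.sigma_sets_subset) auto
  have one: "{\<sigma> \<in> code_space M. \<sigma> i = Some e} \<in> sets (code_borel M)" if "e \<in> edges M" for i e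
  proof -
    have "openin (code_top M) {\<sigma> \<in> code_space M. \<sigma> i = Some e}"
    proof -
      have "openin (Alexandroff_compactification (discrete_topology (edges M))) {Some e}"
        using that by (auto simp: openin_Alexandroff_compactification)
      from openin_continuous_map_preimage[OF continuous_map_product_projection[of i UNIV] this]
      show ?thesis by (simp add: code_top_def code_space_def del: topspace_product_topology)
    qed
    then show ?thesis
      unfolding code_borel_def by (subst sets_measure_of[OF sub]) auto
  qed
  have two: "{\<sigma> \<in> code_space M. \<sigma> i = v} \<in> sets (code_borel M)" if "v \<in> letters" for i v
  proof (cases v)
    case (Some e)
    then show ?thesis using one that by auto
  next
    case None
    have "{\<sigma> \<in> code_space M. \<sigma> i = v} = space (code_borel M) - (\<Union>e\<in>edges M. {\<sigma> \<in> code_space M. \<sigma> i = Some e})"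
      using None code_spaceD[of _ i] by (force simp: letters_def)
    also have "\<dots> \<in> sets (code_borel M)"
      using one countable_edges by (intro sets.Diff sets.top sets.countable_UN') auto
    finally show ?thesis .
  qed
  have "{\<sigma> \<in> code_space M. \<sigma> i \<in> A} \<in> sets (code_borel M)" if "A \<subseteq> letters" for i A
  proof -
    have "{\<sigma> \<in> code_space M. \<sigma> i \<in> A} = (\<Union>v\<in>A. {\<sigma> \<in> code_space M. \<sigma> i = v})" by auto
    also have "\<dots> \<in> sets (code_borel M)"
      using that two countable_subset[OF that] by (intro sets.countable_UN') auto
    finally show ?thesis .
  qed
  then show "sets ?P \<subseteq> sets (code_borel M)"
    unfolding sets_PiM_single using sp unfolding space_PiM[symmetric]
    by (subst space_code_borel[symmetric, folded sp], intro sets.sigma_sets_subset) auto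
qed

lemma space_past [simp]: "space (past_algebra M) = code_space M"
  unfolding past_algebra_def by (intro space_measure_of) (auto simp: cylinder_def)

lemma sets_past: "sets (past_algebra M) = sigma_sets (code_space M) {cylinder M m 0 \<eta> | m \<eta>. m \<le> 0 \<and> \<eta> \<in> code_space M}"
  unfolding past_algebra_def by (intro sets_measure_of) (auto simp: cylinder_def)

lemma code_coord [measurable]: "(\<lambda>\<sigma>. \<sigma> i) \<in> code_borel M \<rightarrow>\<^sub>M count_space letters"
  unfolding measurable_cong_sets[OF sets_code_borel refl] by measurable

lemma cylinder_measurable [measurable]: "cylinder M m n \<eta> \<in> sets (code_borel M)"
proof -
  have "cylinder M m n \<eta> = {\<sigma> \<in> space (code_borel M). \<forall>i\<in>{m..n}. \<sigma> i = \<eta> i}" by (simp add: cylinder_def)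
  also have "\<dots> \<in> sets (code_borel M)" by measurable
  finally show ?thesis .
qed

lemma past_subset: "sets (past_algebra M) \<subseteq> sets (code_borel M)"
  unfolding sets_past space_code_borel[symmetric] by (intro sets.sigma_sets_subset) auto

lemma past_coord:
  assumes "i \<le> 0"
  shows "(\<lambda>\<sigma>. \<sigma> i) \<in> past_algebra M \<rightarrow>\<^sub>M count_space letters"
proof (rule measurable_count_space_eq_countable[THEN iffD2, OF countable_letters], intro conjI ballI)
  fix v assume "v \<in> letters"
  let ?Z = "{\<eta> \<in> PiE {i..0} (\<lambda>_. letters). \<eta> i = v}"
  let ?ext = "\<lambda>\<eta> j. if j \<in> {i..0} then \<eta> j else None"
  have "(\<lambda>\<sigma>. \<sigma> i) -` {v} \<inter> space (past_algebra M) = (\<Union>\<eta>\<in>?Z. cylinder M i 0 (?ext \<eta>))"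
  proof (intro antisym subsetI)
    fix \<sigma> assume "\<sigma> \<in> (\<lambda>\<sigma>. \<sigma> i) -` {v} \<inter> space (past_algebra M)"
    then have "\<sigma> \<in> cylinder M i 0 (?ext (restrict \<sigma> {i..0}))" "restrict \<sigma> {i..0} \<in> ?Z"
      using assms by (auto simp: cylinder_def dest: code_spaceD)
    then show "\<sigma> \<in> (\<Union>\<eta>\<in>?Z. cylinder M i 0 (?ext \<eta>))" by blast
  qed (use assms in \<open>auto simp: cylinder_def\<close>)
  also have "\<dots> \<in> sets (past_algebra M)"
  proof (rule sets.countable_UN')
    have "countable (PiE {i..0} (\<lambda>_. letters))" by (intro countable_PiE) auto
    then show "countable ?Z" by (rule countable_subset[rotated]) auto
    show "(\<lambda>\<eta>. cylinder M i 0 (?ext \<eta>)) ` ?Z \<subseteq> sets (past_algebra M)"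
    proof (rule image_subsetI)
      fix \<eta> assume "\<eta> \<in> ?Z"
      then have "?ext \<eta> \<in> code_space M" by (auto simp: code_space_eq)
      then show "cylinder M i 0 (?ext \<eta>) \<in> sets (past_algebra M)"
        unfolding sets_past using assms by (intro sigma_sets.Basic) blast
    qed
  qed
  finally show "(\<lambda>\<sigma>. \<sigma> i) -` {v} \<inter> space (past_algebra M) \<in> sets (past_algebra M)" .
qed (auto dest: code_spaceD)

text \<open>
  Such a function is constant on each of countably many cylinders, so every preimage is measurable.  The
  points of \<open>K\<close> coded by finite words and their distances are measurable for this reason.
\<close>

lemma measurable_finite_dependence:
  assumes sp: "space N = code_space M" and J: "finite J"
    and coord: "\<And>i. i \<in> J \<Longrightarrow> (\<lambda>\<sigma>. \<sigma> i) \<in> N \<rightarrow>\<^sub>M count_space letters"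
    and dep: "\<And>\<sigma> \<tau>. \<sigma> \<in> code_space M \<Longrightarrow> \<tau> \<in> code_space M \<Longrightarrow> (\<And>i. i \<in> J \<Longrightarrow> \<sigma> i = \<tau> i) \<Longrightarrow> f \<sigma> = f \<tau>"
  shows "f \<in> N \<rightarrow>\<^sub>M count_space UNIV"
proof (rule measurableI)
  fix A
  let ?box = "\<lambda>\<eta>. {\<sigma> \<in> space N. \<forall>i\<in>J. \<sigma> i = \<eta> i}"
  let ?Z = "{\<eta> \<in> PiE J (\<lambda>_. letters). \<exists>\<sigma>\<in>?box \<eta>. f \<sigma> \<in> A}"
  have "f -` A \<inter> space N = (\<Union>\<eta>\<in>?Z. ?box \<eta>)"
  proof (intro antisym subsetI)
    fix \<sigma> assume "\<sigma> \<in> f -` A \<inter> space N"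
    then have "\<sigma> \<in> ?box (restrict \<sigma> J)" "restrict \<sigma> J \<in> ?Z" by (auto simp: sp dest: code_spaceD)
    then show "\<sigma> \<in> (\<Union>\<eta>\<in>?Z. ?box \<eta>)" by blast
  next
    fix \<sigma> assume "\<sigma> \<in> (\<Union>\<eta>\<in>?Z. ?box \<eta>)"
    then obtain \<eta> \<tau> where \<eta>: "\<sigma> \<in> ?box \<eta>" "\<tau> \<in> ?box \<eta>" "f \<tau> \<in> A" by auto
    then have "f \<sigma> = f \<tau>" by (intro dep) (auto simp: sp)
    then show "\<sigma> \<in> f -` A \<inter> space N" using \<eta> by auto
  qed
  also have "\<dots> \<in> sets N"
  proof (rule sets.countable_UN')
    have "countable (PiE J (\<lambda>_. letters))" using J by (intro countable_PiE) auto
    then show "countable ?Z" by (rule countable_subset[rotated]) auto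
    show "?box ` ?Z \<subseteq> sets N"
    proof (rule image_subsetI, rule sets.sets_Collect_countable_All'[OF _ countable_finite[OF J]])
      fix \<eta> i assume "i \<in> J"
      from measurable_sets[OF coord[OF this], of "{\<eta> i} \<inter> letters"]
      have "(\<lambda>\<sigma>. \<sigma> i) -` ({\<eta> i} \<inter> letters) \<inter> space N \<in> sets N" by auto
      also have "(\<lambda>\<sigma>. \<sigma> i) -` ({\<eta> i} \<inter> letters) \<inter> space N = {\<sigma> \<in> space N. \<sigma> i = \<eta> i}"
        by (auto simp: sp dest: code_spaceD[of _ i])
      finally show "{\<sigma> \<in> space N. \<sigma> i = \<eta> i} \<in> sets N" .
    qed
  qed
  finally show "f -` A \<inter> space N \<in> sets N" .
qed auto

lemma past_measurable_finite_dependence: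
  assumes "\<And>\<sigma> \<tau>. \<sigma> \<in> code_space M \<Longrightarrow> \<tau> \<in> code_space M \<Longrightarrow> (\<And>i. i \<in> {- int n..0} \<Longrightarrow> \<sigma> i = \<tau> i) \<Longrightarrow> f \<sigma> = f \<tau>"
  shows "f \<in> past_algebra M \<rightarrow>\<^sub>M count_space UNIV"
proof (rule measurable_finite_dependence[of _ "{- int n..0}"])
  show "(\<lambda>\<sigma>. \<sigma> i) \<in> past_algebra M \<rightarrow>\<^sub>M count_space letters" if "i \<in> {- int n..0}" for i
    using that past_coord by simp
qed (simp, simp, rule assms)

lemma Sigma_G_measurable [measurable]: "Sigma_G M \<in> sets (code_borel M)"
proof -
  let ?P = "\<lambda>n \<sigma>. \<sigma> n \<in> Some ` edges M \<and> srcb M (\<sigma> (n + 1)) = tgtb M (\<sigma> n)"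
  have [measurable]: "?P n \<in> code_borel M \<rightarrow>\<^sub>M count_space UNIV" for n :: int
    by (rule measurable_finite_dependence[of _ "{n, n+1}"]) (auto intro: code_coord)
  have "Sigma_G M = {\<sigma> \<in> space (code_borel M). \<forall>n. ?P n \<sigma>}" by (simp add: Sigma_G_def)
  also have "\<dots> \<in> sets (code_borel M)" by measurable
  finally show ?thesis .
qed

lemma past_point_cong:
  assumes "\<And>i. i \<in> {- int n..0} \<Longrightarrow> \<sigma> i = \<tau> i"
  shows "past_comp M \<sigma> n = past_comp M \<tau> n" "past_point M x \<sigma> n = past_point M x \<tau> n"
proof -
  show *: "past_comp M \<sigma> n = past_comp M \<tau> n"
    using assms
  proof (induction n)
    case (Suc n)
    have "past_comp M \<sigma> n = past_comp M \<tau> n" by (rule Suc.IH) (use Suc.prems in auto)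
    then show ?case using Suc.prems by simp
  qed simp
  show "past_point M x \<sigma> n = past_point M x \<tau> n"
    using assms[of "- int n"] by (simp add: past_point_def *)
qed

lemma past_point_measurable:
  "(\<lambda>\<sigma>. g (past_point M x \<sigma> m) (past_point M x \<sigma> n)) \<in> past_algebra M \<rightarrow>\<^sub>M count_space UNIV"
proof (rule past_measurable_finite_dependence[of "max m n"])
  fix \<sigma> \<tau> :: "int \<Rightarrow> 'e option"
  assume "\<And>i. i \<in> {- int (max m n)..0} \<Longrightarrow> \<sigma> i = \<tau> i"
  then have "past_point M x \<sigma> m = past_point M x \<tau> m" "past_point M x \<sigma> n = past_point M x \<tau> n"
    by (auto intro!: past_point_cong)
  then show "g (past_point M x \<sigma> m) (past_point M x \<sigma> n) = g (past_point M x \<tau> m) (past_point M x \<tau> n)" by simp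
qed

lemma past_convergent_measurable:
  "{\<sigma> \<in> space (past_algebra M). convergent (past_point M x \<sigma>)} \<in> sets (past_algebra M)"
proof -
  have [measurable]: "(\<lambda>\<sigma> :: int \<Rightarrow> 'e option. dist (past_point M x \<sigma> m) (past_point M x \<sigma> n) < c) \<in> past_algebra M \<rightarrow>\<^sub>M count_space UNIV" for m n and c :: real
    by (rule past_point_measurable[of "\<lambda>y z. dist y z < c"])
  show ?thesis
    unfolding Cauchy_convergent_iff[symmetric] metric_Cauchy_iff2 by measurable
qed

text \<open>
  \<open>Fmap\<close> depends on the future through \<open>Sigma_G\<close>.  This version reads only the coordinates up to \<open>0\<close>,
  hence is measurable for the past, and it agrees with \<open>Fmap\<close> on \<open>Sigma_G\<close>.
\<close>

definition limit_point :: "(nat \<Rightarrow> 'k) \<Rightarrow> (int \<Rightarrow> 'e option) \<Rightarrow> 'k" where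
  "limit_point x \<sigma> = (if convergent (past_point M x \<sigma>) then lim (past_point M x \<sigma>) else x (tgtb M (\<sigma> 0)))"

lemma limit_point_measurable [measurable]: "limit_point x \<in> past_algebra M \<rightarrow>\<^sub>M borel"
proof (rule borel_measurable_LIMSEQ_metric)
  have [measurable]: "(\<lambda>\<sigma>. past_point M x \<sigma> n) \<in> past_algebra M \<rightarrow>\<^sub>M borel" for n
    using measurable_compose[OF past_point_measurable[of "\<lambda>y _. y" x n n], of id borel] by simp
  have [measurable]: "(\<lambda>\<sigma>. x (tgtb M (\<sigma> 0))) \<in> past_algebra M \<rightarrow>\<^sub>M borel"
    using measurable_compose[OF past_measurable_finite_dependence[of 0 "\<lambda>\<sigma>. x (tgtb M (\<sigma> 0))"], of id borel] by simp
  note [measurable] = past_convergent_measurable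
  show "(\<lambda>\<sigma>. if convergent (past_point M x \<sigma>) then past_point M x \<sigma> n else x (tgtb M (\<sigma> 0))) \<in> past_algebra M \<rightarrow>\<^sub>M borel" for n
    by measurable
  show "(\<lambda>n. if convergent (past_point M x \<sigma>) then past_point M x \<sigma> n else x (tgtb M (\<sigma> 0))) \<longlonglongrightarrow> limit_point x \<sigma>" for \<sigma>
    by (auto simp: limit_point_def convergent_LIMSEQ_iff)
qed

lemma Fmap_eq_limit_point: "\<sigma> \<in> Sigma_G M \<Longrightarrow> Fmap M x \<sigma> = limit_point x \<sigma>"
  by (auto simp: Fmap_def Dset_def limit_point_def)

lemma past_comp_shift: "past_comp M (shift \<sigma>) (Suc n) = mpb M (\<sigma> 1) \<circ> past_comp M \<sigma> n"
proof (induction n)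
  case (Suc n)
  have "past_comp M (shift \<sigma>) (Suc (Suc n)) = past_comp M (shift \<sigma>) (Suc n) \<circ> mpb M (\<sigma> (- int (Suc n)))"
    by (subst past_comp.simps(2)) (simp add: shift_def algebra_simps)
  also have "\<dots> = mpb M (\<sigma> 1) \<circ> past_comp M \<sigma> (Suc n)"
    unfolding Suc by (simp add: comp_assoc)
  finally show ?case .
qed (simp add: shift_def)

lemma past_point_shift: "past_point M x (shift \<sigma>) (Suc n) = mpb M (\<sigma> 1) (past_point M x \<sigma> n)"
proof -
  have "shift \<sigma> (- int (Suc n)) = \<sigma> (- int n)" by (simp add: shift_def)
  then show ?thesis unfolding past_point_def past_comp_shift by simp
qed

lemma Sigma_GD:
  assumes "\<sigma> \<in> Sigma_G M"
  shows "\<exists>e\<in>edges M. \<sigma> n = Some e" "srcb M (\<sigma> (n + 1)) = tgtb M (\<sigma> n)" "\<sigma> \<in> code_space M"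
  using assms by (auto simp: Sigma_G_def)

lemma shift_code_space: "\<sigma> \<in> code_space M \<Longrightarrow> shift \<sigma> \<in> code_space M"
  by (simp add: code_space_eq shift_def)

lemma shift_measurable [measurable]: "shift \<in> code_borel M \<rightarrow>\<^sub>M code_borel M"
proof -
  have "(\<lambda>\<sigma> i. \<sigma> (i + 1)) \<in> code_borel M \<rightarrow>\<^sub>M (\<Pi>\<^sub>M i\<in>UNIV. count_space letters)"
    by (rule measurable_PiM_single') (auto simp: code_space_eq PiE_def)
  then show ?thesis unfolding measurable_cong_sets[OF refl sets_code_borel] shift_def[abs_def] .
qed

lemma cell_of_past_comp:
  assumes "\<sigma> \<in> Sigma_G M" "cell_of z = srcb M (\<sigma> (- int n))"
  shows "cell_of (past_comp M \<sigma> n z) = tgtb M (\<sigma> 0)"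
  using assms(2)
proof (induction n arbitrary: z)
  case 0
  obtain e where "e \<in> edges M" "\<sigma> 0 = Some e" using Sigma_GD(1)[OF assms(1)] by blast
  then show ?case using 0 cell_of_mp[of e z] by simp
next
  case (Suc n)
  obtain e where e: "e \<in> edges M" "\<sigma> (- int (Suc n)) = Some e" using Sigma_GD(1)[OF assms(1)] by blast
  have "srcb M (\<sigma> (- int n)) = tgt M e" using Sigma_GD(2)[OF assms(1), of "- int (Suc n)"] e by simp
  then have "cell_of (mp M e z) = srcb M (\<sigma> (- int n))"
    using cell_of_mp[OF e(1), of z] Suc.prems e by simp
  from Suc.IH[OF this] show ?case using e by simp
qed

text \<open>
  The empty set makes the family stable under intersections.
\<close>

definition past_cylinders :: "(int \<Rightarrow> 'e option) set set" where
  "past_cylinders = insert {} {cylinder M m 0 \<eta> | m \<eta>. m \<le> 0 \<and> \<eta> \<in> code_space M}"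

lemma past_cylindersI: "m \<le> 0 \<Longrightarrow> \<eta> \<in> code_space M \<Longrightarrow> cylinder M m 0 \<eta> \<in> past_cylinders"
  unfolding past_cylinders_def by blast

lemma sets_past_cylinders: "sets (past_algebra M) = sigma_sets (code_space M) past_cylinders"
  unfolding sets_past past_cylinders_def
  by (intro sigma_sets_eqI) (auto intro: sigma_sets.Empty sigma_sets.Basic)

lemma Int_stable_past_cylinders: "Int_stable past_cylinders"
proof -
  have *: "cylinder M m 0 \<eta> \<inter> cylinder M m' 0 \<eta>' \<in> past_cylinders"
    if "m \<le> m'" "m' \<le> 0" "\<eta> \<in> code_space M" for m m' \<eta> \<eta>'
  proof (cases "\<forall>i\<in>{m'..0}. \<eta> i = \<eta>' i")
    case True
    then have "cylinder M m 0 \<eta> \<inter> cylinder M m' 0 \<eta>' = cylinder M m 0 \<eta>"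
      using that by (auto simp: cylinder_def)
    then show ?thesis using past_cylindersI[of m \<eta>] that by simp
  next
    case False
    then have "cylinder M m 0 \<eta> \<inter> cylinder M m' 0 \<eta>' = {}"
      using that by (force simp: cylinder_def)
    then show ?thesis by (simp add: past_cylinders_def)
  qed
  show ?thesis
  proof (rule Int_stableI)
    fix A B assume A: "A \<in> past_cylinders" and B: "B \<in> past_cylinders"
    show "A \<inter> B \<in> past_cylinders"
    proof (cases "A = {} \<or> B = {}")
      case True
      then show ?thesis by (auto simp: past_cylinders_def)
    next
      case False
      then obtain m \<eta> m' \<eta>' where AB: "A = cylinder M m 0 \<eta>" "m \<le> 0" "\<eta> \<in> code_space M"
        "B = cylinder M m' 0 \<eta>'" "m' \<le> 0" "\<eta>' \<in> code_space M"
        using A B by (auto simp: past_cylinders_def)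
      show ?thesis
        using *[of m m' \<eta> \<eta>'] *[of m' m \<eta>' \<eta>] AB by (cases "m \<le> m'") (auto simp: Int_commute)
    qed
  qed
qed

lemma past_measure_eqI:
  assumes N1: "sets N1 = sets (past_algebra M)" and N2: "sets N2 = sets (past_algebra M)"
    and fin: "finite_measure N1"
    and eq: "\<And>m \<eta>. \<eta> \<in> code_space M \<Longrightarrow> emeasure N1 (cylinder M (- int m) 0 \<eta>) = emeasure N2 (cylinder M (- int m) 0 \<eta>)"
  shows "N1 = N2"
proof (rule measure_eqI_generator_eq_countable)
  show "Int_stable past_cylinders" by (rule Int_stable_past_cylinders)
  show "past_cylinders \<subseteq> Pow (code_space M)" by (auto simp: past_cylinders_def cylinder_def)
  show "sets N1 = sigma_sets (code_space M) past_cylinders" "sets N2 = sigma_sets (code_space M) past_cylinders"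
    using N1 N2 by (simp_all add: sets_past_cylinders)
  show "emeasure N1 X = emeasure N2 X" if "X \<in> past_cylinders" for X
  proof -
    from that consider "X = {}" | m \<eta> where "X = cylinder M m 0 \<eta>" "m \<le> 0" "\<eta> \<in> code_space M"
      by (auto simp: past_cylinders_def)
    then show ?thesis
    proof cases
      case 2
      then have "X = cylinder M (- int (nat (- m))) 0 \<eta>" by simp
      then show ?thesis using eq[OF 2(3), of "nat (- m)"] by simp
    qed simp
  qed
  let ?A = "(\<lambda>v. cylinder M 0 0 (\<lambda>_. v)) ` letters"
  show "?A \<subseteq> past_cylinders" unfolding past_cylinders_def by (auto simp: code_space_eq)
  show "\<Union>?A = code_space M" by (auto simp: cylinder_def intro: code_spaceD)
  show "countable ?A" by simp
  show "emeasure N1 X \<noteq> \<infinity>" for X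
    using finite_measure.emeasure_finite[OF fin] by simp
qed

end

context contractive_markov
begin

lemma cell_of_past_point:
  assumes "\<sigma> \<in> Sigma_G M"
  shows "cell_of (past_point M x \<sigma> n) = tgtb M (\<sigma> 0)"
proof -
  obtain e where e: "e \<in> edges M" "\<sigma> (- int n) = Some e" using Sigma_GD(1)[OF assms(1)] by blast
  then show ?thesis unfolding past_point_def by (intro cell_of_past_comp assms) simp
qed

text \<open>
  Uniform continuity of \<open>p\<^sub>e\<close> on its cell gives an extension to the closure, and continuity makes it
  unique, so that the definite description in \<open>pbar\<close> is meaningful.
\<close>

lemma pbar:
  assumes e: "e \<in> edges M"
  shows pbar_continuous: "continuous_on (closure (cell M (src M e))) (pbar M e)"
    and pbar_eq: "\<And>y. y \<in> cell M (src M e) \<Longrightarrow> pbar M e y = pr M e y"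
    and pbar_outside: "\<And>y. y \<notin> closure (cell M (src M e)) \<Longrightarrow> pbar M e y = 0"
proof -
  let ?S = "cell M (src M e)"
  let ?P = "\<lambda>g. continuous_on (closure ?S) g \<and> (\<forall>y\<in>?S. g y = pr M e y) \<and> (\<forall>y. y \<notin> closure ?S \<longrightarrow> g y = 0)"
  have "uniformly_continuous_on ?S (pr M e)"
    using unif_cont e by (simp add: uniformly_continuous_system_def)
  from uniformly_continuous_on_extension_on_closure[OF this]
  obtain g where g: "uniformly_continuous_on (closure ?S) g" "\<And>y. y \<in> ?S \<Longrightarrow> pr M e y = g y"
    by metis
  define h where "h y = (if y \<in> closure ?S then g y else 0)" for y
  have "continuous_on (closure ?S) h"
    using uniformly_continuous_imp_continuous[OF g(1)] by (rule continuous_on_eq) (simp add: h_def)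
  then have h: "?P h"
    using g(2) closure_subset[of ?S] by (auto simp: h_def)
  have "\<exists>!g. ?P g"
  proof (rule ex1I[where a = h], rule h, rule ext)
    fix k y assume k: "?P k"
    show "k y = h y"
    proof (cases "y \<in> closure ?S")
      case True
      show ?thesis
      proof -
        obtain s where s: "\<And>n. s n \<in> ?S" "s \<longlonglongrightarrow> y" using True by (auto simp: closure_sequential)
        have "(k \<circ> s) \<longlonglongrightarrow> k y" "(h \<circ> s) \<longlonglongrightarrow> h y"
          using k h s True unfolding continuous_on_closure_sequentially by blast+
        moreover have "k \<circ> s = h \<circ> s" using k h s(1) by auto
        ultimately show ?thesis using LIMSEQ_unique by metis
      qed
    next
      case False
      then show ?thesis using k h by simp
    qed
  qed
  from theI'[OF this] have "?P (pbar M e)" unfolding pbar_def .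
  then show "continuous_on (closure ?S) (pbar M e)"
    "\<And>y. y \<in> ?S \<Longrightarrow> pbar M e y = pr M e y" "\<And>y. y \<notin> closure ?S \<Longrightarrow> pbar M e y = 0"
    by blast+
qed

end

section \<open>Invariant measures from non-degenerate code measures\<close>

context contractive_markov
begin

lemma Dset_tendsto:
  assumes "\<sigma> \<in> Dset M x"
  shows "past_point M x \<sigma> \<longlonglongrightarrow> limit_point x \<sigma>" "\<sigma> \<in> Sigma_G M"
  using assms by (auto simp: Dset_def limit_point_def convergent_LIMSEQ_iff)

lemma pbar_measurable:
  assumes e: "e \<in> edges M"
  shows "pbar M e \<in> borel_measurable borel"
proof -
  have "(\<lambda>y. indicator (closure (cell M (src M e))) y *\<^sub>R pbar M e y) \<in> borel_measurable borel"
    by (intro borel_measurable_continuous_on_indicator pbar_continuous[OF e]) simp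
  moreover have "(\<lambda>y. indicator (closure (cell M (src M e))) y *\<^sub>R pbar M e y) = pbar M e"
  proof (rule ext)
    show "indicator (closure (cell M (src M e))) y *\<^sub>R pbar M e y = pbar M e y" for y
      using pbar_outside[OF e, of y] by (auto simp: indicator_def)
  qed
  ultimately show ?thesis by simp
qed

lemma pbar_bounds:
  assumes e: "e \<in> edges M"
  shows "0 \<le> pbar M e y" "pbar M e y \<le> 1"
proof -
  have "0 \<le> pbar M e y \<and> pbar M e y \<le> 1"
  proof (cases "y \<in> closure (cell M (src M e))")
    case True
    then show ?thesis
      using continuous_le_on_closure[OF pbar_continuous[OF e] True, of 1]
        continuous_ge_on_closure[OF pbar_continuous[OF e] True, of 0] pr_le_1[OF e] pr_nonneg[OF e]
      by (simp add: pbar_eq[OF e])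
  qed (simp add: pbar_outside[OF e])
  then show "0 \<le> pbar M e y" "pbar M e y \<le> 1" by auto
qed

text \<open>
  The coded points of finite words lie in the cell, where \<open>pbar\<close> is \<open>p\<^sub>e\<close>, while their limit is only known
  to lie in its closure.
\<close>

lemma pbar_tendsto:
  assumes e: "e \<in> edges M" and \<sigma>: "\<sigma> \<in> Dset M x" and tgt: "tgtb M (\<sigma> 0) = src M e"
  shows "(\<lambda>n. pr M e (past_point M x \<sigma> n)) \<longlonglongrightarrow> pbar M e (limit_point x \<sigma>)"
proof -
  have cell: "past_point M x \<sigma> n \<in> cell M (src M e)" for n
    using cell_of_past_point[OF Dset_tendsto(2)[OF \<sigma>], of n] in_cell_of[of "past_point M x \<sigma> n"] tgt by simp
  have "limit_point x \<sigma> \<in> closure (cell M (src M e))"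
    using cell Dset_tendsto(1)[OF \<sigma>] unfolding closure_sequential by blast
  then have "(pbar M e \<circ> past_point M x \<sigma>) \<longlonglongrightarrow> pbar M e (limit_point x \<sigma>)"
    using pbar_continuous[OF e] cell Dset_tendsto(1)[OF \<sigma>] unfolding continuous_on_closure_sequentially by blast
  then show ?thesis using pbar_eq[OF e cell] by (simp add: comp_def)
qed

text \<open>
  The approximants of the shifted code are the images under \<open>w\<^sub>e\<close> of the approximants of the code, and \<open>w\<^sub>e\<close>
  is continuous at the limit as soon as the limit lies in the cell itself.
\<close>

lemma limit_point_shift:
  assumes \<sigma>: "\<sigma> \<in> Dset M x" and cell: "cell_of (limit_point x \<sigma>) = tgtb M (\<sigma> 0)" and e: "\<sigma> 1 = Some e"
  shows "limit_point x (shift \<sigma>) = mp M e (limit_point x \<sigma>)"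
    and "src M e = cell_of (limit_point x \<sigma>)" and "e \<in> edges M"
proof -
  note lim = Dset_tendsto(1)[OF \<sigma>] and G = Dset_tendsto(2)[OF \<sigma>]
  show E: "e \<in> edges M" using Sigma_GD(1)[OF G, of 1] e by auto
  show src: "src M e = cell_of (limit_point x \<sigma>)" using Sigma_GD(2)[OF G, of 0] e cell by simp
  have cellI: "y \<in> cell M (src M e)" if "cell_of y = tgtb M (\<sigma> 0)" for y
    using that src cell in_cell_of[of y] by simp
  have "uniformly_continuous_on (cell M (src M e)) (mp M e)"
    using unif_cont E by (simp add: uniformly_continuous_system_def)
  then have "continuous_on (cell M (src M e)) (mp M e)" by (rule uniformly_continuous_imp_continuous)
  then have "(\<lambda>n. mp M e (past_point M x \<sigma> n)) \<longlonglongrightarrow> mp M e (limit_point x \<sigma>)"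
    by (rule continuous_on_tendsto_compose[OF _ lim]) (auto intro!: cellI cell cell_of_past_point[OF G] always_eventually)
  then have "(\<lambda>n. past_point M x (shift \<sigma>) (Suc n)) \<longlonglongrightarrow> mp M e (limit_point x \<sigma>)"
    by (simp add: past_point_shift e)
  then have "past_point M x (shift \<sigma>) \<longlonglongrightarrow> mp M e (limit_point x \<sigma>)" by (rule LIMSEQ_imp_Suc)
  then show "limit_point x (shift \<sigma>) = mp M e (limit_point x \<sigma>)"
    by (auto simp: limit_point_def convergent_def limI)
qed

lemma EtildeD:
  assumes "\<Lambda> \<in> Etilde M x"
  shows "sets \<Lambda> = sets (code_borel M)" "prob_space \<Lambda>" "distr \<Lambda> \<Lambda> shift = \<Lambda>"
    "emeasure \<Lambda> (Dset M x) = 1"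
    "\<And>e. e \<in> edges M \<Longrightarrow> AE \<sigma> in \<Lambda>.
        real_cond_exp \<Lambda> (past_algebra M) (indicator (cylinder M 1 1 (\<lambda>_. Some e))) \<sigma> =
          pbar M e (Fmap M x \<sigma>) * indicator (Tset M (src M e)) \<sigma>"
  using assms by (auto simp: Etilde_def shift_invariant_probs_def)

text \<open>
  Let \<open>B\<close> be the set of codes whose limit point lies in the cell indicated by their last letter.  By
  \<open>limit_point_shift\<close> the shift maps \<open>B\<close> into itself up to null sets, so \<open>B\<close> and its preimage, which have the
  same measure, agree almost surely.  On \<open>B\<close> the extension \<open>pbar\<close> takes the values of \<open>p\<^sub>e\<close>, hence the limit
  point moves like the chain, and its law given \<open>B\<close> is invariant.
\<close>

theorem nondegenerate_imp_invariant:
  assumes \<Lambda>: "\<Lambda> \<in> Etilde M x" and j: "j \<in> idx M"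
    and pos: "emeasure \<Lambda> (Tset M j \<inter> Fmap M x -` cell M j) > 0"
  shows "invariant_probs M \<noteq> {}"
proof -
  note [measurable_cong] = EtildeD(1)[OF \<Lambda>]
  interpret prob_space \<Lambda> by (rule EtildeD[OF \<Lambda>])
  have sp: "space \<Lambda> = code_space M" using sets_eq_imp_space_eq[OF EtildeD(1)[OF \<Lambda>]] by simp
  have sub: "subalgebra \<Lambda> (past_algebra M)"
    using past_subset EtildeD(1)[OF \<Lambda>] by (simp add: subalgebra_def sp)
  interpret finite_measure_subalgebra \<Lambda> "past_algebra M"
    by unfold_locales (rule sub)
  let ?Y = "limit_point x"
  have Y [measurable]: "?Y \<in> \<Lambda> \<rightarrow>\<^sub>M borel" by (rule measurable_from_subalg[OF sub limit_point_measurable])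
  have shift [measurable]: "shift \<in> \<Lambda> \<rightarrow>\<^sub>M \<Lambda>"
    unfolding measurable_cong_sets[OF EtildeD(1)[OF \<Lambda>] EtildeD(1)[OF \<Lambda>]] by (rule shift_measurable)
  have AE_D: "AE \<sigma> in \<Lambda>. \<sigma> \<in> Dset M x"
    using EtildeD(4)[OF \<Lambda>] by (intro AE_prob_1) (simp add: emeasure_eq_measure)
  have tgt0 [measurable]: "(\<lambda>\<sigma>. tgtb M (\<sigma> 0)) \<in> past_algebra M \<rightarrow>\<^sub>M count_space UNIV"
    by (rule past_measurable_finite_dependence[of 0]) simp
  define B where "B = {\<sigma> \<in> space (past_algebra M). cell_of (?Y \<sigma>) = tgtb M (\<sigma> 0)}"
  have B_past [measurable]: "B \<in> sets (past_algebra M)" unfolding B_def by measurable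
  have B [measurable]: "B \<in> sets \<Lambda>" using sub B_past by (auto simp: subalgebra_def)
  have "Tset M j \<inter> Fmap M x -` cell M j \<subseteq> B"
    using j by (auto simp: B_def Tset_def Fmap_eq_limit_point Sigma_GD(3) in_cell_iff)
  then have "emeasure \<Lambda> (Tset M j \<inter> Fmap M x -` cell M j) \<le> emeasure \<Lambda> B" by (intro emeasure_mono) auto
  then have B0: "emeasure \<Lambda> B \<noteq> 0" using pos by auto
  have B_inv: "AE \<sigma> in \<Lambda>. \<sigma> \<in> B \<longrightarrow> shift \<sigma> \<in> B"
    using AE_D AE_space
  proof eventually_elim
    case (elim \<sigma>)
    note G = Dset_tendsto(2)[OF elim(1)]
    show ?case
    proof
      assume "\<sigma> \<in> B"
      then have c: "cell_of (?Y \<sigma>) = tgtb M (\<sigma> 0)" by (simp add: B_def)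
      obtain e where e: "\<sigma> 1 = Some e" using Sigma_GD(1)[OF G, of 1] by auto
      note s = limit_point_shift[OF elim(1) c e]
      have "cell_of (?Y (shift \<sigma>)) = tgt M e" using s cell_of_mp[OF s(3,2)] by simp
      also have "\<dots> = tgtb M (shift \<sigma> 0)" using e by (simp add: shift_def)
      finally show "shift \<sigma> \<in> B" using shift_code_space elim(2) by (simp add: B_def sp)
    qed
  qed
  define B1 where "B1 = {\<sigma> \<in> space \<Lambda>. shift \<sigma> \<in> B}"
  have B1 [measurable]: "B1 \<in> sets \<Lambda>" unfolding B1_def by measurable
  have shift_measure: "emeasure \<Lambda> {\<sigma> \<in> space \<Lambda>. shift \<sigma> \<in> A} = emeasure \<Lambda> A" if "A \<in> sets \<Lambda>" for A
  proof -
    have "emeasure \<Lambda> A = emeasure (distr \<Lambda> \<Lambda> shift) A" using EtildeD(3)[OF \<Lambda>] by simp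
    also have "\<dots> = emeasure \<Lambda> (shift -` A \<inter> space \<Lambda>)" using that by (intro emeasure_distr) auto
    also have "shift -` A \<inter> space \<Lambda> = {\<sigma> \<in> space \<Lambda>. shift \<sigma> \<in> A}" by auto
    finally show ?thesis by simp
  qed
  \<comment> \<open>\<open>B\<close> is contained in its preimage \<open>B1\<close> up to a null set, and the two have the same finite measure.\<close>
  have B_eq: "AE \<sigma> in \<Lambda>. \<sigma> \<in> B \<longleftrightarrow> shift \<sigma> \<in> B"
  proof -
    have "emeasure \<Lambda> (B1 \<inter> B) = emeasure \<Lambda> B"
    proof (rule emeasure_eq_AE)
      show "AE \<sigma> in \<Lambda>. \<sigma> \<in> B1 \<inter> B \<longleftrightarrow> \<sigma> \<in> B"
        using B_inv AE_space by eventually_elim (auto simp: B1_def)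
    qed auto
    moreover have "emeasure \<Lambda> B1 = emeasure \<Lambda> B"
      unfolding B1_def by (intro shift_measure B)
    moreover have "emeasure \<Lambda> (B1 - B1 \<inter> B) = emeasure \<Lambda> B1 - emeasure \<Lambda> (B1 \<inter> B)"
      by (intro emeasure_Diff) auto
    ultimately have "emeasure \<Lambda> (B1 - B1 \<inter> B) = 0" by simp
    then have "B1 - B1 \<inter> B \<in> null_sets \<Lambda>" by auto
    then have "AE \<sigma> in \<Lambda>. \<sigma> \<notin> B1 - B1 \<inter> B" by (rule AE_not_in)
    then show ?thesis using B_inv AE_space by eventually_elim (auto simp: B1_def)
  qed
  define U where "U = uniform_measure \<Lambda> B"
  have [measurable_cong]: "sets U = sets (code_borel M)" by (simp add: U_def EtildeD(1)[OF \<Lambda>])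
  have YU [measurable]: "?Y \<in> U \<rightarrow>\<^sub>M borel" using Y by (simp add: U_def)
  interpret U: prob_space U
    unfolding U_def using B0 by (intro prob_space_uniform_measure) auto
  define \<nu> where "\<nu> = distr U borel ?Y"
  have \<nu>: "sets \<nu> = sets borel" "prob_space \<nu>"
    unfolding \<nu>_def by (auto intro: U.prob_space_distr YU)
  \<comment> \<open>The conditional expectation formula on the past event that the code lies in \<open>B\<close> and \<open>w\<^sub>e\<close> moves its
    limit point into \<open>A\<close>.\<close>
  have cond: "(\<integral>\<^sup>+ \<sigma>. ennreal (pr M e (?Y \<sigma>)) * indicator A (mp M e (?Y \<sigma>)) * indicator B \<sigma> \<partial>\<Lambda>)
      = emeasure \<Lambda> {\<sigma> \<in> B. mp M e (?Y \<sigma>) \<in> A \<and> \<sigma> 1 = Some e}"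
    if A [measurable]: "A \<in> sets borel" and e: "e \<in> edges M" for A e
  proof -
    note [measurable] = mp_meas[OF e] pr_meas[OF e]
    let ?S = "{\<sigma> \<in> space (past_algebra M). \<sigma> \<in> B \<and> mp M e (?Y \<sigma>) \<in> A}"
    let ?c = "cylinder M 1 1 (\<lambda>_. Some e)"
    have S_past: "?S \<in> sets (past_algebra M)" by measurable
    then have S [measurable]: "?S \<in> sets \<Lambda>" using sub by (auto simp: subalgebra_def)
    have c [measurable]: "?c \<in> sets \<Lambda>" by measurable
    have int: "integrable \<Lambda> (indicator ?c :: _ \<Rightarrow> real)" by (simp add: integrable_real_indicator[OF c] less_top[symmetric])
    have "(\<integral>\<^sup>+ \<sigma>. ennreal (pr M e (?Y \<sigma>)) * indicator A (mp M e (?Y \<sigma>)) * indicator B \<sigma> \<partial>\<Lambda>)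
      = (\<integral>\<^sup>+ \<sigma>. ennreal (indicator ?S \<sigma> * pr M e (?Y \<sigma>)) \<partial>\<Lambda>)"
      by (intro nn_integral_cong) (auto simp: indicator_def sp)
    also have "\<dots> = ennreal (\<integral>\<sigma>. indicator ?S \<sigma> * pr M e (?Y \<sigma>) \<partial>\<Lambda>)"
    proof (intro nn_integral_eq_integral integrable_const_bound[where B = 1] AE_I2)
      show "norm (indicator ?S \<sigma> * pr M e (?Y \<sigma>)) \<le> 1" for \<sigma>
        using pr_nonneg[OF e, of "?Y \<sigma>"] pr_le_1[OF e, of "?Y \<sigma>"] by (simp add: indicator_def)
      show "0 \<le> indicator ?S \<sigma> * pr M e (?Y \<sigma>)" for \<sigma>
        using pr_nonneg[OF e, of "?Y \<sigma>"] by simp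
    qed measurable
    also have "(\<integral>\<sigma>. indicator ?S \<sigma> * pr M e (?Y \<sigma>) \<partial>\<Lambda>)
        = (\<integral>\<sigma>\<in>?S. real_cond_exp \<Lambda> (past_algebra M) (indicator ?c) \<sigma> \<partial>\<Lambda>)"
      unfolding set_lebesgue_integral_def
    proof (intro integral_cong_AE)
      show "AE \<sigma> in \<Lambda>. indicator ?S \<sigma> * pr M e (?Y \<sigma>)
         = indicator ?S \<sigma> *\<^sub>R real_cond_exp \<Lambda> (past_algebra M) (indicator ?c) \<sigma>"
        using EtildeD(5)[OF \<Lambda> e] AE_D
      proof eventually_elim
        case (elim \<sigma>)
        note G = Dset_tendsto(2)[OF elim(2)]
        have F: "Fmap M x \<sigma> = ?Y \<sigma>" by (rule Fmap_eq_limit_point[OF G])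
        have "pr M e (?Y \<sigma>) = pbar M e (Fmap M x \<sigma>) * indicator (Tset M (src M e)) \<sigma>" if "\<sigma> \<in> B"
        proof (cases "tgtb M (\<sigma> 0) = src M e")
          case True
          then have "?Y \<sigma> \<in> cell M (src M e)" using that in_cell_of[of "?Y \<sigma>"] by (simp add: B_def)
          then show ?thesis using True pbar_eq[OF e] G by (simp add: F Tset_def)
        next
          case False
          then show ?thesis using that pr_outside[OF e, of "?Y \<sigma>"] by (simp add: B_def Tset_def)
        qed
        then show ?case using elim(1) by (auto simp: indicator_def)
      qed
    qed measurable
    also have "\<dots> = (\<integral>\<sigma>\<in>?S. indicator ?c \<sigma> \<partial>\<Lambda>)"
      by (rule real_cond_exp_intA[OF int S_past, symmetric])
    also have "\<dots> = (\<integral>\<sigma>. indicator (?S \<inter> ?c) \<sigma> \<partial>\<Lambda>)"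
      unfolding set_lebesgue_integral_def by (intro Bochner_Integration.integral_cong) (auto simp: indicator_def)
    also have "\<dots> = measure \<Lambda> (?S \<inter> ?c)"
      by (simp add: sp) (intro arg_cong[where f = "measure \<Lambda>"], auto simp: cylinder_def)
    also have "?S \<inter> ?c = {\<sigma> \<in> B. mp M e (?Y \<sigma>) \<in> A \<and> \<sigma> 1 = Some e}"
      by (auto simp: B_def cylinder_def)
    finally show ?thesis by (simp add: emeasure_eq_measure)
  qed
  have "Ustar M \<nu> = \<nu>"
  proof (rule measure_eqI)
    fix A assume "A \<in> sets (Ustar M \<nu>)"
    then have A [measurable]: "A \<in> sets borel" by simp
    let ?SA = "\<lambda>e. {\<sigma> \<in> B. mp M e (?Y \<sigma>) \<in> A \<and> \<sigma> 1 = Some e}"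
    have SA: "?SA e \<in> sets \<Lambda>" if e: "e \<in> edges M" for e
    proof -
      note [measurable] = mp_meas[OF e]
      have "?SA e = {\<sigma> \<in> space \<Lambda>. \<sigma> \<in> B \<and> mp M e (?Y \<sigma>) \<in> A \<and> \<sigma> \<in> cylinder M 1 1 (\<lambda>_. Some e)}"
        by (auto simp: B_def cylinder_def sp)
      also have "\<dots> \<in> sets \<Lambda>" by measurable
      finally show ?thesis .
    qed
    have "emeasure (Ustar M \<nu>) A = (\<integral>\<^sup>+ y. Uop M (indicator A) y \<partial>\<nu>)"
      by (rule emeasure_Ustar[OF sys \<nu>(1) A])
    also have "\<dots> = (\<integral>\<^sup>+ \<sigma>. Uop M (indicator A) (?Y \<sigma>) \<partial>U)"
      unfolding \<nu>_def by (intro nn_integral_distr) measurable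
    also have "\<dots> = (\<integral>\<^sup>+ \<sigma>. Uop M (indicator A) (?Y \<sigma>) * indicator B \<sigma> \<partial>\<Lambda>) / emeasure \<Lambda> B"
      unfolding U_def by (intro nn_integral_uniform_measure) measurable
    also have "(\<integral>\<^sup>+ \<sigma>. Uop M (indicator A) (?Y \<sigma>) * indicator B \<sigma> \<partial>\<Lambda>)
       = (\<integral>\<^sup>+ \<sigma>. (\<integral>\<^sup>+ e. ennreal (pr M e (?Y \<sigma>)) * indicator A (mp M e (?Y \<sigma>)) * indicator B \<sigma> \<partial>count_space (edges M)) \<partial>\<Lambda>)"
      unfolding Uop_def by (simp add: nn_integral_multc)
    also have "\<dots> = (\<integral>\<^sup>+ e. (\<integral>\<^sup>+ \<sigma>. ennreal (pr M e (?Y \<sigma>)) * indicator A (mp M e (?Y \<sigma>)) * indicator B \<sigma> \<partial>\<Lambda>) \<partial>count_space (edges M))"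
    proof (rule nn_integral_count_space_nn_integral[OF countable_edges])
      fix e assume e: "e \<in> edges M"
      note [measurable] = mp_meas[OF e] pr_meas[OF e]
      show "(\<lambda>\<sigma>. ennreal (pr M e (?Y \<sigma>)) * indicator A (mp M e (?Y \<sigma>)) * indicator B \<sigma>) \<in> borel_measurable \<Lambda>"
        by measurable
    qed
    also have "\<dots> = (\<integral>\<^sup>+ e. emeasure \<Lambda> (?SA e) \<partial>count_space (edges M))"
      by (intro nn_integral_cong cond) auto
    also have "\<dots> = emeasure \<Lambda> (\<Union>e\<in>edges M. ?SA e)"
      using SA countable_edges by (intro emeasure_UN_countable[symmetric]) (auto simp: disjoint_family_on_def)
    also have "\<dots> = emeasure \<Lambda> {\<sigma> \<in> space \<Lambda>. shift \<sigma> \<in> {\<sigma> \<in> space \<Lambda>. \<sigma> \<in> B \<and> ?Y \<sigma> \<in> A}}"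
    proof (rule emeasure_eq_AE)
      show "AE \<sigma> in \<Lambda>. \<sigma> \<in> (\<Union>e\<in>edges M. ?SA e) \<longleftrightarrow> \<sigma> \<in> {\<sigma> \<in> space \<Lambda>. shift \<sigma> \<in> {\<sigma> \<in> space \<Lambda>. \<sigma> \<in> B \<and> ?Y \<sigma> \<in> A}}"
        using AE_D B_eq AE_space
      proof eventually_elim
        case (elim \<sigma>)
        note G = Dset_tendsto(2)[OF elim(1)]
        obtain e where e: "\<sigma> 1 = Some e" using Sigma_GD(1)[OF G, of 1] by auto
        have ee: "e \<in> edges M" using Sigma_GD(1)[OF G, of 1] e by auto
        show ?case
        proof (cases "\<sigma> \<in> B")
          case True
          then have c: "cell_of (?Y \<sigma>) = tgtb M (\<sigma> 0)" by (simp add: B_def)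
          show ?thesis using True elim e ee limit_point_shift[OF elim(1) c e] shift_code_space
            by (auto simp: sp)
        next
          case False
          then show ?thesis using elim by auto
        qed
      qed
      show "(\<Union>e\<in>edges M. ?SA e) \<in> sets \<Lambda>"
        using SA countable_edges by (intro sets.countable_UN') auto
    qed measurable
    also have "\<dots> = emeasure \<Lambda> {\<sigma> \<in> space \<Lambda>. \<sigma> \<in> B \<and> ?Y \<sigma> \<in> A}"
      by (intro shift_measure) measurable
    also have "{\<sigma> \<in> space \<Lambda>. \<sigma> \<in> B \<and> ?Y \<sigma> \<in> A} = B \<inter> (?Y -` A \<inter> space \<Lambda>)" by (auto simp: B_def sp)
    also have "emeasure \<Lambda> \<dots> / emeasure \<Lambda> B = emeasure U (?Y -` A \<inter> space \<Lambda>)"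
      unfolding U_def by (intro emeasure_uniform_measure[symmetric]) auto
    also have "\<dots> = emeasure \<nu> A"
      unfolding \<nu>_def by (subst emeasure_distr) (auto simp: U_def)
    finally show "emeasure (Ustar M \<nu>) A = emeasure \<nu> A" .
  qed (simp add: \<nu>)
  then show ?thesis using \<nu> by (auto simp: invariant_probs_def borel_probs_def)
qed

end

section \<open>Limits of mass functions and stationary processes\<close>

lemma pmf_fatou:
  fixes Q :: "nat \<Rightarrow> 'w pmf"
  assumes lim: "\<And>w. (\<lambda>n. pmf (Q n) w) \<longlonglongrightarrow> pmf P w" and f: "\<And>w. f w < \<top>"
  shows "(\<integral>\<^sup>+ w. f w \<partial>P) \<le> liminf (\<lambda>n. \<integral>\<^sup>+ w. f w \<partial>Q n)"
proof -
  have "(\<lambda>n. ennreal (pmf (Q n) w) * f w) \<longlonglongrightarrow> ennreal (pmf P w) * f w" for w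
    using f[of w] by (intro tendsto_mult_ennreal tendsto_ennrealI lim tendsto_const) auto
  then have "liminf (\<lambda>n. ennreal (pmf (Q n) w) * f w) = ennreal (pmf P w) * f w" for w
    by (intro lim_imp_Liminf) auto
  then have "(\<integral>\<^sup>+ w. f w \<partial>P) = (\<integral>\<^sup>+ w. liminf (\<lambda>n. ennreal (pmf (Q n) w) * f w) \<partial>count_space UNIV)"
    by (simp add: nn_integral_measure_pmf)
  also have "\<dots> \<le> liminf (\<lambda>n. \<integral>\<^sup>+ w. ennreal (pmf (Q n) w) * f w \<partial>count_space UNIV)"
    by (intro nn_integral_liminf) auto
  finally show ?thesis by (simp add: nn_integral_measure_pmf)
qed

text \<open>
  Fatou's lemma for \<open>f\<close> and for \<open>1 - f\<close>: the limit is again a probability mass function, so no mass is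
  lost in either estimate.
\<close>

lemma pmf_tendsto_expectation:
  fixes Q :: "nat \<Rightarrow> 'w pmf" and f :: "'w \<Rightarrow> real"
  assumes lim: "\<And>w. (\<lambda>n. pmf (Q n) w) \<longlonglongrightarrow> pmf P w" and f: "\<And>w. 0 \<le> f w" "\<And>w. f w \<le> 1"
  shows "(\<lambda>n. measure_pmf.expectation (Q n) f) \<longlonglongrightarrow> measure_pmf.expectation P f"
proof -
  have int: "integrable (measure_pmf p) g" if "\<And>w. 0 \<le> g w" "\<And>w. g w \<le> 1" for p :: "'w pmf" and g :: "'w \<Rightarrow> real"
    using that by (intro measure_pmf.integrable_const_bound[where B = 1]) auto
  have lower: "\<forall>\<^sub>F n in sequentially. y < measure_pmf.expectation (Q n) g"
    if g: "\<And>w. 0 \<le> g w" "\<And>w. g w \<le> 1" and y: "y < measure_pmf.expectation P g" for g :: "'w \<Rightarrow> real" and y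
  proof (cases "y < 0")
    case True
    have "0 \<le> measure_pmf.expectation (Q n) g" for n using g by simp
    with True have "y < measure_pmf.expectation (Q n) g" for n by (meson order.strict_trans2)
    then show ?thesis by simp
  next
    case False
    have e: "(\<integral>\<^sup>+ w. ennreal (g w) \<partial>measure_pmf p) = ennreal (measure_pmf.expectation p g)" for p
      using g by (intro nn_integral_eq_integral int) auto
    have "ennreal y < (\<integral>\<^sup>+ w. ennreal (g w) \<partial>P)"
      unfolding e using False y by (simp add: ennreal_less_iff)
    then have "\<forall>\<^sub>F n in sequentially. ennreal y < (\<integral>\<^sup>+ w. ennreal (g w) \<partial>Q n)"
      using pmf_fatou[of Q P "\<lambda>w. ennreal (g w)"] lim by (auto simp: le_Liminf_iff)
    then show ?thesis unfolding e using False by (simp add: ennreal_less_iff)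
  qed
  show ?thesis
  proof (rule order_tendstoI)
    fix y assume "measure_pmf.expectation P f < y"
    then have "1 - y < measure_pmf.expectation P (\<lambda>w. 1 - f w)"
      using f by (simp add: int measure_pmf.prob_space)
    from lower[OF _ _ this] have "\<forall>\<^sub>F n in sequentially. 1 - y < measure_pmf.expectation (Q n) (\<lambda>w. 1 - f w)"
      using f by simp
    then show "\<forall>\<^sub>F n in sequentially. measure_pmf.expectation (Q n) f < y"
      using f by (simp add: int measure_pmf.prob_space)
  qed (use lower f in auto)
qed

lemma pmf_tendsto_map:
  fixes Q :: "nat \<Rightarrow> 'w pmf"
  assumes lim: "\<And>w. (\<lambda>n. pmf (Q n) w) \<longlonglongrightarrow> pmf P w"
  shows "(\<lambda>n. pmf (map_pmf f (Q n)) v) \<longlonglongrightarrow> pmf (map_pmf f P) v"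
proof -
  have "pmf (map_pmf f p) v = measure_pmf.expectation p (indicator (f -` {v}))" for p
    by (simp add: pmf_map)
  then show ?thesis using pmf_tendsto_expectation[OF lim, of "indicator (f -` {v})"] by simp
qed

lemma pmf_limit_exists:
  fixes Q :: "nat \<Rightarrow> 'w pmf"
  assumes lim: "\<And>w. (\<lambda>n. pmf (Q n) w) \<longlonglongrightarrow> q w"
    and tight: "\<And>\<epsilon>. 0 < (\<epsilon>::real) \<Longrightarrow> \<exists>F. finite F \<and> (\<forall>n. emeasure (Q n) (- F) \<le> ennreal \<epsilon>)"
  shows "\<exists>P. \<forall>w. pmf P w = q w"
proof -
  have q: "0 \<le> q w" for w
    by (rule LIMSEQ_le_const[OF lim]) auto
  have "(\<integral>\<^sup>+ w. ennreal (q w) \<partial>count_space UNIV) = 1"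
  proof (rule antisym)
    have "liminf (\<lambda>n. ennreal (pmf (Q n) w)) = ennreal (q w)" for w
      by (intro lim_imp_Liminf tendsto_ennrealI lim) auto
    then have "(\<integral>\<^sup>+ w. ennreal (q w) \<partial>count_space UNIV) = (\<integral>\<^sup>+ w. liminf (\<lambda>n. ennreal (pmf (Q n) w)) \<partial>count_space UNIV)"
      by simp
    also have "\<dots> \<le> liminf (\<lambda>n. \<integral>\<^sup>+ w. ennreal (pmf (Q n) w) \<partial>count_space UNIV)"
      by (intro nn_integral_liminf) auto
    also have "\<dots> = 1" by (simp add: nn_integral_pmf Liminf_const)
    finally show "(\<integral>\<^sup>+ w. ennreal (q w) \<partial>count_space UNIV) \<le> 1" .
    show "1 \<le> (\<integral>\<^sup>+ w. ennreal (q w) \<partial>count_space UNIV)"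
    proof (rule ennreal_le_epsilon)
      fix \<epsilon> :: real assume "0 < \<epsilon>"
      then obtain F where F: "finite F" "\<And>n. emeasure (Q n) (- F) \<le> ennreal \<epsilon>" using tight by blast
      have "1 - \<epsilon> \<le> sum q F"
      proof (rule LIMSEQ_le_const)
        show "(\<lambda>n. \<Sum>w\<in>F. pmf (Q n) w) \<longlonglongrightarrow> sum q F" by (intro tendsto_sum lim)
        have "1 - \<epsilon> \<le> (\<Sum>w\<in>F. pmf (Q n) w)" for n
        proof -
          have "measure (Q n) (- F) \<le> \<epsilon>" using F(2)[of n] \<open>0 < \<epsilon>\<close> by (simp add: measure_pmf.emeasure_eq_measure)
          moreover have "measure (Q n) (- F) = 1 - measure (Q n) F"
            using measure_pmf.prob_compl[of F "Q n"] by (simp add: Compl_eq_Diff_UNIV)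
          ultimately show ?thesis using F(1) by (simp add: measure_measure_pmf_finite)
        qed
        then show "\<exists>N. \<forall>n\<ge>N. 1 - \<epsilon> \<le> (\<Sum>w\<in>F. pmf (Q n) w)" by blast
      qed
      then have "ennreal 1 \<le> ennreal (sum q F + \<epsilon>)" by (intro ennreal_leI) simp
      also have "\<dots> = (\<Sum>w\<in>F. ennreal (q w)) + ennreal \<epsilon>"
        using q \<open>0 < \<epsilon>\<close> by (simp add: sum_nonneg)
      also have "(\<Sum>w\<in>F. ennreal (q w)) = (\<integral>\<^sup>+ w. ennreal (q w) \<partial>count_space F)"
        using F(1) by (simp add: nn_integral_count_space_finite)
      also have "\<dots> \<le> (\<integral>\<^sup>+ w. ennreal (q w) \<partial>count_space UNIV)"
        by (simp add: nn_integral_count_space_indicator) (intro nn_integral_mono, auto simp: indicator_def)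
      finally show "1 \<le> (\<integral>\<^sup>+ w. ennreal (q w) \<partial>count_space UNIV) + ennreal \<epsilon>" by simp
    qed
  qed
  then have "pmf (embed_pmf q) w = q w" for w
    by (intro pmf_embed_pmf q)
  then show ?thesis by blast
qed

text \<open>
  The diagonal procedure, with the compactness of the unit interval at each index.
\<close>

lemma diagonal_convergent_subsequence:
  fixes f :: "nat \<Rightarrow> nat \<Rightarrow> real"
  assumes "\<And>n i. f n i \<in> {0..1}"
  obtains r where "strict_mono r" "\<And>i. convergent (\<lambda>n. f (r n) i)"
proof -
  interpret d: subseqs "\<lambda>i s. convergent (\<lambda>n. f (s n) i)"
  proof
    fix i and s :: "nat \<Rightarrow> nat" assume "strict_mono s"
    have "seq_compact {0..1::real}" by (intro compact_imp_seq_compact) simp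
    then obtain l s' where "strict_mono s'" "((\<lambda>n. f (s n) i) \<circ> s') \<longlonglongrightarrow> l"
      using seq_compactE[of "{0..1::real}" "\<lambda>n. f (s n) i"] assms by metis
    then show "\<exists>s'. strict_mono s' \<and> convergent (\<lambda>n. f ((s \<circ> s') n) i)"
      by (auto simp: convergent_def comp_def)
  qed
  show ?thesis
  proof (rule that[OF d.subseq_diagseq])
    fix i
    have "convergent (\<lambda>n. f ((d.diagseq \<circ> ((+) (Suc i))) n) i)"
    proof (rule d.diagseq_holds)
      fix i r s assume "strict_mono (r :: nat \<Rightarrow> nat)" "convergent (\<lambda>n. f (s n) i)"
      then show "convergent (\<lambda>n. f ((s \<circ> r) n) i)"
        using convergent_subseq_convergent[of "\<lambda>n. f (s n) i" r] unfolding comp_def by blast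
    qed
    then have "convergent (\<lambda>n. f (d.diagseq (n + Suc i)) i)"
      unfolding comp_def add.commute[of "Suc i"] .
    then show "convergent (\<lambda>n. f (d.diagseq n) i)"
      using convergent_ignore_initial_segment[of "\<lambda>n. f (d.diagseq n) i" "Suc i"] by blast
  qed
qed


lemma window_of_consistent_words:
  fixes P :: "nat \<Rightarrow> 'e list pmf"
  assumes len: "\<And>n w. w \<in> set_pmf (P n) \<Longrightarrow> length w = n"
    and butlast: "\<And>n. map_pmf butlast (P (Suc n)) = P n"
    and tl: "\<And>n. map_pmf tl (P (Suc n)) = P n"
  shows "map_pmf (\<lambda>w. take n (drop k w)) (P (k + (n + l))) = P n"
proof -
  have drop: "map_pmf (drop k) (P (k + n)) = P n" for k n
  proof (induction k)
    case (Suc k)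
    have "map_pmf (drop (Suc k)) (P (Suc k + n)) = map_pmf (drop k) (map_pmf tl (P (Suc (k + n))))"
      by (simp add: pmf.map_comp comp_def flip: drop_Suc)
    then show ?case by (simp add: tl Suc)
  qed (simp add: pmf.map_ident)
  have take: "map_pmf (take n) (P (n + l)) = P n" for n l
  proof (induction l)
    case 0
    have "map_pmf (take n) (P n) = map_pmf (\<lambda>w. w) (P n)"
      by (rule map_pmf_cong) (use len in auto)
    then show ?case by (simp add: pmf.map_ident)
  next
    case (Suc l)
    have "map_pmf (take n) (P (n + Suc l)) = map_pmf (\<lambda>w. take n (butlast w)) (P (Suc (n + l)))"
      by (rule map_pmf_cong) (use len in \<open>auto simp: take_butlast\<close>)
    also have "\<dots> = map_pmf (take n) (map_pmf butlast (P (Suc (n + l))))"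
      by (simp add: pmf.map_comp comp_def)
    finally show ?case by (simp add: butlast Suc)
  qed
  have "map_pmf (\<lambda>w. take n (drop k w)) (P (k + (n + l))) = map_pmf (take n) (map_pmf (drop k) (P (k + (n + l))))"
    by (simp add: pmf.map_comp comp_def)
  then show ?thesis by (simp add: drop take)
qed

text \<open>
  Kolmogorov's extension theorem for letters embedded in the real line.  The law of the coordinates in a
  finite set \<open>J\<close> is read off a window that contains \<open>J\<close>; consistency under dropping the first or the last
  letter makes the result independent of the window, which gives projectivity and stationarity at once.
\<close>

theorem stationary_process_of_consistent_words:
  fixes P :: "nat \<Rightarrow> 'e list pmf"
  assumes E: "countable E"
    and len: "\<And>n w. w \<in> set_pmf (P n) \<Longrightarrow> length w = n"
    and letters: "\<And>n w. w \<in> set_pmf (P n) \<Longrightarrow> set w \<subseteq> E"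
    and butlast: "\<And>n. map_pmf butlast (P (Suc n)) = P n"
    and tl: "\<And>n. map_pmf tl (P (Suc n)) = P n"
  shows "\<exists>\<Lambda>. sets \<Lambda> = sets (\<Pi>\<^sub>M i\<in>(UNIV :: int set). count_space E) \<and> prob_space \<Lambda> \<and>
    (\<forall>k w. emeasure \<Lambda> {\<sigma> \<in> space \<Lambda>. \<forall>i<length w. \<sigma> (k + int i) = w ! i} = ennreal (pmf (P (length w)) w))"
proof -
  define enc where "enc e = real (to_nat_on E e)" for e
  define dec where "dec r = from_nat_into E (nat \<lfloor>r\<rfloor>)" for r :: real
  have dec_enc: "dec (enc e) = e" if "e \<in> E" for e
    using that E by (simp add: dec_def enc_def)
  have "E \<noteq> {}"
  proof -
    obtain w where "w \<in> set_pmf (P 1)" using set_pmf_not_empty[of "P 1"] by blast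
    then show ?thesis using len[of w 1] letters[of w 1] by (cases w) auto
  qed
  then have dec_E: "dec r \<in> E" for r by (simp add: dec_def from_nat_into)
  have dec_meas [measurable]: "dec \<in> borel \<rightarrow>\<^sub>M count_space E"
  proof -
    have "(\<lambda>z :: int. from_nat_into E (nat z)) \<in> count_space UNIV \<rightarrow>\<^sub>M count_space E"
      using \<open>E \<noteq> {}\<close> by (simp add: from_nat_into)
    from measurable_compose[OF measurable_real_floor this] show ?thesis by (simp add: dec_def[abs_def])
  qed
  define W where "W k n J = distr (measure_pmf (P n)) (\<Pi>\<^sub>M j\<in>J. borel) (\<lambda>w. \<lambda>j\<in>J. enc (w ! nat (j - k)))" for k :: int and n J
  have W_meas: "(\<lambda>w. \<lambda>j\<in>J. enc (w ! nat (j - k))) \<in> measure_pmf p \<rightarrow>\<^sub>M (\<Pi>\<^sub>M j\<in>J. borel)" for J k and p :: "'e list pmf"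
    by (rule measurable_restrict) simp
  have W_enlarge: "W k' n' J = W k n J"
    if J: "J \<subseteq> {k..<k + int n}" and k: "k' \<le> k" "k + int n \<le> k' + int n'" for k k' n n' J
  proof -
    define d where "d = nat (k - k')"
    define l where "l = n' - (d + n)"
    have n': "n' = d + (n + l)" using k by (simp add: d_def l_def)
    have win: "map_pmf (\<lambda>w. take n (drop d w)) (P n') = P n"
      unfolding n' by (rule window_of_consistent_words) (use len butlast tl in auto)
    have "W k n J = distr (measure_pmf (map_pmf (\<lambda>w. take n (drop d w)) (P n'))) (\<Pi>\<^sub>M j\<in>J. borel) (\<lambda>w. \<lambda>j\<in>J. enc (w ! nat (j - k)))"
      unfolding W_def win ..
    also have "\<dots> = distr (measure_pmf (P n')) (\<Pi>\<^sub>M j\<in>J. borel) ((\<lambda>w. \<lambda>j\<in>J. enc (w ! nat (j - k))) \<circ> (\<lambda>w. take n (drop d w)))"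
      unfolding map_pmf_rep_eq by (rule distr_distr) (rule measurable_restrict, simp, simp)
    also have "\<dots> = W k' n' J"
      unfolding W_def
    proof (rule distr_cong_AE)
      show "AE w in measure_pmf (P n'). ((\<lambda>w. \<lambda>j\<in>J. enc (w ! nat (j - k))) \<circ> (\<lambda>w. take n (drop d w))) w = (\<lambda>j\<in>J. enc (w ! nat (j - k')))"
      proof (rule AE_pmfI)
        fix w assume "w \<in> set_pmf (P n')"
        then have lw: "length w = n'" by (rule len)
        show "((\<lambda>w. \<lambda>j\<in>J. enc (w ! nat (j - k))) \<circ> (\<lambda>w. take n (drop d w))) w = (\<lambda>j\<in>J. enc (w ! nat (j - k')))"
        proof (rule ext)
          fix j
          show "((\<lambda>w. \<lambda>j\<in>J. enc (w ! nat (j - k))) \<circ> (\<lambda>w. take n (drop d w))) w j = (\<lambda>j\<in>J. enc (w ! nat (j - k'))) j"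
          proof (cases "j \<in> J")
            case True
            then have "k \<le> j" "j < k + int n" using J by auto
            then have "nat (j - k) < n" "d + nat (j - k) = nat (j - k')" using k by (auto simp: d_def)
            then show ?thesis using True lw n' by simp
          qed simp
        qed
      qed
    qed (rule refl, rule refl, unfold comp_def, (rule measurable_restrict, simp)+)
    finally show ?thesis ..
  qed
  define m where "m J = nat (Max (insert 0 (abs ` J)))" for J :: "int set"
  have m: "\<bar>j\<bar> \<le> int (m J)" if "finite J" "j \<in> J" for j J
  proof -
    have "\<bar>j\<bar> \<le> Max (insert 0 (abs ` J))" using that by (intro Max_ge) auto
    also have "\<dots> \<le> int (m J)" unfolding m_def by linarith
    finally show ?thesis .
  qed
  define PJ where "PJ J = W (- int (m J)) (2 * m J + 1) J" for J
  have m_window: "J \<subseteq> {- int (m J)..<- int (m J) + int (2 * m J + 1)}" if "finite J" for J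
    using m[OF that] by fastforce
  have PJ_eq: "PJ J = W k n J" if J: "finite J" "J \<subseteq> {k..<k + int n}" for J k n
  proof -
    \<comment> \<open>a window that contains both the given one and the default one\<close>
    define k' where "k' = min k (- int (m J))"
    define n' where "n' = nat (max (k + int n) (int (m J) + 1) - k')"
    have "PJ J = W k' n' J"
      unfolding PJ_def using m_window[OF J(1)] by (intro W_enlarge[symmetric]) (auto simp: k'_def n'_def)
    also have "\<dots> = W k n J"
      using J(2) by (intro W_enlarge) (auto simp: k'_def n'_def)
    finally show ?thesis .
  qed
  have "projective_family UNIV PJ (\<lambda>_. borel)"
  proof (rule projective_family.intro)
    fix J H :: "int set" assume JH: "J \<subseteq> H" "finite H" "H \<subseteq> UNIV"
    let ?k = "- int (m H)" and ?n = "2 * m H + 1"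
    have "distr (PJ H) (\<Pi>\<^sub>M j\<in>J. borel) (\<lambda>f. restrict f J)
       = distr (measure_pmf (P ?n)) (\<Pi>\<^sub>M j\<in>J. borel) ((\<lambda>f. restrict f J) \<circ> (\<lambda>w. \<lambda>j\<in>H. enc (w ! nat (j - ?k))))"
      unfolding PJ_def W_def using JH by (intro distr_distr W_meas measurable_restrict_subset)
    also have "(\<lambda>f. restrict f J) \<circ> (\<lambda>w. \<lambda>j\<in>H. enc (w ! nat (j - ?k))) = (\<lambda>w. \<lambda>j\<in>J. enc (w ! nat (j - ?k)))"
      using JH by (auto simp: fun_eq_iff)
    also have "distr (measure_pmf (P ?n)) (\<Pi>\<^sub>M j\<in>J. borel) \<dots> = PJ J"
      using JH m_window[OF JH(2)] finite_subset[OF JH(1,2)] unfolding W_def[symmetric] by (intro PJ_eq[symmetric]) auto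
    finally show "PJ J = distr (PJ H) (\<Pi>\<^sub>M j\<in>J. borel) (\<lambda>f. restrict f J)" ..
  next
    show "prob_space (PJ J)" if "finite J" "J \<subseteq> UNIV" for J
      unfolding PJ_def W_def by (rule measure_pmf.prob_space_distr) (rule W_meas)
  qed
  then interpret polish_projective UNIV PJ by (rule polish_projective.intro)
  define D where "D \<omega> = (\<lambda>i. dec (\<omega> i))" for \<omega> :: "int \<Rightarrow> real"
  have D [measurable]: "D \<in> lim \<rightarrow>\<^sub>M (\<Pi>\<^sub>M i\<in>UNIV. count_space E)"
    unfolding measurable_cong_sets[OF sets_lim refl] D_def
    by (rule measurable_PiM_single', rule measurable_compose[OF _ dec_meas], rule measurable_component_singleton)
      (auto simp: dec_E)
  define \<Lambda> where "\<Lambda> = distr lim (\<Pi>\<^sub>M i\<in>UNIV. count_space E) D"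
  have "emeasure \<Lambda> {\<sigma> \<in> space \<Lambda>. \<forall>i<length w. \<sigma> (k + int i) = w ! i} = ennreal (pmf (P (length w)) w)" for k w
  proof -
    let ?n = "length w" and ?J = "{k..<k + int (length w)}"
    let ?A = "\<lambda>j. dec -` {w ! nat (j - k)}"
    have A: "?A j \<in> sets borel" for j
    proof -
      have "?A j = dec -` ({w ! nat (j - k)} \<inter> E) \<inter> space borel" using dec_E by auto
      also have "\<dots> \<in> sets borel" by (rule measurable_sets[OF dec_meas]) auto
      finally show ?thesis .
    qed
    have X: "PiE ?J ?A \<in> sets (\<Pi>\<^sub>M j\<in>?J. borel)" using A by (intro sets_PiM_I_finite) auto
    have S: "{\<sigma> \<in> space \<Lambda>. \<forall>i<length w. \<sigma> (k + int i) = w ! i} \<in> sets (\<Pi>\<^sub>M i\<in>UNIV. count_space E)"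
    proof -
      have [measurable]: "(\<lambda>\<sigma>. \<sigma> i = e) \<in> (\<Pi>\<^sub>M i\<in>(UNIV :: int set). count_space E) \<rightarrow>\<^sub>M count_space UNIV" for i e
        by (rule measurable_compose[OF measurable_component_singleton[OF UNIV_I]]) simp
      have "{\<sigma> \<in> space (\<Pi>\<^sub>M i\<in>(UNIV :: int set). count_space E). \<forall>i<length w. \<sigma> (k + int i) = w ! i} \<in> sets (\<Pi>\<^sub>M i\<in>UNIV. count_space E)"
        by measurable
      then show ?thesis by (simp add: \<Lambda>_def)
    qed
    have "emeasure \<Lambda> {\<sigma> \<in> space \<Lambda>. \<forall>i<length w. \<sigma> (k + int i) = w ! i}
      = emeasure lim (D -` {\<sigma> \<in> space \<Lambda>. \<forall>i<length w. \<sigma> (k + int i) = w ! i} \<inter> space lim)"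
      unfolding \<Lambda>_def by (rule emeasure_distr[OF D]) (use S in \<open>simp add: \<Lambda>_def\<close>)
    also have "D -` {\<sigma> \<in> space \<Lambda>. \<forall>i<length w. \<sigma> (k + int i) = w ! i} \<inter> space lim = emb UNIV ?J (PiE ?J ?A)"
    proof -
      have "(\<forall>i<length w. dec (\<omega> (k + int i)) = w ! i) \<longleftrightarrow> (\<forall>j\<in>?J. dec (\<omega> j) = w ! nat (j - k))" for \<omega>
      proof (intro iffI ballI allI impI)
        fix j assume *: "\<forall>i<length w. dec (\<omega> (k + int i)) = w ! i" and j: "j \<in> ?J"
        have "nat (j - k) < length w" "k + int (nat (j - k)) = j" using j by auto
        then show "dec (\<omega> j) = w ! nat (j - k)" using * by metis
      next
        fix i assume *: "\<forall>j\<in>?J. dec (\<omega> j) = w ! nat (j - k)" and i: "i < length w"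
        then have "k + int i \<in> ?J" by simp
        then have "dec (\<omega> (k + int i)) = w ! nat (k + int i - k)" using * by blast
        then show "dec (\<omega> (k + int i)) = w ! i" by simp
      qed
      then show ?thesis
        using dec_E by (auto simp: prod_emb_def D_def \<Lambda>_def space_PiM PiE_iff)
    qed
    also have "emeasure lim \<dots> = emeasure (PJ ?J) (PiE ?J ?A)"
      by (rule emeasure_lim_emb) (use X in auto)
    also have "\<dots> = emeasure (W k ?n ?J) (PiE ?J ?A)" by (subst PJ_eq[of ?J k ?n]) auto
    also have "\<dots> = emeasure (measure_pmf (P ?n)) ((\<lambda>w. \<lambda>j\<in>?J. enc (w ! nat (j - k))) -` PiE ?J ?A \<inter> space (measure_pmf (P ?n)))"
      unfolding W_def by (rule emeasure_distr[OF W_meas X])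
    also have "\<dots> = emeasure (measure_pmf (P ?n)) {w}"
    proof (rule emeasure_eq_AE)
      show "AE v in measure_pmf (P ?n). v \<in> (\<lambda>w. \<lambda>j\<in>?J. enc (w ! nat (j - k))) -` PiE ?J ?A \<inter> space (measure_pmf (P ?n)) \<longleftrightarrow> v \<in> {w}"
      proof (rule AE_pmfI)
        fix v assume v: "v \<in> set_pmf (P ?n)"
        have lv: "length v = ?n" and vE: "\<And>i. i < ?n \<Longrightarrow> v ! i \<in> E" using len[OF v] letters[OF v] by auto
        have "v \<in> (\<lambda>w. \<lambda>j\<in>?J. enc (w ! nat (j - k))) -` PiE ?J ?A \<longleftrightarrow> (\<forall>j\<in>?J. dec (enc (v ! nat (j - k))) = w ! nat (j - k))"
          by auto
        also have "\<dots> \<longleftrightarrow> (\<forall>i<?n. v ! i = w ! i)"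
        proof (intro iffI allI impI ballI)
          fix i assume *: "\<forall>j\<in>?J. dec (enc (v ! nat (j - k))) = w ! nat (j - k)" and i: "i < ?n"
          then have "k + int i \<in> ?J" by simp
          then have "dec (enc (v ! nat (k + int i - k))) = w ! nat (k + int i - k)" using * by blast
          then show "v ! i = w ! i" using vE[OF i] by (simp add: dec_enc)
        next
          fix j assume *: "\<forall>i<?n. v ! i = w ! i" and "j \<in> ?J"
          then have "nat (j - k) < ?n" by auto
          then show "dec (enc (v ! nat (j - k))) = w ! nat (j - k)" using * vE by (simp add: dec_enc)
        qed
        also have "\<dots> \<longleftrightarrow> v = w" using lv by (auto simp: list_eq_iff_nth_eq)
        finally show "v \<in> (\<lambda>w. \<lambda>j\<in>?J. enc (w ! nat (j - k))) -` PiE ?J ?A \<inter> space (measure_pmf (P ?n)) \<longleftrightarrow> v \<in> {w}" by simp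
      qed
    qed auto
    finally show ?thesis by (simp add: emeasure_pmf_single)
  qed
  moreover have "prob_space \<Lambda>" unfolding \<Lambda>_def by (rule P.prob_space_distr[OF D])
  moreover have "sets \<Lambda> = sets (\<Pi>\<^sub>M i\<in>UNIV. count_space E)" by (simp add: \<Lambda>_def)
  ultimately show ?thesis by blast
qed

section \<open>Words read along the chain\<close>

lemma summable_tail:
  fixes f :: "'a \<Rightarrow> ennreal"
  assumes A: "countable A" and fin: "(\<integral>\<^sup>+ e. f e \<partial>count_space A) < \<top>" and \<delta>: "0 < (\<delta>::ennreal)"
  shows "\<exists>F. finite F \<and> (\<integral>\<^sup>+ e. f e * indicator (- F) e \<partial>count_space A) < \<delta>"
proof -
  let ?N = "density (count_space A) f"
  let ?B = "\<lambda>n. A - from_nat_into A ` {..<n}"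
  have em: "emeasure ?N X = (\<integral>\<^sup>+ e. f e * indicator X e \<partial>count_space A)" if "X \<subseteq> A" for X
    using that by (intro emeasure_density) auto
  have "(\<lambda>n. emeasure ?N (?B n)) \<longlonglongrightarrow> emeasure ?N (\<Inter>n. ?B n)"
  proof (rule Lim_emeasure_decseq)
    show "emeasure ?N (?B n) \<noteq> \<infinity>" for n
    proof -
      have "emeasure ?N (?B n) \<le> emeasure ?N A" by (intro emeasure_mono) auto
      also have "\<dots> = (\<integral>\<^sup>+ e. f e \<partial>count_space A)"
        unfolding em[OF order_refl] by (intro nn_integral_cong) simp
      finally show ?thesis using fin by (auto simp: top_unique)
    qed
  qed (auto simp: decseq_def)
  moreover have "(\<Inter>n. ?B n) = {}"
  proof -
    have "e \<notin> (\<Inter>n. ?B n)" for e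
    proof (cases "e \<in> A")
      case True
      then obtain i where "from_nat_into A i = e" using from_nat_into_surj[OF A True] by blast
      then have "e \<notin> ?B (Suc i)" by auto
      then show ?thesis by blast
    qed auto
    then show ?thesis by blast
  qed
  ultimately have "(\<lambda>n. emeasure ?N (?B n)) \<longlonglongrightarrow> 0" by (simp only: emeasure_empty)
  then have "\<forall>\<^sub>F n in sequentially. emeasure ?N (?B n) < \<delta>" using \<delta> by (rule order_tendstoD)
  then obtain n where "emeasure ?N (?B n) < \<delta>" by (auto simp: eventually_sequentially)
  moreover have "emeasure ?N (?B n) = (\<integral>\<^sup>+ e. f e * indicator (- (from_nat_into A ` {..<n})) e \<partial>count_space A)"
    by (subst em) (auto intro!: nn_integral_cong simp: indicator_def)
  ultimately show ?thesis by (metis finite_imageI finite_lessThan)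
qed

context markov
begin

fun walk :: "'k \<Rightarrow> nat \<Rightarrow> 'e list pmf" where
  "walk y 0 = return_pmf []"
| "walk y (Suc n) = bind_pmf (step y) (\<lambda>e. map_pmf ((#) e) (walk (mp M e y) n))"

abbreviation endpoint :: "'e list \<Rightarrow> 'k \<Rightarrow> 'k" where
  "endpoint w y \<equiv> fold (mp M) w y"

fun admissible :: "nat \<Rightarrow> 'e list \<Rightarrow> bool" where
  "admissible j [] \<longleftrightarrow> True"
| "admissible j (e # w) \<longleftrightarrow> e \<in> edges M \<and> src M e = j \<and> admissible (tgt M e) w"

lemma set_walk: "w \<in> set_pmf (walk y n) \<Longrightarrow> length w = n \<and> admissible (cell_of y) w"
proof (induction n arbitrary: y w)
  case (Suc n)
  then obtain e v where e: "e \<in> set_pmf (step y)" "v \<in> set_pmf (walk (mp M e y) n)" "w = e # v" by auto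
  then have "e \<in> edges M" "src M e = cell_of y" using set_step by auto
  then show ?case using Suc.IH[OF e(2)] cell_of_mp[of e y] e(3) by simp
qed simp

lemma admissible_edges: "admissible j w \<Longrightarrow> set w \<subseteq> edges M"
  by (induction w arbitrary: j) auto

lemma walk_append: "walk y (m + n) = bind_pmf (walk y m) (\<lambda>v. map_pmf ((@) v) (walk (endpoint v y) n))"
proof (induction m arbitrary: y)
  case 0
  have "map_pmf ((@) []) p = p" for p :: "'e list pmf" by (simp add: map_pmf_def bind_return_pmf')
  then show ?case by (simp add: bind_return_pmf)
next
  case (Suc m)
  have eq: "(@) (e # v) = (\<lambda>u. e # v @ u)" for e :: 'e and v by auto
  show ?case
    by (simp add: eq Suc map_bind_pmf bind_assoc_pmf bind_map_pmf pmf.map_comp comp_def)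
qed

lemma map_take_walk: "map_pmf (take m) (walk y (m + n)) = walk y m"
proof -
  have "map_pmf (take m) (walk y (m + n)) = bind_pmf (walk y m) (\<lambda>v. map_pmf (\<lambda>u. take m (v @ u)) (walk (endpoint v y) n))"
    by (simp add: walk_append map_bind_pmf pmf.map_comp comp_def)
  also have "\<dots> = bind_pmf (walk y m) return_pmf"
    by (rule bind_pmf_cong) (auto dest: set_walk simp: map_pmf_const)
  finally show ?thesis by (simp add: bind_return_pmf')
qed

definition pos :: "'k \<Rightarrow> nat \<Rightarrow> 'k pmf" where
  "pos y k = map_pmf (\<lambda>v. endpoint v y) (walk y k)"

definition segment :: "'k \<Rightarrow> nat \<Rightarrow> nat \<Rightarrow> 'e list pmf" where
  "segment y k L = map_pmf (drop k) (walk y (k + L))"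

lemma segment_eq: "segment y k L = bind_pmf (pos y k) (\<lambda>z. walk z L)"
proof -
  have "segment y k L = bind_pmf (walk y k) (\<lambda>v. map_pmf (\<lambda>u. drop k (v @ u)) (walk (endpoint v y) L))"
    by (simp add: segment_def walk_append map_bind_pmf pmf.map_comp comp_def)
  also have "\<dots> = bind_pmf (walk y k) (\<lambda>v. walk (endpoint v y) L)"
    by (rule bind_pmf_cong) (auto dest: set_walk simp: pmf.map_ident)
  finally show ?thesis by (simp add: pos_def bind_map_pmf)
qed

lemma segment_tl: "map_pmf tl (segment y k (Suc L)) = segment y (Suc k) L"
proof -
  have eq: "tl \<circ> drop k = drop (Suc k)" by (auto simp: drop_Suc drop_tl)
  show ?thesis unfolding segment_def pmf.map_comp eq by simp
qed

lemma set_segment: "w \<in> set_pmf (segment y k L) \<Longrightarrow> length w = L \<and> (\<exists>j. admissible j w)"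
  unfolding segment_eq using set_walk by fastforce

lemma butlast_walk: "map_pmf butlast (walk y (Suc n)) = walk y n"
proof -
  have "map_pmf butlast (walk y (Suc n)) = map_pmf (take n) (walk y (n + 1))"
    by (rule map_pmf_cong) (auto dest!: set_walk simp: butlast_conv_take simp del: walk.simps)
  then show ?thesis by (simp only: map_take_walk)
qed

lemma segment_butlast: "map_pmf butlast (segment y k (Suc L)) = segment y k L"
  unfolding segment_eq map_bind_pmf butlast_walk ..

lemma hd_walk: "map_pmf hd (walk y (Suc n)) = step y"
  by (simp add: map_bind_pmf pmf.map_comp comp_def map_pmf_const bind_return_pmf')

lemma pos_Suc: "pos y (Suc k) = bind_pmf (pos y k) (\<lambda>z. map_pmf (\<lambda>e. mp M e z) (step z))"
proof -
  have "pos y (Suc k) = map_pmf (\<lambda>v. endpoint v y) (walk y (k + 1))" by (simp add: pos_def)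
  also have "\<dots> = bind_pmf (walk y k) (\<lambda>v. map_pmf (\<lambda>u. endpoint (v @ u) y) (walk (endpoint v y) 1))"
    by (simp only: walk_append map_bind_pmf pmf.map_comp comp_def)
  also have "\<dots> = bind_pmf (pos y k) (\<lambda>z. map_pmf (\<lambda>e. mp M e z) (step z))"
    by (simp add: pos_def bind_map_pmf map_bind_pmf map_pmf_def[symmetric] pmf.map_comp comp_def)
  finally show ?thesis .
qed

lemma nn_integral_pos: "(\<integral>\<^sup>+ z. f z \<partial>pos y k) = (Uop M ^^ k) f y"
proof (induction k arbitrary: f)
  case 0
  then show ?case by (simp add: pos_def)
next
  case (Suc k)
  have "(\<integral>\<^sup>+ z. f z \<partial>pos y (Suc k)) = (\<integral>\<^sup>+ z. Uop M f z \<partial>pos y k)"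
    by (simp add: pos_Suc Uop_step)
  then show ?case using Suc[of "Uop M f"] by (simp add: funpow_swap1)
qed

lemma emeasure_pos: "B \<in> sets borel \<Longrightarrow> emeasure (pos y k) B = emeasure (orbit y k) B"
  using nn_integral_pos[where f = "indicator B" and y = y and k = k] by (simp add: emeasure_orbit)

text \<open>
  The average over the times counted by \<open>alpha\<close> with index \<open>n + 1\<close>; the shift of the index keeps the set
  of times nonempty.
\<close>

definition words :: "'k \<Rightarrow> nat \<Rightarrow> nat \<Rightarrow> 'e list pmf" where
  "words y n L = bind_pmf (pmf_of_set {1..Suc n}) (\<lambda>k. segment y k L)"

definition occupation :: "'k \<Rightarrow> nat \<Rightarrow> 'k pmf" where
  "occupation y n = bind_pmf (pmf_of_set {1..Suc n}) (pos y)"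

lemma words_eq: "words y n L = bind_pmf (occupation y n) (\<lambda>z. walk z L)"
  by (simp add: words_def occupation_def segment_eq bind_assoc_pmf)

lemma set_words: "w \<in> set_pmf (words y n L) \<Longrightarrow> length w = L \<and> (\<exists>j. admissible j w)"
  unfolding words_def using set_segment by auto

lemma words_butlast: "map_pmf butlast (words y n (Suc L)) = words y n L"
  unfolding words_def map_bind_pmf segment_butlast ..

lemma words_tl: "map_pmf tl (words y n (Suc L)) = bind_pmf (pmf_of_set {1..Suc n}) (\<lambda>k. segment y (Suc k) L)"
  unfolding words_def map_bind_pmf segment_tl ..

text \<open>
  Dropping the first letter shifts the range of starting times by one, so the two averages share all
  terms except the first of one and the last of the other.
\<close>

lemma words_tl_close: "\<bar>pmf (map_pmf tl (words y n (Suc L))) w - pmf (words y n L) w\<bar> \<le> 1 / real (Suc n)"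
proof -
  let ?s = "\<lambda>k. pmf (segment y k L) w"
  have "pmf (map_pmf tl (words y n (Suc L))) w - pmf (words y n L) w = ((\<Sum>k=1..Suc n. ?s (Suc k)) - (\<Sum>k=1..Suc n. ?s k)) / real (Suc n)"
    unfolding words_tl unfolding words_def by (subst (1 2) pmf_bind_pmf_of_set) (auto simp: diff_divide_distrib)
  also have "(\<Sum>k=1..Suc n. ?s (Suc k)) - (\<Sum>k=1..Suc n. ?s k) = ?s (Suc (Suc n)) - ?s 1"
    by (simp only: sum_subtractf[symmetric]) (induction n, auto)
  finally have "\<bar>pmf (map_pmf tl (words y n (Suc L))) w - pmf (words y n L) w\<bar> = \<bar>?s (Suc (Suc n)) - ?s 1\<bar> / real (Suc n)"
    by simp
  also have "\<dots> \<le> 1 / real (Suc n)"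
    using pmf_le_1[of "segment y (Suc (Suc n)) L" w] pmf_le_1[of "segment y 1 L" w]
      pmf_nonneg[of "segment y (Suc (Suc n)) L" w] pmf_nonneg[of "segment y 1 L" w]
    by (intro divide_right_mono) (auto simp del: pmf_nonneg)
  finally show ?thesis .
qed

lemma emeasure_occupation:
  assumes "X \<subseteq> idx M"
  shows "emeasure (occupation y n) {z. cell_of z \<in> X} = emeasure (alpha M y (Suc n)) X"
proof -
  have m: "{z. cell_of z \<in> X} \<in> sets borel" by measurable
  have "emeasure (occupation y n) {z. cell_of z \<in> X} = (\<Sum>k=1..Suc n. emeasure (orbit y k) {z. cell_of z \<in> X}) / of_nat (Suc n)"
    by (simp add: occupation_def nn_integral_pmf_of_set emeasure_pos[OF m])
  also have "(\<Sum>k=1..Suc n. emeasure (orbit y k) {z. cell_of z \<in> X}) = ennreal (\<Sum>k=1..Suc n. measure (orbit y k) {z. cell_of z \<in> X})"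
    using prob_space_orbit by (simp add: finite_measure.emeasure_eq_measure prob_space.finite_measure del: sum.cl_ivl_Suc)
  also have "\<dots> / of_nat (Suc n) = ennreal (1 / real (Suc n) * (\<Sum>k=1..Suc n. measure (orbit y k) {z. cell_of z \<in> X}))"
    unfolding ennreal_of_nat_eq_real_of_nat
    by (subst divide_ennreal) (auto intro: sum_nonneg simp del: sum.cl_ivl_Suc)
  finally show ?thesis unfolding emeasure_alpha[OF assms] .
qed


text \<open>
  The dominating sums bound the tails of \<open>p\<^sub>e\<close> over the edges leaving a cell uniformly on the cell.
\<close>

lemma step_tail:
  assumes dom: "dominating_chain M" and V: "finite V" "V \<subseteq> idx M" and \<delta>: "0 < (\<delta>::ennreal)"
  shows "\<exists>E0. finite E0 \<and> (\<forall>z. cell_of z \<in> V \<longrightarrow> emeasure (step z) (- E0) \<le> \<delta>)"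
proof -
  let ?s = "\<lambda>j e. SUP y \<in> cell M j. ennreal (pr M e y)"
  have "\<exists>F. finite F \<and> (\<integral>\<^sup>+ e. ?s j e * indicator (- F) e \<partial>count_space (out_edges M j)) < \<delta>" if "j \<in> V" for j
  proof (rule summable_tail[OF _ _ \<delta>])
    show "countable (out_edges M j)"
      using countable_edges by (rule countable_subset[rotated]) (auto simp: out_edges_def)
    show "(\<integral>\<^sup>+ e. ?s j e \<partial>count_space (out_edges M j)) < \<top>"
      using dom that V by (auto simp: dominating_chain_def)
  qed
  then have "\<forall>j\<in>V. \<exists>F. finite F \<and> (\<integral>\<^sup>+ e. ?s j e * indicator (- F) e \<partial>count_space (out_edges M j)) < \<delta>"
    by blast
  from bchoice[OF this] obtain F where F: "\<And>j. j \<in> V \<Longrightarrow> finite (F j)"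
    "\<And>j. j \<in> V \<Longrightarrow> (\<integral>\<^sup>+ e. ?s j e * indicator (- F j) e \<partial>count_space (out_edges M j)) < \<delta>" by blast
  have "emeasure (step z) (- (\<Union>j\<in>V. F j)) \<le> \<delta>" if z: "cell_of z \<in> V" for z
  proof -
    let ?j = "cell_of z"
    have "emeasure (step z) (- (\<Union>j\<in>V. F j)) = (\<integral>\<^sup>+ e. indicator (- (\<Union>j\<in>V. F j)) e \<partial>step z)" by simp
    also have "\<dots> = (\<integral>\<^sup>+ e. ennreal (pr M e z) * indicator (- (\<Union>j\<in>V. F j)) e \<partial>count_space (out_edges M ?j))"
      by (rule nn_integral_step_out)
    also have "\<dots> \<le> (\<integral>\<^sup>+ e. ?s ?j e * indicator (- F ?j) e \<partial>count_space (out_edges M ?j))"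
      using z by (intro nn_integral_mono mult_mono SUP_upper) (auto simp: indicator_def)
    also have "\<dots> \<le> \<delta>" using F(2)[OF z] by (rule less_imp_le)
    finally show ?thesis .
  qed
  then show ?thesis using V F(1) by (intro exI[of _ "\<Union>j\<in>V. F j"]) auto
qed

text \<open>
  Induction on the length.  The first letter is controlled by the tight frequencies of the cells and
  \<open>step_tail\<close>.  The remaining letters form a word whose starting time is shifted by one, and the average
  over \<open>2, \<dots>, n + 2\<close> is at most twice the average over \<open>1, \<dots>, n + 2\<close>.
\<close>

lemma words_tight:
  assumes dom: "dominating_chain M" and tight: "alpha_tight M y" and \<epsilon>: "0 < (\<epsilon>::real)"
  shows "\<exists>F. finite F \<and> (\<forall>n. emeasure (words y n L) (- F) \<le> ennreal \<epsilon>)"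
  using \<epsilon>
proof (induction L arbitrary: \<epsilon>)
  case 0
  have "emeasure (words y n 0) (- {[]}) = 0" for n
  proof -
    have "(- {[]}) \<inter> set_pmf (words y n 0) = {}" using set_words[of _ y n 0] by auto
    then show ?thesis using emeasure_Int_set_pmf[of "words y n 0" "- {[]}"] by simp
  qed
  then show ?case by (intro exI[of _ "{[]}"]) simp
next
  case (Suc L)
  obtain F where F: "finite F" "\<And>n. emeasure (words y n L) (- F) \<le> ennreal (\<epsilon> / 4)"
    using Suc.IH[of "\<epsilon> / 4"] Suc.prems by auto
  obtain V where V: "V \<subseteq> idx M" "finite V" "\<And>n. n \<ge> 1 \<Longrightarrow> emeasure (alpha M y n) (idx M - V) < ennreal (\<epsilon> / 4)"
    using tight Suc.prems unfolding alpha_tight_def by (metis divide_pos_pos zero_less_numeral)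
  obtain E0 where E0: "finite E0" "\<And>z. cell_of z \<in> V \<Longrightarrow> emeasure (step z) (- E0) \<le> ennreal (\<epsilon> / 4)"
    using step_tail[OF dom V(2,1), of "ennreal (\<epsilon> / 4)"] Suc.prems by auto
  have hd: "emeasure (words y n (Suc L)) {w. hd w \<notin> E0} \<le> ennreal (\<epsilon> / 2)" for n
  proof -
    have "emeasure (words y n (Suc L)) {w. hd w \<notin> E0} = emeasure (map_pmf hd (words y n (Suc L))) (- E0)"
      by (simp add: vimage_def)
    also have "map_pmf hd (words y n (Suc L)) = bind_pmf (occupation y n) step"
      unfolding words_eq map_bind_pmf hd_walk ..
    also have "emeasure \<dots> (- E0) = (\<integral>\<^sup>+ z. emeasure (step z) (- E0) \<partial>occupation y n)" by simp
    also have "\<dots> \<le> (\<integral>\<^sup>+ z. indicator {z. cell_of z \<in> idx M - V} z + ennreal (\<epsilon> / 4) \<partial>occupation y n)"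
    proof (intro nn_integral_mono)
      fix z
      show "emeasure (step z) (- E0) \<le> indicator {z. cell_of z \<in> idx M - V} z + ennreal (\<epsilon> / 4)"
        using E0(2)[of z] measure_pmf.emeasure_le_1[of "step z" "- E0"]
        by (cases "cell_of z \<in> V") (auto intro: add_increasing2)
    qed
    also have "\<dots> = emeasure (occupation y n) {z. cell_of z \<in> idx M - V} + ennreal (\<epsilon> / 4)"
      by (simp add: nn_integral_add)
    also have "\<dots> \<le> ennreal (\<epsilon> / 4) + ennreal (\<epsilon> / 4)"
      using V(3)[of "Suc n"] unfolding emeasure_occupation[OF Diff_subset] by (intro add_mono) (auto intro: less_imp_le)
    also have "\<dots> = ennreal (\<epsilon> / 2)" using Suc.prems by (simp flip: ennreal_plus)
    finally show ?thesis .
  qed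
  have tl: "emeasure (words y n (Suc L)) {w. tl w \<notin> F} \<le> ennreal (\<epsilon> / 2)" for n
  proof -
    let ?s = "\<lambda>k. emeasure (segment y k L) (- F)"
    have "emeasure (words y n (Suc L)) {w. tl w \<notin> F} = emeasure (map_pmf tl (words y n (Suc L))) (- F)"
      by (simp add: vimage_def)
    also have "\<dots> = (\<Sum>k=1..Suc n. ?s (Suc k)) / of_nat (Suc n)"
      unfolding words_tl by (simp add: nn_integral_pmf_of_set ennreal_of_nat_eq_real_of_nat del: sum.cl_ivl_Suc)
    also have "(\<Sum>k=1..Suc n. ?s (Suc k)) = (\<Sum>k=Suc 1..Suc (Suc n). ?s k)"
      by (rule sum.shift_bounds_cl_Suc_ivl[symmetric])
    also have "\<dots> / of_nat (Suc n) \<le> (\<Sum>k=1..Suc (Suc n). ?s k) / of_nat (Suc n)"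
      by (intro divide_right_mono_ennreal sum_mono2) auto
    also have "(\<Sum>k=1..Suc (Suc n). ?s k) = of_nat (Suc (Suc n)) * emeasure (words y (Suc n) L) (- F)"
    proof -
      have "emeasure (words y (Suc n) L) (- F) = (\<Sum>k=1..Suc (Suc n). ?s k) / of_nat (Suc (Suc n))"
        unfolding words_def by (simp add: nn_integral_pmf_of_set ennreal_of_nat_eq_real_of_nat del: sum.cl_ivl_Suc)
      then show ?thesis
        by (simp add: ennreal_times_divide mult.commute[of "of_nat _"] ennreal_mult_divide_eq del: sum.cl_ivl_Suc of_nat_Suc)
    qed
    also have "\<dots> / of_nat (Suc n) \<le> 2 * ennreal (\<epsilon> / 4)"
    proof -
      have "of_nat (Suc (Suc n)) * emeasure (words y (Suc n) L) (- F) / of_nat (Suc n) \<le> (of_nat (Suc n) * 2) * ennreal (\<epsilon> / 4) / of_nat (Suc n)"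
      proof (intro divide_right_mono_ennreal mult_mono F(2))
        have "of_nat (Suc (Suc n)) \<le> (of_nat (Suc n * 2) :: ennreal)" by (rule of_nat_mono) simp
        then show "of_nat (Suc (Suc n)) \<le> (of_nat (Suc n) * 2 :: ennreal)"
          by (simp only: of_nat_mult of_nat_numeral)
      qed auto
      also have "\<dots> = (2 * ennreal (\<epsilon> / 4)) * of_nat (Suc n) / of_nat (Suc n)" by (simp only: mult_ac)
      also have "\<dots> = 2 * ennreal (\<epsilon> / 4)"
        by (rule ennreal_mult_divide_eq) (auto simp: of_nat_less_top simp del: of_nat_Suc)
      finally show ?thesis .
    qed
    also have "\<dots> = ennreal (\<epsilon> / 2)" using Suc.prems by (simp add: ennreal_mult'[symmetric] flip: ennreal_numeral)
    finally show ?thesis .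
  qed
  define F' where "F' = (\<lambda>(e, w). e # w) ` (E0 \<times> F)"
  have "emeasure (words y n (Suc L)) (- F') \<le> ennreal \<epsilon>" for n
  proof -
    have "emeasure (words y n (Suc L)) (- F') = emeasure (words y n (Suc L)) (- F' \<inter> set_pmf (words y n (Suc L)))"
      by (rule emeasure_Int_set_pmf[symmetric])
    also have "\<dots> \<le> emeasure (words y n (Suc L)) ({w. hd w \<notin> E0} \<union> {w. tl w \<notin> F})"
    proof (intro emeasure_mono subsetI)
      fix w assume w: "w \<in> - F' \<inter> set_pmf (words y n (Suc L))"
      then obtain e v where "w = e # v" using set_words[of w y n "Suc L"] by (auto simp: length_Suc_conv)
      then show "w \<in> {w. hd w \<notin> E0} \<union> {w. tl w \<notin> F}" using w by (auto simp: F'_def)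
    qed simp
    also have "\<dots> \<le> emeasure (words y n (Suc L)) {w. hd w \<notin> E0} + emeasure (words y n (Suc L)) {w. tl w \<notin> F}"
      by (intro emeasure_subadditive) auto
    also have "\<dots> \<le> ennreal (\<epsilon> / 2) + ennreal (\<epsilon> / 2)" by (intro add_mono hd tl)
    also have "\<dots> = ennreal \<epsilon>" using Suc.prems by (simp flip: ennreal_plus)
    finally show ?thesis .
  qed
  moreover have "finite F'" using F E0 by (simp add: F'_def)
  ultimately show ?case by blast
qed

theorem limit_words:
  assumes dom: "dominating_chain M" and tight: "alpha_tight M y"
  obtains r P where "strict_mono r" "\<And>L w. (\<lambda>n. pmf (words y (r n) L) w) \<longlonglongrightarrow> pmf (P L) w"
proof -
  let ?u = "from_nat_into (lists (edges M))"
  have L: "countable (lists (edges M))" using countable_edges by simp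
  have "pmf (words y n (length (?u i))) (?u i) \<in> {0..1}" for n i
    by (simp add: pmf_le_1)
  then obtain r where r: "strict_mono r" and conv: "\<And>i. convergent (\<lambda>n. pmf (words y (r n) (length (?u i))) (?u i))"
    using diagonal_convergent_subsequence[of "\<lambda>n i. pmf (words y n (length (?u i))) (?u i)"] by auto
  have "convergent (\<lambda>n. pmf (words y (r n) L) w)" for L w
  proof (cases "w \<in> lists (edges M) \<and> length w = L")
    case True
    then obtain i where "?u i = w" using from_nat_into_surj[OF L, of w] by blast
    then show ?thesis using conv[of i] True by simp
  next
    case False
    have "w \<notin> set_pmf (words y n L)" for n
      using False set_words[of w y n L] admissible_edges by auto
    then have "pmf (words y (r n) L) w = 0" for n by (simp add: set_pmf_iff)
    then show ?thesis by (simp add: convergent_const)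
  qed
  then obtain q where q: "\<And>L w. (\<lambda>n. pmf (words y (r n) L) w) \<longlonglongrightarrow> q L w"
    unfolding convergent_def by metis
  have "\<exists>P. \<forall>w. pmf P w = q L w" for L
  proof (rule pmf_limit_exists[OF q])
    fix \<epsilon> :: real assume "0 < \<epsilon>"
    from words_tight[OF dom tight this, of L] obtain F where
      "finite F" "\<And>n. emeasure (words y n L) (- F) \<le> ennreal \<epsilon>" by blast
    then show "\<exists>F. finite F \<and> (\<forall>n. emeasure (words y (r n) L) (- F) \<le> ennreal \<epsilon>)"
      by (intro exI[of _ F]) simp
  qed
  then have "\<exists>P. \<forall>L w. pmf (P L) w = q L w" by (intro choice) blast
  then obtain P where "\<And>L w. pmf (P L) w = q L w" by blast
  then show ?thesis using that[OF r, of P] q by simp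
qed

lemma limit_words_support:
  assumes lim: "\<And>L w. (\<lambda>n. pmf (words y (r n) L) w) \<longlonglongrightarrow> pmf (P L) w" and w: "w \<in> set_pmf (P L)"
  shows "length w = L \<and> (\<exists>j. admissible j w)"
proof -
  have "\<exists>n. w \<in> set_pmf (words y (r n) L)"
  proof (rule ccontr)
    assume "\<nexists>n. w \<in> set_pmf (words y (r n) L)"
    then have "(\<lambda>n. pmf (words y (r n) L) w) = (\<lambda>n. 0)" by (auto simp: set_pmf_iff)
    then have "(\<lambda>n. 0) \<longlonglongrightarrow> pmf (P L) w" using lim[of L w] by simp
    then have "pmf (P L) w = 0" using LIMSEQ_unique tendsto_const by blast
    then show False using w by (simp add: set_pmf_iff)
  qed
  then show ?thesis using set_words by blast
qed

lemma limit_words_consistent: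
  assumes r: "strict_mono r" and lim: "\<And>L w. (\<lambda>n. pmf (words y (r n) L) w) \<longlonglongrightarrow> pmf (P L) w"
  shows "map_pmf butlast (P (Suc L)) = P L" "map_pmf tl (P (Suc L)) = P L"
proof -
  show "map_pmf butlast (P (Suc L)) = P L"
  proof (rule pmf_eqI)
    fix w
    have "(\<lambda>n. pmf (words y (r n) L) w) \<longlonglongrightarrow> pmf (map_pmf butlast (P (Suc L))) w"
      using pmf_tendsto_map[OF lim[of "Suc L"], of butlast w] by (simp add: words_butlast)
    then show "pmf (map_pmf butlast (P (Suc L))) w = pmf (P L) w"
      using lim[of L w] LIMSEQ_unique by blast
  qed
  show "map_pmf tl (P (Suc L)) = P L"
  proof (rule pmf_eqI)
    fix w
    have "(\<lambda>n. 1 / real (Suc (r n))) \<longlonglongrightarrow> 0"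
      using LIMSEQ_subseq_LIMSEQ[OF LIMSEQ_Suc[OF lim_1_over_n] r] by (simp add: comp_def)
    then have "(\<lambda>n. pmf (map_pmf tl (words y (r n) (Suc L))) w - pmf (words y (r n) L) w) \<longlonglongrightarrow> 0"
      by (rule Lim_null_comparison[rotated]) (use words_tl_close in auto)
    from tendsto_add[OF this lim[of L w]]
    have "(\<lambda>n. pmf (map_pmf tl (words y (r n) (Suc L))) w) \<longlonglongrightarrow> pmf (P L) w" by simp
    then show "pmf (map_pmf tl (P (Suc L))) w = pmf (P L) w"
      using pmf_tendsto_map[OF lim[of "Suc L"], of tl w] LIMSEQ_unique by blast
  qed
qed

lemma cell_of_endpoint:
  "admissible (cell_of z) w \<Longrightarrow> w \<noteq> [] \<Longrightarrow> cell_of (endpoint w z) = tgt M (last w)"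
proof (induction w arbitrary: z)
  case (Cons e w)
  then have "cell_of (mp M e z) = tgt M e" using cell_of_mp[of e z] by simp
  then show ?case using Cons.IH[of "mp M e z"] Cons.prems by (cases w) auto
qed simp

lemma admissible_hd: "admissible j w \<Longrightarrow> w \<noteq> [] \<Longrightarrow> src M (hd w) = j \<and> hd w \<in> edges M"
  by (cases w) auto

lemma words_snoc:
  "words y n (Suc L) = bind_pmf (occupation y n) (\<lambda>z. bind_pmf (walk z L) (\<lambda>v. map_pmf (\<lambda>e. v @ [e]) (step (endpoint v z))))"
proof -
  have "walk z (Suc L) = bind_pmf (walk z L) (\<lambda>v. map_pmf (\<lambda>e. v @ [e]) (step (endpoint v z)))" for z
  proof -
    have "walk z (Suc L) = bind_pmf (walk z L) (\<lambda>v. map_pmf ((@) v) (walk (endpoint v z) 1))"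
      using walk_append[of z L 1] by simp
    then show ?thesis by (simp add: map_pmf_def[symmetric] pmf.map_comp comp_def)
  qed
  then show ?thesis by (simp add: words_eq)
qed

end

section \<open>Contraction along words\<close>

context contractive_markov
begin

text \<open>
  The bound is preserved by one step because \<open>c = b / (1 - a)\<close> solves \<open>a c + b = c\<close>.
\<close>

lemma nn_integral_pos_base_dist: "(\<integral>\<^sup>+ z. ennreal (base_dist z) \<partial>pos y k) \<le> ennreal (base_dist y + b / (1 - a))"
proof (induction k)
  case 0
  show ?case using a_less_1 b_nonneg by (simp add: pos_def ennreal_leI)
next
  case (Suc k)
  let ?H = "base_dist y + b / (1 - a)"
  have "(\<integral>\<^sup>+ z. ennreal (base_dist z) \<partial>pos y (Suc k)) = (\<integral>\<^sup>+ z. Uop M (\<lambda>z. ennreal (base_dist z)) z \<partial>pos y k)"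
    by (simp add: pos_Suc Uop_step)
  also have "\<dots> \<le> (\<integral>\<^sup>+ z. ennreal a * ennreal (base_dist z) + ennreal b \<partial>pos y k)"
    using base_dist_drift a_pos b_nonneg by (intro nn_integral_mono) (simp add: ennreal_mult'[symmetric] flip: ennreal_plus)
  also have "\<dots> = ennreal a * (\<integral>\<^sup>+ z. ennreal (base_dist z) \<partial>pos y k) + ennreal b"
    by (simp add: nn_integral_add nn_integral_cmult)
  also have "\<dots> \<le> ennreal a * ennreal ?H + ennreal b" by (intro add_mono mult_left_mono Suc) auto
  also have "\<dots> = ennreal (a * ?H + b)"
    using a_pos a_less_1 b_nonneg by (simp add: ennreal_mult'[symmetric] flip: ennreal_plus)
  also have "\<dots> \<le> ennreal ?H"
  proof (intro ennreal_leI)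
    have "a * base_dist y \<le> base_dist y" using a_less_1 by (simp add: mult_left_le_one_le a_pos less_imp_le)
    moreover have "a * (b / (1 - a)) + b = b / (1 - a)" using a_less_1 by (simp add: field_simps)
    ultimately show "a * ?H + b \<le> ?H" by (simp add: distrib_left)
  qed
  finally show ?case .
qed

lemma nn_integral_walk_contraction:
  "cell_of y = cell_of z \<Longrightarrow>
    (\<integral>\<^sup>+ w. ennreal (dist (endpoint w y) (endpoint w z)) \<partial>walk y n) \<le> ennreal (a ^ n * dist y z)"
proof (induction n arbitrary: y z)
  case (Suc n)
  have "(\<integral>\<^sup>+ w. ennreal (dist (endpoint w y) (endpoint w z)) \<partial>walk y (Suc n))
      = (\<integral>\<^sup>+ e. (\<integral>\<^sup>+ w. ennreal (dist (endpoint w (mp M e y)) (endpoint w (mp M e z))) \<partial>walk (mp M e y) n) \<partial>step y)"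
    by simp
  also have "\<dots> \<le> (\<integral>\<^sup>+ e. ennreal (a ^ n) * ennreal (dist (mp M e y) (mp M e z)) \<partial>step y)"
  proof (intro nn_integral_mono_AE AE_pmfI)
    fix e assume "e \<in> set_pmf (step y)"
    then have e: "e \<in> edges M" "src M e = cell_of y" using set_step by auto
    have "cell_of (mp M e y) = cell_of (mp M e z)"
      using cell_of_mp[of e y] cell_of_mp[of e z] e Suc.prems by simp
    from Suc.IH[OF this] show "(\<integral>\<^sup>+ w. ennreal (dist (endpoint w (mp M e y)) (endpoint w (mp M e z))) \<partial>walk (mp M e y) n)
       \<le> ennreal (a ^ n) * ennreal (dist (mp M e y) (mp M e z))"
      using a_pos by (simp add: ennreal_mult)
  qed
  also have "\<dots> = ennreal (a ^ n) * (\<integral>\<^sup>+ e. ennreal (dist (mp M e y) (mp M e z)) \<partial>step y)"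
    by (rule nn_integral_cmult) simp
  also have "\<dots> \<le> ennreal (a ^ n) * ennreal (a * dist y z)"
    by (intro mult_left_mono contraction_step Suc.prems) simp
  also have "\<dots> = ennreal (a ^ Suc n * dist y z)"
    using a_pos by (simp add: ennreal_mult[symmetric] mult_ac)
  finally show ?case .
qed simp

text \<open>
  The point coded by a finite word; for the word of the last letters of a code, this is the approximant
  of \<open>Fmap\<close> (see \<open>past_point_window\<close> below).
\<close>

definition base_point :: "'e list \<Rightarrow> 'k" where
  "base_point w = endpoint w (x (src M (hd w)))"

lemma cell_of_base_point: "admissible j w \<Longrightarrow> w \<noteq> [] \<Longrightarrow> cell_of (base_point w) = tgt M (last w)"
  unfolding base_point_def using admissible_hd[of j w] by (intro cell_of_endpoint) auto

abbreviation drift_bound :: "'k \<Rightarrow> real" where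
  "drift_bound y \<equiv> base_dist y + b / (1 - a)"

lemma drift_bound_nonneg: "0 \<le> drift_bound y"
  using a_less_1 b_nonneg by simp

text \<open>
  The path that starts at the position \<open>z\<close> of the chain and the one that starts at the base point of the
  same cell follow the same edges, so contraction applies, and the mean of \<open>h\<close> bounds the initial distance.
\<close>

lemma endpoint_base_point_pos:
  "(\<integral>\<^sup>+ z. (\<integral>\<^sup>+ w. ennreal (dist (endpoint w z) (base_point w)) \<partial>walk z (Suc n)) \<partial>pos y k)
    \<le> ennreal (a ^ Suc n * drift_bound y)"
proof -
  have "(\<integral>\<^sup>+ z. (\<integral>\<^sup>+ w. ennreal (dist (endpoint w z) (base_point w)) \<partial>walk z (Suc n)) \<partial>pos y k)
     \<le> (\<integral>\<^sup>+ z. ennreal (a ^ Suc n) * ennreal (base_dist z) \<partial>pos y k)"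
  proof (rule nn_integral_mono)
    fix z
    have "(\<integral>\<^sup>+ w. ennreal (dist (endpoint w z) (base_point w)) \<partial>walk z (Suc n))
       = (\<integral>\<^sup>+ w. ennreal (dist (endpoint w z) (endpoint w (x (cell_of z)))) \<partial>walk z (Suc n))"
    proof (rule nn_integral_cong_AE, rule AE_pmfI)
      fix w assume "w \<in> set_pmf (walk z (Suc n))"
      then have "admissible (cell_of z) w" "w \<noteq> []" using set_walk[of w z "Suc n"] by auto
      then show "ennreal (dist (endpoint w z) (base_point w)) = ennreal (dist (endpoint w z) (endpoint w (x (cell_of z))))"
        using admissible_hd by (simp add: base_point_def)
    qed
    also have "\<dots> \<le> ennreal (a ^ Suc n * dist z (x (cell_of z)))"
      by (rule nn_integral_walk_contraction) simp
    also have "\<dots> = ennreal (a ^ Suc n) * ennreal (base_dist z)"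
      using a_pos by (simp add: base_dist_def ennreal_mult del: power_Suc)
    finally show "(\<integral>\<^sup>+ w. ennreal (dist (endpoint w z) (base_point w)) \<partial>walk z (Suc n)) \<le> ennreal (a ^ Suc n) * ennreal (base_dist z)" .
  qed
  also have "\<dots> = ennreal (a ^ Suc n) * (\<integral>\<^sup>+ z. ennreal (base_dist z) \<partial>pos y k)"
    by (rule nn_integral_cmult) simp
  also have "\<dots> \<le> ennreal (a ^ Suc n) * ennreal (drift_bound y)"
    by (intro mult_left_mono nn_integral_pos_base_dist) simp
  also have "\<dots> = ennreal (a ^ Suc n * drift_bound y)"
    using a_pos drift_bound_nonneg by (simp add: ennreal_mult del: power_Suc)
  finally show ?thesis .
qed

lemma nn_integral_average_le:
  "(\<And>k. (\<integral>\<^sup>+ z. f z \<partial>measure_pmf (p k)) \<le> c) \<Longrightarrow> (\<integral>\<^sup>+ z. f z \<partial>bind_pmf q p) \<le> (c :: ennreal)"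
proof -
  assume "\<And>k. (\<integral>\<^sup>+ z. f z \<partial>measure_pmf (p k)) \<le> c"
  then have "(\<integral>\<^sup>+ z. f z \<partial>bind_pmf q p) \<le> (\<integral>\<^sup>+ k. c \<partial>q)"
    unfolding nn_integral_bind_pmf by (rule nn_integral_mono)
  then show ?thesis by simp
qed

lemma endpoint_base_point_occupation:
  "(\<integral>\<^sup>+ z. (\<integral>\<^sup>+ w. ennreal (dist (endpoint w z) (base_point w)) \<partial>walk z (Suc n)) \<partial>occupation y N)
    \<le> ennreal (a ^ Suc n * drift_bound y)"
  unfolding occupation_def by (rule nn_integral_average_le[OF endpoint_base_point_pos])

text \<open>
  Both coded points are close to the true position of the chain after the whole word.
\<close>

lemma base_point_tl_words:
  "(\<integral>\<^sup>+ w. ennreal (dist (base_point w) (base_point (tl w))) \<partial>words y N (Suc (Suc n)))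
    \<le> ennreal (2 * a ^ Suc n * drift_bound y)"
  unfolding words_def
proof (rule nn_integral_average_le)
  fix k
  let ?d1 = "\<lambda>z w. ennreal (dist (endpoint w z) (base_point w))"
  have "(\<integral>\<^sup>+ w. ennreal (dist (base_point w) (base_point (tl w))) \<partial>segment y k (Suc (Suc n)))
     = (\<integral>\<^sup>+ z. (\<integral>\<^sup>+ w. ennreal (dist (base_point w) (base_point (tl w))) \<partial>walk z (Suc (Suc n))) \<partial>pos y k)"
    by (simp only: segment_eq nn_integral_bind_pmf)
  also have "\<dots> \<le> (\<integral>\<^sup>+ z. (\<integral>\<^sup>+ w. ?d1 z w + ?d1 (mp M (hd w) z) (tl w) \<partial>walk z (Suc (Suc n))) \<partial>pos y k)"
  proof (intro nn_integral_mono_AE[OF AE_pmfI] AE_pmfI)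
    fix z w assume "w \<in> set_pmf (walk z (Suc (Suc n)))"
    then obtain e v where w: "w = e # v" using set_walk[of w z "Suc (Suc n)"] by (auto simp: length_Suc_conv)
    have "dist (base_point w) (base_point v) \<le> dist (endpoint w z) (base_point w) + dist (endpoint v (mp M e z)) (base_point v)"
      using dist_triangle3[of "base_point w" "base_point v" "endpoint w z"] by (simp add: w)
    then show "ennreal (dist (base_point w) (base_point (tl w))) \<le> ?d1 z w + ?d1 (mp M (hd w) z) (tl w)"
      by (simp add: w ennreal_leI flip: ennreal_plus)
  qed
  also have "\<dots> = (\<integral>\<^sup>+ z. (\<integral>\<^sup>+ w. ?d1 z w \<partial>walk z (Suc (Suc n))) \<partial>pos y k) +
      (\<integral>\<^sup>+ z. (\<integral>\<^sup>+ w. ?d1 (mp M (hd w) z) (tl w) \<partial>walk z (Suc (Suc n))) \<partial>pos y k)"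
    by (simp add: nn_integral_add del: walk.simps)
  also have "(\<integral>\<^sup>+ z. (\<integral>\<^sup>+ w. ?d1 (mp M (hd w) z) (tl w) \<partial>walk z (Suc (Suc n))) \<partial>pos y k)
      = (\<integral>\<^sup>+ z. (\<integral>\<^sup>+ w. ?d1 z w \<partial>walk z (Suc n)) \<partial>pos y (Suc k))"
    by (simp add: pos_Suc del: walk.simps add: walk.simps(2)[of _ "Suc n"])
  also have "(\<integral>\<^sup>+ z. (\<integral>\<^sup>+ w. ?d1 z w \<partial>walk z (Suc (Suc n))) \<partial>pos y k)
      + (\<integral>\<^sup>+ z. (\<integral>\<^sup>+ w. ?d1 z w \<partial>walk z (Suc n)) \<partial>pos y (Suc k))
      \<le> ennreal (a ^ Suc n * drift_bound y) + ennreal (a ^ Suc n * drift_bound y)"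
  proof (intro add_mono endpoint_base_point_pos order.trans[OF endpoint_base_point_pos ennreal_leI])
    have "a ^ Suc (Suc n) \<le> a ^ Suc n" using a_pos a_less_1 by (intro power_decreasing) auto
    then show "a ^ Suc (Suc n) * drift_bound y \<le> a ^ Suc n * drift_bound y"
      by (intro mult_right_mono drift_bound_nonneg)
  qed
  also have "\<dots> = ennreal (2 * a ^ Suc n * drift_bound y)"
    using a_pos drift_bound_nonneg[of y] by (simp del: power_Suc flip: ennreal_plus)
  finally show "(\<integral>\<^sup>+ w. ennreal (dist (base_point w) (base_point (tl w))) \<partial>segment y k (Suc (Suc n)))
      \<le> ennreal (2 * a ^ Suc n * drift_bound y)" .
qed

end

section \<open>The law of the next letter\<close>

lemma ennreal_le_plusD:
  assumes "ennreal p \<le> ennreal q + ennreal s" "0 \<le> q" "0 \<le> s"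
  shows "p \<le> q + s"
proof -
  have "ennreal p \<le> ennreal (q + s)" using assms by simp
  then show ?thesis using ennreal_le_iff[of "q + s" p] assms by simp
qed

text \<open>
  Any subsequential limit of the averaged word laws.  Existence is \<open>limit_words\<close>; the law of the next
  letter, in terms of the point coded by the past, is the same for every choice.
\<close>

locale limit_chain = contractive_markov M x a b
  for M :: "('k :: complete_space, 'e) markov_sys" and x :: "nat \<Rightarrow> 'k" and a b :: real +
  fixes y :: 'k and r :: "nat \<Rightarrow> nat" and P :: "nat \<Rightarrow> 'e list pmf"
  assumes r: "strict_mono r"
    and words_tendsto: "(\<lambda>n. pmf (words y (r n) L) w) \<longlonglongrightarrow> pmf (P L) w"
begin

lemma P_support: "w \<in> set_pmf (P L) \<Longrightarrow> length w = L \<and> (\<exists>j. admissible j w)"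
  by (rule limit_words_support[OF words_tendsto])

lemma P_butlast: "map_pmf butlast (P (Suc L)) = P L" and P_tl: "map_pmf tl (P (Suc L)) = P L"
  by (rule limit_words_consistent[OF r words_tendsto])+

lemma P_drop: "map_pmf (drop k) (P (k + L)) = P L"
proof -
  have "map_pmf (drop k) (P (k + L)) = map_pmf (\<lambda>w. take L (drop k w)) (P (k + (L + 0)))"
    by (rule map_pmf_cong) (auto dest: P_support)
  also have "\<dots> = P L"
    by (rule window_of_consistent_words) (use P_support P_butlast P_tl in auto)
  finally show ?thesis .
qed

lemma P_base_point_tl:
  "(\<integral>\<^sup>+ w. ennreal (dist (base_point w) (base_point (tl w))) \<partial>P (Suc (Suc n)))
    \<le> ennreal (2 * a ^ Suc n * drift_bound y)"
proof -
  let ?f = "\<lambda>w. ennreal (dist (base_point w) (base_point (tl w)))"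
  have "(\<integral>\<^sup>+ w. ?f w \<partial>P (Suc (Suc n))) \<le> liminf (\<lambda>N. \<integral>\<^sup>+ w. ?f w \<partial>words y (r N) (Suc (Suc n)))"
    by (rule pmf_fatou[OF words_tendsto]) simp
  also have "\<dots> \<le> liminf (\<lambda>N. ennreal (2 * a ^ Suc n * drift_bound y))"
    by (intro Liminf_mono always_eventually allI base_point_tl_words)
  also have "\<dots> = ennreal (2 * a ^ Suc n * drift_bound y)" by (simp add: Liminf_const)
  finally show ?thesis .
qed

text \<open>
  The probability that \<open>w\<close> is followed by \<open>e\<close> is the mean of \<open>p\<^sub>e\<close> at the true position over the paths that
  end with \<open>w\<close>.  Replacing the position by the point coded by \<open>k\<close> further letters of the past and \<open>w\<close>
  costs at most \<open>\<eta>\<close> if the two points are closer than \<open>\<delta>\<close>, and otherwise at most \<open>1\<close>, which is then bounded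
  by their distance divided by \<open>\<delta>\<close>.
\<close>

lemma next_letter_close:
  assumes e: "e \<in> edges M" and w: "w \<noteq> []" "tgt M (last w) = src M e"
    and \<delta>: "0 < \<delta>" and \<eta>: "0 \<le> \<eta>"
    and mod: "\<And>u v. cell_of u = src M e \<Longrightarrow> cell_of v = src M e \<Longrightarrow> dist u v < \<delta> \<Longrightarrow> \<bar>pr M e u - pr M e v\<bar> \<le> \<eta>"
  shows "\<bar>measure (words y N (k + length w + 1)) {v. drop k v = w @ [e]}
      - measure_pmf.expectation (words y N (k + length w)) (\<lambda>v. if drop k v = w then pr M e (base_point v) else 0)\<bar>
    \<le> \<eta> + a ^ (k + length w) * drift_bound y / \<delta>"
proof -
  let ?L = "k + length w"
  let ?O = "occupation y N"
  let ?A = "\<lambda>z v. if drop k v = w then pr M e (endpoint v z) else 0"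
  let ?B = "\<lambda>v. if drop k v = w then pr M e (base_point v) else 0"
  let ?E = "\<eta> + a ^ ?L * drift_bound y / \<delta>"
  have E: "0 \<le> ?E" using \<eta> \<delta> a_pos a_less_1 b_nonneg by (intro add_nonneg_nonneg divide_nonneg_pos mult_nonneg_nonneg) auto
  obtain l where l: "?L = Suc l" using w(1) by (cases "?L") auto
  have "measure (words y N (?L + 1)) {v. drop k v = w @ [e]} \<le> 1" by (rule measure_pmf.prob_le_1)
  have mA: "ennreal (measure (words y N (?L + 1)) {v. drop k v = w @ [e]}) = (\<integral>\<^sup>+ z. (\<integral>\<^sup>+ v. ennreal (?A z v) \<partial>walk z ?L) \<partial>?O)"
  proof -
    have "ennreal (measure (words y N (?L + 1)) {v. drop k v = w @ [e]}) = emeasure (words y N (Suc ?L)) {v. drop k v = w @ [e]}"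
      by (simp add: measure_pmf.emeasure_eq_measure)
    also have "\<dots> = (\<integral>\<^sup>+ z. (\<integral>\<^sup>+ v. emeasure (step (endpoint v z)) {f. drop k (v @ [f]) = w @ [e]} \<partial>walk z ?L) \<partial>?O)"
      unfolding words_snoc by (simp add: vimage_def)
    also have "\<dots> = (\<integral>\<^sup>+ z. (\<integral>\<^sup>+ v. ennreal (?A z v) \<partial>walk z ?L) \<partial>?O)"
    proof (intro nn_integral_cong_AE[OF AE_pmfI] AE_pmfI)
      fix z v assume "v \<in> set_pmf (walk z ?L)"
      then have "length v = ?L" using set_walk by blast
      then have "{f. drop k (v @ [f]) = w @ [e]} = (if drop k v = w then {e} else {})" by auto
      then show "emeasure (step (endpoint v z)) {f. drop k (v @ [f]) = w @ [e]} = ennreal (?A z v)"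
        using e by (simp add: emeasure_pmf_single pmf_step)
    qed
    finally show ?thesis .
  qed
  have mB: "ennreal (measure_pmf.expectation (words y N ?L) ?B) = (\<integral>\<^sup>+ z. (\<integral>\<^sup>+ v. ennreal (?B v) \<partial>walk z ?L) \<partial>?O)"
  proof -
    have "ennreal (measure_pmf.expectation (words y N ?L) ?B) = (\<integral>\<^sup>+ v. ennreal (?B v) \<partial>words y N ?L)"
      using pr_nonneg[OF e] pr_le_1[OF e]
      by (intro nn_integral_eq_integral[symmetric] measure_pmf.integrable_const_bound[where B = 1]) auto
    then show ?thesis by (simp only: words_eq nn_integral_bind_pmf)
  qed
  have D: "(\<integral>\<^sup>+ z. (\<integral>\<^sup>+ v. ennreal (\<eta> + dist (endpoint v z) (base_point v) / \<delta>) \<partial>walk z ?L) \<partial>?O) \<le> ennreal ?E"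
  proof -
    have "(\<integral>\<^sup>+ z. (\<integral>\<^sup>+ v. ennreal (\<eta> + dist (endpoint v z) (base_point v) / \<delta>) \<partial>walk z ?L) \<partial>?O)
        = (\<integral>\<^sup>+ z. (\<integral>\<^sup>+ v. ennreal \<eta> + ennreal (1 / \<delta>) * ennreal (dist (endpoint v z) (base_point v)) \<partial>walk z ?L) \<partial>?O)"
      using \<eta> \<delta> by (intro nn_integral_cong) (simp add: ennreal_mult'[symmetric] flip: ennreal_plus)
    also have "\<dots> = ennreal \<eta> + ennreal (1 / \<delta>) * (\<integral>\<^sup>+ z. (\<integral>\<^sup>+ v. ennreal (dist (endpoint v z) (base_point v)) \<partial>walk z ?L) \<partial>?O)"
      by (simp add: nn_integral_add nn_integral_cmult)
    also have "\<dots> \<le> ennreal \<eta> + ennreal (1 / \<delta>) * ennreal (a ^ ?L * drift_bound y)"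
      unfolding l by (intro add_left_mono mult_left_mono endpoint_base_point_occupation) simp
    also have "\<dots> = ennreal ?E"
      using \<eta> \<delta> a_pos drift_bound_nonneg[of y] by (simp add: ennreal_mult'[symmetric] flip: ennreal_plus)
    finally show ?thesis .
  qed
  have pw: "?A z v \<le> ?B v + (\<eta> + dist (endpoint v z) (base_point v) / \<delta>) \<and>
      ?B v \<le> ?A z v + (\<eta> + dist (endpoint v z) (base_point v) / \<delta>)" if "v \<in> set_pmf (walk z ?L)" for z v
  proof (cases "drop k v = w")
    case False
    then show ?thesis using \<eta> \<delta> by simp
  next
    case True
    let ?p = "endpoint v z" and ?q = "base_point v"
    have v: "length v = ?L" "admissible (cell_of z) v" using set_walk[OF that] by auto
    have "v \<noteq> []" using v(1) w(1) by auto
    moreover have "last v = last w"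
      using True w(1) last_drop[of k v] by (cases "k < length v") auto
    ultimately have cells: "cell_of ?p = src M e" "cell_of ?q = src M e"
      using cell_of_endpoint[OF v(2)] cell_of_base_point[OF v(2)] w(2) by auto
    have "\<bar>pr M e ?p - pr M e ?q\<bar> \<le> \<eta> + dist ?p ?q / \<delta>"
    proof (cases "dist ?p ?q < \<delta>")
      case True
      then have "\<bar>pr M e ?p - pr M e ?q\<bar> \<le> \<eta>" by (rule mod[OF cells])
      then show ?thesis using \<delta> by (simp add: add_increasing2)
    next
      case False
      then have "1 \<le> dist ?p ?q / \<delta>" using \<delta> by simp
      moreover have "\<bar>pr M e ?p - pr M e ?q\<bar> \<le> 1"
        using pr_nonneg[OF e, of ?p] pr_le_1[OF e, of ?p] pr_nonneg[OF e, of ?q] pr_le_1[OF e, of ?q] by linarith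
      ultimately show ?thesis using \<eta> by linarith
    qed
    then show ?thesis using True by auto
  qed
  have nn: "0 \<le> ?A z v" "0 \<le> ?B v" "0 \<le> \<eta> + dist (endpoint v z) (base_point v) / \<delta>" for z v
    using pr_nonneg[OF e] \<eta> \<delta> by auto
  have sum: "(\<integral>\<^sup>+ z. (\<integral>\<^sup>+ v. ennreal (f z v) \<partial>walk z ?L) \<partial>?O)
      \<le> (\<integral>\<^sup>+ z. (\<integral>\<^sup>+ v. ennreal (g z v) \<partial>walk z ?L) \<partial>?O) + ennreal ?E"
    if le: "\<And>z v. v \<in> set_pmf (walk z ?L) \<Longrightarrow> f z v \<le> g z v + (\<eta> + dist (endpoint v z) (base_point v) / \<delta>)"
      and g: "\<And>z v. 0 \<le> g z v" for f g
  proof -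
    have "(\<integral>\<^sup>+ z. (\<integral>\<^sup>+ v. ennreal (f z v) \<partial>walk z ?L) \<partial>?O)
      \<le> (\<integral>\<^sup>+ z. (\<integral>\<^sup>+ v. ennreal (g z v) + ennreal (\<eta> + dist (endpoint v z) (base_point v) / \<delta>) \<partial>walk z ?L) \<partial>?O)"
    proof (intro nn_integral_mono_AE[OF AE_pmfI] AE_pmfI)
      fix z v assume "v \<in> set_pmf (walk z ?L)"
      from ennreal_leI[OF le[OF this]] show "ennreal (f z v) \<le> ennreal (g z v) + ennreal (\<eta> + dist (endpoint v z) (base_point v) / \<delta>)"
        using g nn(3) by (simp only: ennreal_plus)
    qed
    also have "\<dots> = (\<integral>\<^sup>+ z. (\<integral>\<^sup>+ v. ennreal (g z v) \<partial>walk z ?L) \<partial>?O)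
       + (\<integral>\<^sup>+ z. (\<integral>\<^sup>+ v. ennreal (\<eta> + dist (endpoint v z) (base_point v) / \<delta>) \<partial>walk z ?L) \<partial>?O)"
      by (subst nn_integral_add[symmetric]) (auto intro!: nn_integral_cong nn_integral_add simp del: ennreal_plus)
    finally show ?thesis using D by (meson add_left_mono order.trans)
  qed
  have EB: "0 \<le> measure_pmf.expectation (words y N ?L) ?B" by (intro Bochner_Integration.integral_nonneg nn(2))
  have "ennreal (measure (words y N (?L + 1)) {v. drop k v = w @ [e]}) \<le> ennreal (measure_pmf.expectation (words y N ?L) ?B) + ennreal ?E"
    unfolding mA mB by (rule sum) (use pw nn in auto)
  then have 1: "measure (words y N (?L + 1)) {v. drop k v = w @ [e]} \<le> measure_pmf.expectation (words y N ?L) ?B + ?E"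
    by (rule ennreal_le_plusD[OF _ EB E])
  have "ennreal (measure_pmf.expectation (words y N ?L) ?B) \<le> ennreal (measure (words y N (?L + 1)) {v. drop k v = w @ [e]}) + ennreal ?E"
    unfolding mA mB by (rule sum) (use pw nn in auto)
  then have 2: "measure_pmf.expectation (words y N ?L) ?B \<le> measure (words y N (?L + 1)) {v. drop k v = w @ [e]} + ?E"
    by (rule ennreal_le_plusD[OF _ measure_nonneg E])
  from 1 2 show ?thesis by linarith
qed

text \<open>
  The estimate of \<open>next_letter_close\<close> does not depend on the time \<open>N\<close> and therefore passes to the limit
  laws.  Afterwards the length \<open>k\<close> of the past tends to infinity.
\<close>

theorem next_letter_law:
  assumes e: "e \<in> edges M" and w: "w \<noteq> []" "tgt M (last w) = src M e"
  shows "(\<lambda>k. measure_pmf.expectation (P (k + length w)) (\<lambda>v. if drop k v = w then pr M e (base_point v) else 0))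
    \<longlonglongrightarrow> pmf (P (length w + 1)) (w @ [e])"
proof (rule LIMSEQ_I)
  fix \<epsilon> :: real assume "0 < \<epsilon>"
  let ?B = "\<lambda>k v. if drop k v = w then pr M e (base_point v) else 0"
  have "uniformly_continuous_on (cell M (src M e)) (pr M e)"
    using unif_cont e by (simp add: uniformly_continuous_system_def)
  then obtain \<delta> where \<delta>: "0 < \<delta>" "\<And>u v. u \<in> cell M (src M e) \<Longrightarrow> v \<in> cell M (src M e) \<Longrightarrow> dist u v < \<delta> \<Longrightarrow> dist (pr M e u) (pr M e v) < \<epsilon> / 2"
    unfolding uniformly_continuous_on_def using \<open>0 < \<epsilon>\<close> by (metis half_gt_zero dist_commute)
  have mod: "\<bar>pr M e u - pr M e v\<bar> \<le> \<epsilon> / 2" if "cell_of u = src M e" "cell_of v = src M e" "dist u v < \<delta>" for u v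
    using \<delta>(2)[of u v] that in_cell_of[of u] in_cell_of[of v] by (simp add: dist_real_def)
  have bound: "\<bar>pmf (P (length w + 1)) (w @ [e]) - measure_pmf.expectation (P (k + length w)) (?B k)\<bar>
      \<le> \<epsilon> / 2 + a ^ (k + length w) * drift_bound y / \<delta>" for k
  proof (rule LIMSEQ_le_const2)
    have P: "pmf (P (length w + 1)) (w @ [e]) = measure_pmf.expectation (P (k + length w + 1)) (indicator {v. drop k v = w @ [e]})"
    proof -
      have "pmf (P (length w + 1)) (w @ [e]) = pmf (map_pmf (drop k) (P (k + (length w + 1)))) (w @ [e])"
        by (simp only: P_drop)
      also have "\<dots> = measure (P (k + length w + 1)) {v. drop k v = w @ [e]}"
        by (simp add: pmf_map vimage_def)
      finally show ?thesis by simp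
    qed
    have "(\<lambda>n. measure_pmf.expectation (words y (r n) (k + length w + 1)) (indicator {v. drop k v = w @ [e]} :: _ \<Rightarrow> real))
      \<longlonglongrightarrow> measure_pmf.expectation (P (k + length w + 1)) (indicator {v. drop k v = w @ [e]})"
      by (rule pmf_tendsto_expectation[OF words_tendsto]) auto
    moreover have "(\<lambda>n. measure_pmf.expectation (words y (r n) (k + length w)) (?B k))
      \<longlonglongrightarrow> measure_pmf.expectation (P (k + length w)) (?B k)"
      by (rule pmf_tendsto_expectation[OF words_tendsto]) (use pr_nonneg[OF e] pr_le_1[OF e] in auto)
    ultimately show "(\<lambda>n. \<bar>measure (words y (r n) (k + length w + 1)) {v. drop k v = w @ [e]} - measure_pmf.expectation (words y (r n) (k + length w)) (?B k)\<bar>)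
      \<longlonglongrightarrow> \<bar>pmf (P (length w + 1)) (w @ [e]) - measure_pmf.expectation (P (k + length w)) (?B k)\<bar>"
      unfolding P by (intro tendsto_rabs tendsto_diff) simp_all
    show "\<exists>N. \<forall>n\<ge>N. \<bar>measure (words y (r n) (k + length w + 1)) {v. drop k v = w @ [e]} - measure_pmf.expectation (words y (r n) (k + length w)) (?B k)\<bar>
      \<le> \<epsilon> / 2 + a ^ (k + length w) * drift_bound y / \<delta>"
    proof (intro exI allI impI next_letter_close[OF e w \<delta>(1)] mod)
      show "0 \<le> \<epsilon> / 2" using \<open>0 < \<epsilon>\<close> by simp
    qed
  qed
  have "(\<lambda>k. a ^ (k + length w) * drift_bound y / \<delta>) \<longlonglongrightarrow> 0 * drift_bound y / \<delta>"
    using a_pos a_less_1 \<delta>(1) by (intro tendsto_intros LIMSEQ_ignore_initial_segment LIMSEQ_realpow_zero) auto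
  then have "\<forall>\<^sub>F k in sequentially. a ^ (k + length w) * drift_bound y / \<delta> < \<epsilon> / 2"
    using \<open>0 < \<epsilon>\<close> by (intro order_tendstoD) auto
  then obtain K where K: "\<And>k. k \<ge> K \<Longrightarrow> a ^ (k + length w) * drift_bound y / \<delta> < \<epsilon> / 2"
    by (auto simp: eventually_sequentially)
  have "norm (measure_pmf.expectation (P (k + length w)) (?B k) - pmf (P (length w + 1)) (w @ [e])) < \<epsilon>" if "k \<ge> K" for k
    using bound[of k] K[OF that] unfolding real_norm_def by linarith
  then show "\<exists>K. \<forall>k\<ge>K. norm (measure_pmf.expectation (P (k + length w)) (?B k) - pmf (P (length w + 1)) (w @ [e])) < \<epsilon>"
    by blast
qed

end

section \<open>Stationary limit measures\<close>

lemma Cauchy_of_summable_dist: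
  fixes f :: "nat \<Rightarrow> 'a :: metric_space"
  assumes "summable (\<lambda>n. dist (f (Suc n)) (f n))"
  shows "Cauchy f"
proof (rule metric_CauchyI)
  fix e :: real assume "0 < e"
  with assms obtain N where N: "\<And>m n. m \<ge> N \<Longrightarrow> norm (\<Sum>i=m..<n. dist (f (Suc i)) (f i)) < e"
    unfolding summable_Cauchy by blast
  have le: "dist (f (m + k)) (f m) \<le> (\<Sum>i=m..<m+k. dist (f (Suc i)) (f i))" for m k
  proof (induction k)
    case (Suc k)
    have "dist (f (m + Suc k)) (f m) \<le> dist (f (Suc (m + k))) (f (m + k)) + dist (f (m + k)) (f m)"
      by (simp add: dist_triangle)
    then show ?case using Suc by simp
  qed simp
  have lt: "dist (f n) (f m) < e" if "N \<le> m" "m \<le> n" for m n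
    using le[of m "n - m"] N[of m n] that by (auto simp: sum_nonneg)
  show "\<exists>N. \<forall>m\<ge>N. \<forall>n\<ge>N. dist (f m) (f n) < e"
    using lt by (metis dist_commute nle_le)
qed

definition window :: "int \<Rightarrow> nat \<Rightarrow> (int \<Rightarrow> 'a) \<Rightarrow> 'a list" where
  "window k L \<sigma> = map (\<lambda>i. \<sigma> (k + int i)) [0..<L]"

lemma length_window [simp]: "length (window k L \<sigma>) = L"
  by (simp add: window_def)

lemma window_nth: "i < L \<Longrightarrow> window k L \<sigma> ! i = \<sigma> (k + int i)"
  by (simp add: window_def)

lemma window_eq_iff: "window k L \<sigma> = w \<longleftrightarrow> length w = L \<and> (\<forall>i<L. \<sigma> (k + int i) = w ! i)"
  by (auto simp: list_eq_iff_nth_eq window_nth)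

lemma window_Suc: "window k (Suc L) \<sigma> = \<sigma> k # window (k + 1) L \<sigma>"
  by (simp add: window_def map_upt_Suc algebra_simps del: upt_Suc)

lemma window_drop: "drop d (window k (d + L) \<sigma>) = window (k + int d) L \<sigma>"
  by (rule nth_equalityI) (auto simp: window_nth algebra_simps)

lemma window_snoc: "window k (Suc L) \<sigma> = window k L \<sigma> @ [\<sigma> (k + int L)]"
  by (simp add: window_def)

lemma window_eq_window_iff: "window k L \<sigma> = window k L \<eta> \<longleftrightarrow> (\<forall>i\<in>{k..<k + int L}. \<sigma> i = \<eta> i)"
proof -
  have "(\<forall>i<L. \<sigma> (k + int i) = \<eta> (k + int i)) \<longleftrightarrow> (\<forall>i\<in>{k..<k + int L}. \<sigma> i = \<eta> i)"
  proof safe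
    fix j assume *: "\<forall>i<L. \<sigma> (k + int i) = \<eta> (k + int i)" and "j \<in> {k..<k + int L}"
    then have "nat (j - k) < L" "k + int (nat (j - k)) = j" by auto
    then show "\<sigma> j = \<eta> j" using * by metis
  qed simp
  then show ?thesis by (auto simp: window_eq_iff window_nth)
qed

text \<open>
  A Kolmogorov extension of the limit laws.  Prescribing the law of a window irrespective of its
  position is what makes \<open>\<Lambda>\<close> shift invariant.
\<close>

locale stationary_limit = limit_chain M x a b y r P
  for M :: "('k :: complete_space, 'e) markov_sys" and x :: "nat \<Rightarrow> 'k" and a b :: real
    and y r P +
  fixes \<Lambda> :: "(int \<Rightarrow> 'e option) measure"
  assumes sets_\<Lambda>: "sets \<Lambda> = sets (code_borel M)" and prob_\<Lambda>: "prob_space \<Lambda>"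
    and \<Lambda>_word: "emeasure \<Lambda> {\<sigma> \<in> space \<Lambda>. \<forall>i<length w. \<sigma> (k + int i) = w ! i}
      = ennreal (pmf (map_pmf (map Some) (P (length w))) w)"
begin

sublocale prob_space \<Lambda> by (rule prob_\<Lambda>)

lemmas [measurable_cong] = sets_\<Lambda>

lemma space_\<Lambda>: "space \<Lambda> = code_space M"
  using sets_eq_imp_space_eq[OF sets_\<Lambda>] by simp

lemma past_subalgebra: "subalgebra \<Lambda> (past_algebra M)"
  using past_subset sets_\<Lambda> by (simp add: subalgebra_def space_\<Lambda>)

lemma window_measurable [measurable]: "window k L \<in> \<Lambda> \<rightarrow>\<^sub>M count_space UNIV"
proof -
  have "window k L \<in> code_borel M \<rightarrow>\<^sub>M count_space UNIV"
    by (rule measurable_finite_dependence[of _ "{k..<k + int L}"])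
      (auto intro: code_coord window_eq_window_iff[THEN iffD2])
  then show ?thesis using measurable_cong_sets[OF sets_\<Lambda> refl] by blast
qed

lemma window_distr: "distr \<Lambda> (count_space UNIV) (window k L) = measure_pmf (map_pmf (map Some) (P L))"
proof (rule measure_eqI_countable_AE)
  let ?\<Omega> = "{w \<in> lists letters. length w = L}"
  have "countable (lists letters)" by simp
  then show "countable ?\<Omega>" by (rule countable_subset[rotated]) auto
  show "AE w in distr \<Lambda> (count_space UNIV) (window k L). w \<in> ?\<Omega>"
    by (subst AE_distr_iff) (auto intro!: AE_I2 simp: space_\<Lambda> window_def intro: code_spaceD)
  show "AE w in measure_pmf (map_pmf (map Some) (P L)). w \<in> ?\<Omega>"
  proof (rule AE_pmfI)
    fix w assume "w \<in> set_pmf (map_pmf (map Some) (P L))"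
    then obtain v where v: "v \<in> set_pmf (P L)" "w = map Some v" by auto
    then have "length v = L" "set v \<subseteq> edges M" using P_support[OF v(1)] admissible_edges by auto
    then show "w \<in> ?\<Omega>" using v(2) by (auto simp: subset_eq)
  qed
  fix w assume w: "w \<in> ?\<Omega>"
  have "emeasure (distr \<Lambda> (count_space UNIV) (window k L)) {w} = emeasure \<Lambda> (window k L -` {w} \<inter> space \<Lambda>)"
    by (rule emeasure_distr) auto
  also have "window k L -` {w} \<inter> space \<Lambda> = {\<sigma> \<in> space \<Lambda>. \<forall>i<length w. \<sigma> (k + int i) = w ! i}"
    using w by (auto simp: window_eq_iff)
  finally show "emeasure (distr \<Lambda> (count_space UNIV) (window k L)) {w} = emeasure (measure_pmf (map_pmf (map Some) (P L))) {w}"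
    using w \<Lambda>_word[where w = w and k = k] by (simp add: emeasure_pmf_single)
qed simp_all

lemma nn_integral_window: "(\<integral>\<^sup>+ \<sigma>. f (window k L \<sigma>) \<partial>\<Lambda>) = (\<integral>\<^sup>+ w. f (map Some w) \<partial>P L)"
proof -
  have "(\<integral>\<^sup>+ \<sigma>. f (window k L \<sigma>) \<partial>\<Lambda>) = (\<integral>\<^sup>+ w. f w \<partial>distr \<Lambda> (count_space UNIV) (window k L))"
    by (rule nn_integral_distr[symmetric]) auto
  then show ?thesis by (simp add: window_distr)
qed

lemma integral_window: "(\<integral> \<sigma>. f (window k L \<sigma>) \<partial>\<Lambda>) = measure_pmf.expectation (P L) (\<lambda>w. f (map Some w) :: real)"
proof -
  have "(\<integral> \<sigma>. f (window k L \<sigma>) \<partial>\<Lambda>) = (\<integral> w. f w \<partial>distr \<Lambda> (count_space UNIV) (window k L))"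
    by (rule integral_distr[symmetric]) auto
  then show ?thesis by (simp add: window_distr)
qed

lemma emeasure_window: "emeasure \<Lambda> {\<sigma> \<in> space \<Lambda>. window k L \<sigma> \<in> S} = emeasure (map_pmf (map Some) (P L)) S"
proof -
  have "emeasure (distr \<Lambda> (count_space UNIV) (window k L)) S = emeasure \<Lambda> (window k L -` S \<inter> space \<Lambda>)"
    by (rule emeasure_distr) auto
  also have "window k L -` S \<inter> space \<Lambda> = {\<sigma> \<in> space \<Lambda>. window k L \<sigma> \<in> S}" by auto
  finally show ?thesis by (simp add: window_distr)
qed

lemma AE_window: "AE \<sigma> in \<Lambda>. \<exists>w\<in>set_pmf (P L). window k L \<sigma> = map Some w"
proof -
  have "AE v in distr \<Lambda> (count_space UNIV) (window k L). \<exists>w\<in>set_pmf (P L). v = map Some w"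
    unfolding window_distr by (rule AE_pmfI) auto
  then show ?thesis by (rule AE_distrD[rotated]) measurable
qed

lemma AE_Sigma_G: "AE \<sigma> in \<Lambda>. \<sigma> \<in> Sigma_G M"
proof -
  have "AE \<sigma> in \<Lambda>. \<forall>n. \<exists>w\<in>set_pmf (P 2). window n 2 \<sigma> = map Some w"
    unfolding AE_all_countable using AE_window by blast
  then show ?thesis
    using AE_space
  proof eventually_elim
    case (elim \<sigma>)
    have "\<sigma> n \<in> Some ` edges M \<and> srcb M (\<sigma> (n + 1)) = tgtb M (\<sigma> n)" for n
    proof -
      obtain w where w: "w \<in> set_pmf (P 2)" "window n 2 \<sigma> = map Some w" using elim by blast
      then obtain e f where ef: "w = [e, f]" using P_support[OF w(1)] by (auto simp: numeral_2_eq_2 length_Suc_conv)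
      obtain j where "admissible j w" using P_support[OF w(1)] by auto
      then have "e \<in> edges M" "src M f = tgt M e" by (auto simp: ef)
      moreover have "\<sigma> n = Some e" "\<sigma> (n + 1) = Some f"
        using w(2) by (auto simp: ef numeral_2_eq_2 window_Suc window_def)
      ultimately show ?thesis by auto
    qed
    then show ?case using elim by (simp add: Sigma_G_def space_\<Lambda>)
  qed
qed

lemma past_comp_window:
  assumes \<sigma>: "\<sigma> \<in> Sigma_G M"
  shows "past_comp M \<sigma> m z = endpoint (map the (window (- int m) (Suc m) \<sigma>)) z"
proof (induction m arbitrary: z)
  case 0
  obtain e where "\<sigma> 0 = Some e" using Sigma_GD(1)[OF \<sigma>] by blast
  then show ?case by (simp add: window_def)
next
  case (Suc m)
  obtain e where e: "\<sigma> (- int (Suc m)) = Some e" using Sigma_GD(1)[OF \<sigma>] by blast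
  then show ?case using Suc by (simp add: window_Suc[of _ "Suc m"])
qed

lemma past_point_window:
  assumes \<sigma>: "\<sigma> \<in> Sigma_G M"
  shows "past_point M x \<sigma> m = base_point (map the (window (- int m) (Suc m) \<sigma>))"
proof -
  obtain e where e: "\<sigma> (- int m) = Some e" using Sigma_GD(1)[OF \<sigma>] by blast
  then show ?thesis
    unfolding past_point_def past_comp_window[OF \<sigma>] base_point_def by (simp add: window_Suc)
qed

lemma map_the_Some [simp]: "map the (map Some w) = w"
  by (simp add: comp_def)

lemma past_dist_measurable [measurable]:
  "(\<lambda>\<sigma>. ennreal (dist (past_point M x \<sigma> m) (past_point M x \<sigma> n))) \<in> borel_measurable \<Lambda>"
  using measurable_compose[OF past_point_measurable[of "\<lambda>y z. ennreal (dist y z)"], of id borel]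
  by (intro measurable_from_subalg[OF past_subalgebra]) simp

text \<open>
  Consecutive approximants have summable mean distances, hence almost surely summable distances.
\<close>

lemma AE_Dset: "AE \<sigma> in \<Lambda>. \<sigma> \<in> Dset M x"
proof -
  let ?d = "\<lambda>m \<sigma>. ennreal (dist (past_point M x \<sigma> (Suc m)) (past_point M x \<sigma> m))"
  have le: "(\<integral>\<^sup>+ \<sigma>. ?d m \<sigma> \<partial>\<Lambda>) \<le> ennreal (2 * a ^ Suc m * drift_bound y)" for m
  proof -
    let ?f = "\<lambda>w. ennreal (dist (base_point (map the w)) (base_point (tl (map the w))))"
    have "(\<integral>\<^sup>+ \<sigma>. ?d m \<sigma> \<partial>\<Lambda>) = (\<integral>\<^sup>+ \<sigma>. ?f (window (- int (Suc m)) (Suc (Suc m)) \<sigma>) \<partial>\<Lambda>)"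
    proof (rule nn_integral_cong_AE)
      show "AE \<sigma> in \<Lambda>. ?d m \<sigma> = ?f (window (- int (Suc m)) (Suc (Suc m)) \<sigma>)"
        using AE_Sigma_G
      proof eventually_elim
        case (elim \<sigma>)
        then show ?case using past_point_window[OF elim, of m] past_point_window[OF elim, of "Suc m"]
          by (simp add: window_Suc[of _ "Suc m"])
      qed
    qed
    also have "\<dots> = (\<integral>\<^sup>+ w. ennreal (dist (base_point w) (base_point (tl w))) \<partial>P (Suc (Suc m)))"
      unfolding nn_integral_window[of ?f] by (simp only: map_the_Some)
    finally show ?thesis using P_base_point_tl[of m] by simp
  qed
  have "(\<integral>\<^sup>+ \<sigma>. (\<Sum>m. ?d m \<sigma>) \<partial>\<Lambda>) = (\<Sum>m. \<integral>\<^sup>+ \<sigma>. ?d m \<sigma> \<partial>\<Lambda>)"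
    by (rule nn_integral_suminf) measurable
  also have "\<dots> \<le> (\<Sum>m. ennreal (2 * a ^ Suc m * drift_bound y))" by (intro suminf_le le) auto
  also have "\<dots> < \<top>"
  proof -
    have "summable (\<lambda>m. 2 * a ^ Suc m * drift_bound y)"
      using a_pos a_less_1 by (intro summable_mult summable_mult2 summable_Suc_iff[THEN iffD2] summable_geometric) auto
    then have "(\<Sum>m. ennreal (2 * a ^ Suc m * drift_bound y)) \<noteq> \<top>"
      using a_pos drift_bound_nonneg[of y] by (intro ennreal_suminf_neq_top mult_nonneg_nonneg) auto
    then show ?thesis by (simp only: less_top)
  qed
  finally have "(\<integral>\<^sup>+ \<sigma>. (\<Sum>m. ?d m \<sigma>) \<partial>\<Lambda>) \<noteq> \<infinity>" by simp
  then have "AE \<sigma> in \<Lambda>. (\<Sum>m. ?d m \<sigma>) \<noteq> \<infinity>" by (intro nn_integral_PInf_AE) measurable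
  then show ?thesis
    using AE_Sigma_G
  proof eventually_elim
    case (elim \<sigma>)
    have "summable (\<lambda>m. dist (past_point M x \<sigma> (Suc m)) (past_point M x \<sigma> m))"
      using elim(1) by (intro summable_suminf_not_top) auto
    then have "convergent (past_point M x \<sigma>)"
      unfolding Cauchy_convergent_iff[symmetric] by (rule Cauchy_of_summable_dist)
    then show ?case using elim(2) by (simp add: Dset_def)
  qed
qed

lemma shift_invariant: "distr \<Lambda> \<Lambda> shift = \<Lambda>"
proof (rule measure_eqI_PiM_infinite)
  have shift_meas: "shift \<in> \<Lambda> \<rightarrow>\<^sub>M \<Lambda>"
    unfolding measurable_cong_sets[OF sets_\<Lambda> sets_\<Lambda>] by (rule shift_measurable)
  show "sets (distr \<Lambda> \<Lambda> shift) = sets (\<Pi>\<^sub>M i\<in>UNIV. count_space letters)" "sets \<Lambda> = sets (\<Pi>\<^sub>M i\<in>UNIV. count_space letters)"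
    by (simp_all add: sets_\<Lambda> sets_code_borel)
  show "finite_measure (distr \<Lambda> \<Lambda> shift)"
    using prob_space_distr[OF shift_meas] by (rule prob_space.finite_measure)
  fix A :: "int \<Rightarrow> 'e option set" and J :: "int set"
  assume J: "finite J" and A: "\<And>i. i \<in> J \<Longrightarrow> A i \<in> sets (count_space letters)"
  define k where "k = Min (insert 0 J)"
  define L where "L = nat (Max (insert 0 J) - k + 1)"
  have JL: "k \<le> j" "j < k + int L" if "j \<in> J" for j
  proof -
    show "k \<le> j" unfolding k_def using that J by (intro Min_le) auto
    have "j \<le> Max (insert 0 J)" using that J by (intro Max_ge) auto
    moreover have "k \<le> Max (insert 0 J)" unfolding k_def using J by (intro order.trans[OF Min_le[of _ 0] Max_ge[of _ 0]]) auto
    ultimately show "j < k + int L" by (simp add: L_def)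
  qed
  let ?emb = "prod_emb UNIV (\<lambda>_. count_space letters) J (PiE J A)"
  define S where "S = {w. \<forall>j\<in>J. w ! nat (j - k) \<in> A j}"
  have nth: "window (k + d) L \<sigma> ! nat (j - k) = \<sigma> (j + d)" if "j \<in> J" for \<sigma> :: "int \<Rightarrow> 'e option" and j d
    using JL[OF that] by (subst window_nth) (auto simp: algebra_simps)
  have emb: "?emb = {\<sigma> \<in> space \<Lambda>. window k L \<sigma> \<in> S}"
    using nth[of _ 0] by (auto simp: prod_emb_def PiE_iff space_\<Lambda> code_space_eq S_def extensional_def)
  have emb_sets: "?emb \<in> sets \<Lambda>"
    using measurable_sets[OF window_measurable, of S k L] unfolding emb by (simp add: vimage_def Int_def conj_commute)
  have "emeasure (distr \<Lambda> \<Lambda> shift) ?emb = emeasure \<Lambda> (shift -` ?emb \<inter> space \<Lambda>)"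
    by (rule emeasure_distr[OF shift_meas emb_sets])
  also have "shift -` ?emb \<inter> space \<Lambda> = {\<sigma> \<in> space \<Lambda>. window (k + 1) L \<sigma> \<in> S}"
    unfolding emb using nth[of _ 0] nth[of _ 1] by (auto simp: S_def shift_def space_\<Lambda> code_space_eq)
  also have "emeasure \<Lambda> \<dots> = emeasure \<Lambda> ?emb"
    unfolding emb by (simp only: emeasure_window)
  finally show "emeasure (distr \<Lambda> \<Lambda> shift) ?emb = emeasure \<Lambda> ?emb" .
qed

end

section \<open>Conditional law given the past\<close>

context stationary_limit
begin

definition next_prob :: "'e \<Rightarrow> (int \<Rightarrow> 'e option) \<Rightarrow> real" where
  "next_prob e \<sigma> = pbar M e (limit_point x \<sigma>) * (if tgtb M (\<sigma> 0) = src M e then 1 else 0)"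

lemma next_prob_measurable:
  assumes e: "e \<in> edges M"
  shows "next_prob e \<in> borel_measurable (past_algebra M)"
proof -
  note [measurable] = pbar_measurable[OF e]
  have [measurable]: "(\<lambda>\<sigma>. tgtb M (\<sigma> 0)) \<in> past_algebra M \<rightarrow>\<^sub>M count_space UNIV"
    by (rule past_measurable_finite_dependence[of 0]) simp
  show ?thesis unfolding next_prob_def[abs_def] by measurable
qed

lemma next_prob_bounds:
  assumes e: "e \<in> edges M"
  shows "0 \<le> next_prob e \<sigma>" "next_prob e \<sigma> \<le> 1"
  using pbar_bounds[OF e] by (auto simp: next_prob_def)

lemma past_cylinder_eq_window: "cylinder M (- int m) 0 \<eta> = {\<sigma> \<in> space \<Lambda>. window (- int m) (Suc m) \<sigma> = window (- int m) (Suc m) \<eta>}"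
proof -
  have "{- int m..0} = {- int m..<- int m + int (Suc m)}" by auto
  then show ?thesis by (simp only: cylinder_def space_\<Lambda> window_eq_window_iff)
qed

text \<open>
  The integral is the limit of the integrals of \<open>p\<^sub>e\<close> at the approximants of the limit point, by dominated
  convergence, and \<open>next_letter_law\<close> evaluates that limit.  If \<open>e\<close> does not start where \<open>w\<close> ends, both sides
  vanish.
\<close>

lemma next_letter_on_cylinder:
  assumes e: "e \<in> edges M" and w: "w \<in> set_pmf (P (Suc m))"
  defines "K \<equiv> {\<sigma> \<in> space \<Lambda>. window (- int m) (Suc m) \<sigma> = map Some w}"
  shows "(\<integral> \<sigma>. indicator K \<sigma> * next_prob e \<sigma> \<partial>\<Lambda>) = pmf (P (Suc (Suc m))) (w @ [e])"
proof -
  obtain j where len: "length w = Suc m" and ch: "admissible j w" using P_support[OF w] by auto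
  then have w0: "w \<noteq> []" by auto
  have K [measurable]: "K \<in> sets \<Lambda>"
    using measurable_sets[OF window_measurable, of "{map Some w}" "- int m" "Suc m"]
    unfolding K_def by (simp add: vimage_def Int_def conj_commute)
  note next_meas [measurable] = measurable_from_subalg[OF past_subalgebra next_prob_measurable[OF e]]
  have tgt: "tgtb M (\<sigma> 0) = tgt M (last w)" if "\<sigma> \<in> K" for \<sigma>
  proof -
    have "\<sigma> 0 = last (window (- int m) (Suc m) \<sigma>)" by (simp add: window_snoc)
    also have "\<dots> = Some (last w)" using that w0 by (simp add: K_def last_map)
    finally show ?thesis by simp
  qed
  show ?thesis
  proof (cases "tgt M (last w) = src M e")
    case False
    have "(\<integral> \<sigma>. indicator K \<sigma> * next_prob e \<sigma> \<partial>\<Lambda>) = (\<integral> \<sigma>. 0 \<partial>\<Lambda>)"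
      using False tgt by (intro Bochner_Integration.integral_cong) (auto simp: indicator_def next_prob_def)
    moreover have "w @ [e] \<notin> set_pmf (P (Suc (Suc m)))"
    proof
      assume "w @ [e] \<in> set_pmf (P (Suc (Suc m)))"
      then obtain i where "admissible i (w @ [e])" using P_support by blast
      then have "tgt M (last w) = src M e"
        using w0 by (induction w arbitrary: i) (auto split: if_splits)
      then show False using False by simp
    qed
    ultimately show ?thesis by (simp add: set_pmf_iff)
  next
    case True
    let ?B = "\<lambda>k v. if drop k v = w then pr M e (base_point v) else 0"
    let ?X = "\<lambda>k \<sigma>. window (- int (k + m)) (Suc (k + m)) \<sigma>"
    have fin: "measure_pmf.expectation (P (k + length w)) (?B k) = (\<integral> \<sigma>. ?B k (map the (?X k \<sigma>)) \<partial>\<Lambda>)" for k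
      using integral_window[of "\<lambda>v. ?B k (map the v)" "- int (k + m)" "Suc (k + m)"]
      unfolding map_the_Some len add_Suc_right by (rule sym)
    have in_K: "indicator K \<sigma> * pr M e (past_point M x \<sigma> (k + m)) = ?B k (map the (?X k \<sigma>))" if \<sigma>: "\<sigma> \<in> Sigma_G M" for k \<sigma>
    proof -
      have some: "map Some (map the (window l L \<sigma>)) = window l L \<sigma>" for l L
      proof -
        have "Some (the (\<sigma> n)) = \<sigma> n" for n using Sigma_GD(1)[OF \<sigma>, of n] by auto
        then show ?thesis by (simp add: window_def comp_def)
      qed
      have "drop k (map the (?X k \<sigma>)) = map the (window (- int m) (Suc m) \<sigma>)"
        using window_drop[of k "- int (k + m)" "Suc m" \<sigma>] by (simp add: drop_map)
      also have "\<dots> = w \<longleftrightarrow> window (- int m) (Suc m) \<sigma> = map Some w"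
        using some by (metis map_the_Some)
      also have "\<dots> \<longleftrightarrow> \<sigma> \<in> K" using Sigma_GD(3)[OF \<sigma>] by (simp add: K_def space_\<Lambda>)
      finally show ?thesis using past_point_window[OF \<sigma>, of "k + m"] by (simp add: indicator_def)
    qed
    have "(\<lambda>k. \<integral> \<sigma>. ?B k (map the (?X k \<sigma>)) \<partial>\<Lambda>) \<longlonglongrightarrow> (\<integral> \<sigma>. indicator K \<sigma> * next_prob e \<sigma> \<partial>\<Lambda>)"
    proof (rule integral_dominated_convergence[where w = "\<lambda>_. 1"])
      show "(\<lambda>\<sigma>. indicator K \<sigma> * next_prob e \<sigma>) \<in> borel_measurable \<Lambda>" by measurable
      show "(\<lambda>\<sigma>. ?B k (map the (?X k \<sigma>))) \<in> borel_measurable \<Lambda>" for k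
        by (rule measurable_compose[OF window_measurable[of "- int (k + m)" "Suc (k + m)"]]) simp
      show "integrable \<Lambda> (\<lambda>_. 1 :: real)" by simp
      show "AE \<sigma> in \<Lambda>. norm (?B k (map the (?X k \<sigma>))) \<le> 1" for k
        using pr_nonneg[OF e] pr_le_1[OF e] by (intro AE_I2) auto
      show "AE \<sigma> in \<Lambda>. (\<lambda>k. ?B k (map the (?X k \<sigma>))) \<longlonglongrightarrow> indicator K \<sigma> * next_prob e \<sigma>"
        using AE_Dset
      proof eventually_elim
        case (elim \<sigma>)
        note G = Dset_tendsto(2)[OF elim]
        show ?case
        proof (cases "\<sigma> \<in> K")
          case K: True
          have t: "tgtb M (\<sigma> 0) = src M e" using tgt[OF K] True by simp
          have "(\<lambda>k. pr M e (past_point M x \<sigma> (k + m))) \<longlonglongrightarrow> pbar M e (limit_point x \<sigma>)"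
            by (rule LIMSEQ_ignore_initial_segment[OF pbar_tendsto[OF e elim t]])
          then show ?thesis using K t unfolding in_K[OF G, symmetric] by (simp add: next_prob_def)
        next
          case False
          then show ?thesis unfolding in_K[OF G, symmetric] by simp
        qed
      qed
    qed
    moreover have "(\<lambda>k. \<integral> \<sigma>. ?B k (map the (?X k \<sigma>)) \<partial>\<Lambda>) \<longlonglongrightarrow> pmf (P (length w + 1)) (w @ [e])"
      unfolding fin[symmetric] by (rule next_letter_law[OF e w0 True])
    ultimately show ?thesis using LIMSEQ_unique len by simp blast
  qed
qed

text \<open>
  The cylinders of the past generate the past algebra and are stable under intersections, so the defining
  identity of the conditional expectation needs to be checked on them only.
\<close>

lemma conditional_next_letter:
  assumes e: "e \<in> edges M"
  shows "AE \<sigma> in \<Lambda>. real_cond_exp \<Lambda> (past_algebra M) (indicator (cylinder M 1 1 (\<lambda>_. Some e))) \<sigma> = next_prob e \<sigma>"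
proof -
  let ?c = "cylinder M 1 1 (\<lambda>_. Some e)"
  interpret finite_measure_subalgebra \<Lambda> "past_algebra M"
    by unfold_locales (rule past_subalgebra)
  note next_meas [measurable] = measurable_from_subalg[OF past_subalgebra next_prob_measurable[OF e]]
  have c [measurable]: "?c \<in> sets \<Lambda>" by measurable
  have past_sets: "A \<in> sets \<Lambda>" if "A \<in> sets (past_algebra M)" for A
    using past_subalgebra that by (auto simp: subalgebra_def)
  let ?D1 = "density \<Lambda> (indicator ?c)" and ?D2 = "density \<Lambda> (\<lambda>\<sigma>. ennreal (next_prob e \<sigma>))"
  have sub1: "subalgebra ?D1 (past_algebra M)" and sub2: "subalgebra ?D2 (past_algebra M)"
    using past_subalgebra by (simp_all add: subalgebra_def)
  have cyl_past: "cylinder M (- int m) 0 \<eta> \<in> sets (past_algebra M)" if "\<eta> \<in> code_space M" for m \<eta>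
    unfolding sets_past_cylinders using that by (intro sigma_sets.Basic past_cylindersI) auto
  have em1: "emeasure ?D1 A = emeasure \<Lambda> (A \<inter> ?c)" if A: "A \<in> sets (past_algebra M)" for A
  proof -
    have "emeasure ?D1 A = (\<integral>\<^sup>+ \<sigma>. indicator ?c \<sigma> * indicator A \<sigma> \<partial>\<Lambda>)"
      using past_sets[OF A] by (intro emeasure_density) auto
    also have "\<dots> = (\<integral>\<^sup>+ \<sigma>. indicator (A \<inter> ?c) \<sigma> \<partial>\<Lambda>)"
      by (intro nn_integral_cong) (auto simp: indicator_def)
    also have "\<dots> = emeasure \<Lambda> (A \<inter> ?c)" using past_sets[OF A] by (intro nn_integral_indicator) auto
    finally show ?thesis .
  qed
  have int: "integrable \<Lambda> (\<lambda>\<sigma>. indicator A \<sigma> * next_prob e \<sigma>)" if "A \<in> sets \<Lambda>" for A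
    using that next_prob_bounds[OF e] by (intro integrable_const_bound[where B = 1]) (auto simp: indicator_def)
  have em2: "emeasure ?D2 A = ennreal (\<integral> \<sigma>. indicator A \<sigma> * next_prob e \<sigma> \<partial>\<Lambda>)" if A: "A \<in> sets (past_algebra M)" for A
  proof -
    have "emeasure ?D2 A = (\<integral>\<^sup>+ \<sigma>. ennreal (next_prob e \<sigma>) * indicator A \<sigma> \<partial>\<Lambda>)"
      using past_sets[OF A] by (intro emeasure_density) auto
    also have "\<dots> = (\<integral>\<^sup>+ \<sigma>. ennreal (indicator A \<sigma> * next_prob e \<sigma>) \<partial>\<Lambda>)"
      by (intro nn_integral_cong) (simp add: indicator_def)
    also have "\<dots> = ennreal (\<integral> \<sigma>. indicator A \<sigma> * next_prob e \<sigma> \<partial>\<Lambda>)"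
      using next_prob_bounds[OF e] by (intro nn_integral_eq_integral int past_sets[OF A]) auto
    finally show ?thesis .
  qed
  have "restr_to_subalg ?D1 (past_algebra M) = restr_to_subalg ?D2 (past_algebra M)"
  proof (rule past_measure_eqI)
    show "sets (restr_to_subalg ?D1 (past_algebra M)) = sets (past_algebra M)" by (rule sets_restr_to_subalg[OF sub1])
    show "sets (restr_to_subalg ?D2 (past_algebra M)) = sets (past_algebra M)" by (rule sets_restr_to_subalg[OF sub2])
    show "finite_measure (restr_to_subalg ?D1 (past_algebra M))"
    proof (rule finite_measure_restr_to_subalg[OF sub1])
      show "finite_measure ?D1"
        using em1[OF sets.top] by (intro finite_measureI) (simp add: space_\<Lambda>)
    qed
    fix m \<eta> assume \<eta>: "\<eta> \<in> code_space M"
    let ?K = "cylinder M (- int m) 0 \<eta>"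
    let ?w = "window (- int m) (Suc m) \<eta>"
    note Kw = past_cylinder_eq_window[of m \<eta>]
    have K: "?K \<in> sets (past_algebra M)" by (rule cyl_past[OF \<eta>])
    have "emeasure ?D1 ?K = emeasure ?D2 ?K"
    proof (cases "\<exists>w\<in>set_pmf (P (Suc m)). ?w = map Some w")
      case False
      have "emeasure \<Lambda> ?K = 0"
      proof -
        have "AE \<sigma> in \<Lambda>. \<sigma> \<notin> ?K"
          using AE_window[of "Suc m" "- int m"] by eventually_elim (use False in \<open>auto simp: Kw\<close>)
        then show ?thesis using AE_iff_null_sets[OF past_sets[OF K]] by auto
      qed
      then have "?K \<in> null_sets \<Lambda>" using past_sets[OF K] by auto
      then have "?K \<in> null_sets ?D1" "?K \<in> null_sets ?D2"
        by (auto simp: null_sets_density_iff AE_not_in intro: AE_mp[OF AE_not_in])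
      then show ?thesis by (simp only: null_setsD1)
    next
      case True
      then obtain w where w: "w \<in> set_pmf (P (Suc m))" "?w = map Some w" by blast
      have "?K \<inter> ?c = {\<sigma> \<in> space \<Lambda>. window (- int m) (Suc (Suc m)) \<sigma> \<in> {map Some (w @ [e])}}"
        unfolding Kw w(2) by (subst window_snoc) (auto simp: cylinder_def space_\<Lambda>)
      then have "emeasure \<Lambda> (?K \<inter> ?c) = emeasure (map_pmf (map Some) (P (Suc (Suc m)))) {map Some (w @ [e])}"
        by (simp only: emeasure_window)
      also have "\<dots> = ennreal (pmf (P (Suc (Suc m))) (w @ [e]))"
        unfolding emeasure_pmf_single by (subst pmf_map_inj') (auto intro: inj_mapI)
      also have "\<dots> = ennreal (\<integral> \<sigma>. indicator ?K \<sigma> * next_prob e \<sigma> \<partial>\<Lambda>)"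
        using next_letter_on_cylinder[OF e w(1)] by (simp add: Kw w(2))
      finally show ?thesis by (simp only: em1[OF K] em2[OF K])
    qed
    then show "emeasure (restr_to_subalg ?D1 (past_algebra M)) ?K = emeasure (restr_to_subalg ?D2 (past_algebra M)) ?K"
      by (simp only: emeasure_restr_to_subalg[OF sub1 K] emeasure_restr_to_subalg[OF sub2 K])
  qed
  then have eq: "emeasure ?D1 A = emeasure ?D2 A" if "A \<in> sets (past_algebra M)" for A
    using emeasure_restr_to_subalg[OF sub1 that] emeasure_restr_to_subalg[OF sub2 that] by simp
  show ?thesis
  proof (rule real_cond_exp_charact)
    fix A assume A: "A \<in> sets (past_algebra M)"
    have "(\<integral>\<sigma>\<in>A. indicator ?c \<sigma> \<partial>\<Lambda>) = measure \<Lambda> (A \<inter> ?c)"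
    proof -
      have "(\<integral>\<sigma>\<in>A. indicator ?c \<sigma> \<partial>\<Lambda>) = (\<integral>\<sigma>. (indicator (A \<inter> ?c) \<sigma> :: real) \<partial>\<Lambda>)"
        unfolding set_lebesgue_integral_def by (intro Bochner_Integration.integral_cong) (auto simp: indicator_def)
      moreover have "A \<inter> ?c \<inter> space \<Lambda> = A \<inter> ?c" by (auto simp: cylinder_def space_\<Lambda>)
      ultimately show ?thesis by simp
    qed
    also have "\<dots> = (\<integral>\<sigma>. indicator A \<sigma> * next_prob e \<sigma> \<partial>\<Lambda>)"
    proof -
      have "ennreal (measure \<Lambda> (A \<inter> ?c)) = ennreal (\<integral>\<sigma>. indicator A \<sigma> * next_prob e \<sigma> \<partial>\<Lambda>)"
        using eq[OF A] em1[OF A] em2[OF A] by (simp add: emeasure_eq_measure)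
      then show ?thesis
        using next_prob_bounds[OF e] by (subst (asm) ennreal_inj) (auto intro!: Bochner_Integration.integral_nonneg)
    qed
    also have "\<dots> = (\<integral>\<sigma>\<in>A. next_prob e \<sigma> \<partial>\<Lambda>)" by (simp add: set_lebesgue_integral_def)
    finally show "(\<integral>\<sigma>\<in>A. indicator ?c \<sigma> \<partial>\<Lambda>) = (\<integral>\<sigma>\<in>A. next_prob e \<sigma> \<partial>\<Lambda>)" .
  next
    show "integrable \<Lambda> (indicator ?c :: _ \<Rightarrow> real)" by (simp add: integrable_real_indicator[OF c] less_top[symmetric])
    show "integrable \<Lambda> (next_prob e)"
      using next_prob_bounds[OF e] by (intro integrable_const_bound[where B = 1]) auto
    show "next_prob e \<in> borel_measurable (past_algebra M)" by (rule next_prob_measurable[OF e])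
  qed
qed

theorem stationary_limit_in_Etilde: "\<Lambda> \<in> Etilde M x"
proof -
  have D: "emeasure \<Lambda> (Dset M x) = 1"
  proof -
    have "Dset M x = Sigma_G M \<inter> {\<sigma> \<in> space (past_algebra M). convergent (past_point M x \<sigma>)}"
      by (auto simp: Dset_def Sigma_GD(3))
    also have "\<dots> \<in> sets \<Lambda>"
      using Sigma_G_measurable past_convergent_measurable past_subset unfolding sets_\<Lambda> by blast
    finally have m: "Dset M x \<in> sets \<Lambda>" .
    have "measure \<Lambda> (Dset M x) = 1" using AE_Dset by (subst prob_eq_1[OF m])
    then show ?thesis by (simp add: emeasure_eq_measure)
  qed
  have "AE \<sigma> in \<Lambda>. real_cond_exp \<Lambda> (past_algebra M) (indicator (cylinder M 1 1 (\<lambda>_. Some e))) \<sigma> =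
      pbar M e (Fmap M x \<sigma>) * indicator (Tset M (src M e)) \<sigma>" if e: "e \<in> edges M" for e
    using conditional_next_letter[OF e] AE_Sigma_G
  proof eventually_elim
    case (elim \<sigma>)
    then show ?case by (simp add: next_prob_def Fmap_eq_limit_point Tset_def indicator_def)
  qed
  then show ?thesis
    using sets_\<Lambda> prob_\<Lambda> shift_invariant D by (auto simp: Etilde_def shift_invariant_probs_def)
qed

end

context contractive_markov
begin

theorem Etilde_nonempty:
  assumes "dominating_chain M" "alpha_tight M y"
  shows "Etilde M x \<noteq> {}"
proof -
  obtain r P where r: "strict_mono r" and lim: "\<And>L w. (\<lambda>n. pmf (words y (r n) L) w) \<longlonglongrightarrow> pmf (P L) w"
    using limit_words[OF assms] by blast
  interpret limit_chain M x a b y r P by unfold_locales (rule r, rule lim)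
  let ?P = "\<lambda>L. map_pmf (map Some) (P L)"
  have "\<exists>\<Lambda>. sets \<Lambda> = sets (\<Pi>\<^sub>M i\<in>(UNIV :: int set). count_space letters) \<and> prob_space \<Lambda> \<and>
    (\<forall>k w. emeasure \<Lambda> {\<sigma> \<in> space \<Lambda>. \<forall>i<length w. \<sigma> (k + int i) = w ! i} = ennreal (pmf (?P (length w)) w))"
  proof (rule stationary_process_of_consistent_words)
    show "countable letters" by simp
    fix n w assume "w \<in> set_pmf (?P n)"
    then obtain v where v: "v \<in> set_pmf (P n)" "w = map Some v" by auto
    then show "length w = n" using P_support by auto
    show "set w \<subseteq> letters" using v P_support[OF v(1)] admissible_edges by (force simp: letters_def)
  next
    fix n
    show "map_pmf butlast (?P (Suc n)) = ?P n"
      using P_butlast[of n, symmetric] by (simp add: pmf.map_comp comp_def map_butlast)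
    show "map_pmf tl (?P (Suc n)) = ?P n"
      using P_tl[of n, symmetric] by (simp add: pmf.map_comp comp_def map_tl)
  qed
  then obtain \<Lambda> where \<Lambda>: "sets \<Lambda> = sets (\<Pi>\<^sub>M i\<in>(UNIV :: int set). count_space letters)" "prob_space \<Lambda>"
    "\<And>k w. emeasure \<Lambda> {\<sigma> \<in> space \<Lambda>. \<forall>i<length w. \<sigma> (k + int i) = w ! i} = ennreal (pmf (?P (length w)) w)"
    by blast
  have "sets \<Lambda> = sets (code_borel M)" using \<Lambda>(1) by (simp add: sets_code_borel)
  then have "stationary_limit_axioms M P \<Lambda>"
    by (rule stationary_limit_axioms.intro) (rule \<Lambda>(2), rule \<Lambda>(3))
  then interpret stationary_limit M x a b y r P \<Lambda>
    by (rule stationary_limit.intro[OF limit_chain_axioms])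
  show ?thesis using stationary_limit_in_Etilde by blast
qed

end

section \<open>Existence and tightness of invariant measures\<close>

theorem corollary2:
  fixes M :: "('k :: complete_space, 'e) markov_sys" and x :: "nat \<Rightarrow> 'k"
  assumes "markov_system M"
    and "\<And>j. j \<in> idx M \<Longrightarrow> x j \<in> cell M j"
    and "contractive M"
    and "uniformly_continuous_system M"
    and "bsup M x < \<infinity>"
  shows
    "(nondegenerate M x \<and> dominating_chain M \<longrightarrow>
        (invariant_probs M \<noteq> {} \<longleftrightarrow> (\<exists>x0. alpha_tight M x0)))
     \<and> (consistent M x \<and> dominating_chain M \<and> (\<exists>x0. alpha_tight M x0) \<longrightarrow>
          invariant_probs M \<noteq> {})
     \<and> (\<forall>\<mu> \<in> invariant_probs M. uniformly_tight {\<mu>})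
     \<and> ((\<forall>j \<in> idx M. finite (out_edges M j) \<and> finite (in_edges M j)) \<longrightarrow>
          (\<forall>c \<subseteq> idx M. finite c \<longrightarrow> (\<forall>\<epsilon>::real. \<epsilon> > 0 \<longrightarrow>
             (\<exists>C. compact C \<and> (\<forall>\<mu> \<in> invariant_probs M.
                measure \<mu> C > measure \<mu> (\<Union>j \<in> c. cell M j) - \<epsilon>)))))
     \<and> (finite (edges M) \<longrightarrow> uniformly_tight (invariant_probs M))"
proof -
  obtain a where a: "0 < a" "a < 1" "\<And>j y z. j \<in> idx M \<Longrightarrow> y \<in> cell M j \<Longrightarrow> z \<in> cell M j \<Longrightarrow>
        (\<integral>\<^sup>+ e. ennreal (pr M e y * dist (mp M e y) (mp M e z)) \<partial>count_space (out_edges M j))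
          \<le> ennreal (a * dist y z)"
    using assms(3) unfolding contractive_def by blast
  obtain b where b: "0 \<le> b" "bsup M x = ennreal b"
    using assms(5) by (cases "bsup M x") auto
  interpret contractive_markov M x a b
    by unfold_locales (use assms a b in auto)
  have nonempty: "invariant_probs M \<noteq> {}"
    if dom: "dominating_chain M" and tight: "alpha_tight M y" and "nondegenerate M x \<or> consistent M x" for y
  proof -
    obtain \<Lambda> where \<Lambda>: "\<Lambda> \<in> Etilde M x" using Etilde_nonempty[OF dom tight] by blast
    from that(3) show ?thesis
    proof
      assume "nondegenerate M x"
      then obtain j where "j \<in> idx M" "emeasure \<Lambda> (Tset M j \<inter> Fmap M x -` cell M j) > 0"
        using \<Lambda> unfolding nondegenerate_def by blast
      then show ?thesis by (rule nondegenerate_imp_invariant[OF \<Lambda>])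
    next
      assume "consistent M x"
      then show ?thesis using \<Lambda> unfolding consistent_def by blast
    qed
  qed
  have iv: "\<exists>C. compact C \<and> (\<forall>\<mu> \<in> invariant_probs M. measure \<mu> C > measure \<mu> (\<Union>j \<in> c. cell M j) - \<epsilon>)"
    if fin: "\<forall>j \<in> idx M. finite (in_edges M j)" and c: "c \<subseteq> idx M" "finite c" and \<epsilon>: "\<epsilon> > 0" for c and \<epsilon> :: real
  proof -
    obtain C where C: "compact C" "\<And>\<mu>. \<mu> \<in> invariant_probs M \<Longrightarrow> emeasure \<mu> ((\<Union>j\<in>c. cell M j) - C) < ennreal \<epsilon>"
      using invariant_tight_on_cells[OF _ c \<epsilon>] fin by blast
    have "measure \<mu> C > measure \<mu> (\<Union>j \<in> c. cell M j) - \<epsilon>" if \<mu>: "\<mu> \<in> invariant_probs M" for \<mu>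
    proof -
      interpret \<mu>: prob_space \<mu> by (rule invariantD[OF \<mu>])
      have [simp]: "C \<in> sets \<mu>" "(\<Union>j \<in> c. cell M j) \<in> sets \<mu>"
        using C(1) sets.finite_UN[OF c(2), of "cell M" borel] c(1) cell_borel
        unfolding invariantD(1)[OF \<mu>] by (blast intro: borel_compact)+
      have "measure \<mu> (\<Union>j \<in> c. cell M j) \<le> measure \<mu> (C \<union> ((\<Union>j\<in>c. cell M j) - C))"
        by (intro \<mu>.finite_measure_mono) auto
      also have "\<dots> \<le> measure \<mu> C + measure \<mu> ((\<Union>j\<in>c. cell M j) - C)"
        by (intro measure_Un_le) auto
      also have "measure \<mu> ((\<Union>j\<in>c. cell M j) - C) < \<epsilon>"
        using C(2)[OF \<mu>] by (simp add: \<mu>.emeasure_eq_measure ennreal_less_iff)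
      finally show ?thesis by simp
    qed
    then show ?thesis using C(1) by blast
  qed
  have v: "uniformly_tight (invariant_probs M)" if fin: "finite (edges M)"
    unfolding uniformly_tight_def
  proof (intro allI impI)
    fix \<epsilon> :: real assume \<epsilon>: "\<epsilon> > 0"
    have "finite (idx M)" using fin src_surj by (metis finite_imageI)
    moreover have "finite (in_edges M j)" for j using fin by (simp add: in_edges_def)
    ultimately obtain C where "compact C" "\<And>\<mu>. \<mu> \<in> invariant_probs M \<Longrightarrow> emeasure \<mu> ((\<Union>j\<in>idx M. cell M j) - C) < ennreal \<epsilon>"
      using invariant_tight_on_cells[OF _ order_refl _ \<epsilon>] by blast
    then show "\<exists>C. compact C \<and> (\<forall>\<Lambda>\<in>invariant_probs M. emeasure \<Lambda> (UNIV - C) < ennreal \<epsilon>)"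
      unfolding cell_cover by blast
  qed
  show ?thesis
  proof (intro conjI impI ballI allI)
    assume *: "nondegenerate M x \<and> dominating_chain M"
    show "invariant_probs M \<noteq> {} \<longleftrightarrow> (\<exists>x0. alpha_tight M x0)"
    proof
      assume "invariant_probs M \<noteq> {}"
      then obtain \<mu> where "\<mu> \<in> invariant_probs M" by blast
      then show "\<exists>x0. alpha_tight M x0" by (rule invariant_imp_alpha_tight)
    next
      assume "\<exists>x0. alpha_tight M x0"
      then obtain x0 where "alpha_tight M x0" by blast
      then show "invariant_probs M \<noteq> {}" using * nonempty[of x0] by simp
    qed
  next
    assume *: "consistent M x \<and> dominating_chain M \<and> (\<exists>x0. alpha_tight M x0)"
    then obtain x0 where "alpha_tight M x0" by blast
    then show "invariant_probs M \<noteq> {}" using * nonempty[of x0] by simp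
  next
    fix \<mu> assume "\<mu> \<in> invariant_probs M"
    then show "uniformly_tight {\<mu>}" by (rule invariant_tight)
  next
    fix c and \<epsilon> :: real
    assume "\<forall>j \<in> idx M. finite (out_edges M j) \<and> finite (in_edges M j)" "c \<subseteq> idx M" "finite c" "\<epsilon> > 0"
    then show "\<exists>C. compact C \<and> (\<forall>\<mu> \<in> invariant_probs M. measure \<mu> C > measure \<mu> (\<Union>j \<in> c. cell M j) - \<epsilon>)"
      by (intro iv) auto
  qed (rule v)
qed

end
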